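(* Suppose that $r>0$, $1<p<\infty$, $0<q<\infty$, $\alpha>-1$ and that $\mu\in\mathcal{M}_+$. Then the following conditions are equivalent: (1) $T_\mu$ is bounded on $A_\alpha^p(T_B)$. (2) $\widetilde{\mu}$ is a bounded function on $T_B$. (3) $\widehat{\mu}_r$ is a bounded function on $T_B$. (4) $\mu$ is a Carleson measure for $A_\alpha^q(T_B)$.
   Context: For $z=(z',z_n)\in\mathbb{C}^n$ with $z'=(z_1,\dots,z_{n-1})$, write $z'^2=z_1^2+\cdots+z_{n-1}^2$. Let $B=\{(y',y_n)\in\mathbb{R}^n: y_1^2+\cdots+y_{n-1}^2<y_n\}$ and $T_B=\{x+iy\in\mathbb{C}^n: x\in\mathbb{R}^n,\ y\in B\}$. Put $\rho(z,w)=\frac14\left((z'-\overline{w'})^2-2i(z_n-\overline{w_n})\right)$ and $\rho(z)=\rho(z,z)=y_n-y'^2$ for $z=x+iy$. For $z,w\in T_B$ one has $\operatorname{Re}\rho(z,w)>0$, and powers of $\rho(z,w)$ use the principal branch. Let $\mathbf{i}=(0',i)\in T_B$. For $\alpha>-1$ let $dV_\alpha(z)=\rho(z)^\alpha dV(z)$ with $dV$ Lebesgue measure on $\mathbb{C}^n$. For $0<p<\infty$, $\|f\|_{p,\alpha}=\left(\int_{T_B}|f|^p\,dV_\alpha\right)^{1/p}$, and $A_\alpha^p(T_B)$ is the space of holomorphic $f$ on $T_B$ with $\|f\|_{p,\alpha}<\infty$. The weighted Bergman kernel is $$K_\alpha(z,w)=\frac{\Gamma(n+\alpha+1)}{2^{n+1}\pi^n\Gamma(\alpha+1)\,\rho(z,w)^{n+\alpha+1}}.$$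 The Bergman metric on $T_B$ is $\beta(z,w)=\tanh^{-1}\sqrt{1-\frac{\rho(z)\rho(w)}{|\rho(z,w)|^2}}$, and $D(z,r)=\{w\in T_B:\beta(z,w)<r\}$. For a positive Borel measure $\mu$ on $T_B$: - $\widetilde\mu(z)=\int_{T_B}|k_z(w)|^2\,d\mu(w)$, where $k_z(w)=K_\alpha(z,w)/\sqrt{K_\alpha(z,z)}$. - $\widehat\mu_r(z)=\mu(D(z,r))/V_\alpha(D(z,r))$. - $\mu$ is a Carleson measure for $A_\alpha^q(T_B)$ if there is $C>0$ with $\int_{T_B}|f|^q\,d\mu\le C\|f\|_{q,\alpha}^q$ for all $f\in A_\alpha^q(T_B)$. - $\mathcal{M}_+$ is the set of all positive Borel measures $\mu$ on $T_B$ such that $\int_{T_B}|\rho(z,\mathbf{i})|^{-t}\,d\mu(z)<\infty$ for some $t>0$. For $t\in\mathbb{R}$, $S_t$ is the space of holomorphic $f$ on $T_B$ with $\sup_{z\in T_B}|\rho(z,\mathbf{i})|^t|f(z)|<\infty$. The Toeplitz operator is $T_\mu f(z)=\int_{T_B}K_\alpha(z,w)f(w)\,d\mu(w)$. For $\mu\in\mathcal{M}_+$ it is defined (by an absolutely convergent integral) on $S_t$ whenever $t>n+(\alpha+1)/p$ and $\int_{T_B}|\rho(z,\mathbf{i})|^{-t}d\mu(z)<\infty$; such $S_t$ is a dense subspace of $A_\alpha^p(T_B)$. "$T_\mu$ is bounded on $A_\alpha^p(T_B)$" means that, for some such $t$, $T_\mu$ maps $S_t$ into $A^p_\alpha(T_B)$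 and extends to a bounded operator on $A_\alpha^p(T_B)$, i.e. there is $C>0$ with $\|T_\mu f\|_{p,\alpha}\le C\|f\|_{p,\alpha}$ for all $f\in S_t$. *)

theory Defs
  imports "HOL-Analysis.Analysis"
begin

text \<open>
  \<open>\<complex>\<^sup>n\<close> is \<^typ>\<open>complex ^ 'n\<close> with \<open>n = CARD('n) \<ge> 1\<close>. The linear order on the index type
  only serves to single out the last coordinate \<open>z\<^sub>n\<close>; for \<open>n = 1\<close> the part \<open>z'\<close> is empty.
\<close>

type_synonym 'n cvec = "(complex, 'n) vec"

definition last_ix :: "'n::{finite,linorder}" where
  "last_ix = Max UNIV"

definition B :: "(real ^ 'n::{finite,linorder}) set" where
  "B = {y. (\<Sum>j\<in>UNIV - {last_ix}. (y $ j)\<^sup>2) < y $ last_ix}"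

definition T_B :: "'n::{finite,linorder} cvec set" where
  "T_B = {z. (\<chi> j. Im (z $ j)) \<in> B}"

definition rho :: "'n::{finite,linorder} cvec \<Rightarrow> 'n cvec \<Rightarrow> complex" where
  "rho z w = 1/4 * ((\<Sum>j\<in>UNIV - {last_ix}. (z $ j - cnj (w $ j))\<^sup>2)
                    - 2 * \<i> * (z $ last_ix - cnj (w $ last_ix)))"

definition rho1 :: "'n::{finite,linorder} cvec \<Rightarrow> real" where
  "rho1 z = Im (z $ last_ix) - (\<Sum>j\<in>UNIV - {last_ix}. (Im (z $ j))\<^sup>2)"

lemma rho_diag: "rho z z = of_real (rho1 z)"
proof -
  have 1: "(z $ j - cnj (z $ j))\<^sup>2 = of_real (- 4 * (Im (z $ j))\<^sup>2)" for j
    by (simp add: complex_eq_iff power2_eq_square)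
  have 2: "2 * \<i> * (z $ last_ix - cnj (z $ last_ix)) = of_real (- 4 * Im (z $ last_ix))"
    by (simp add: complex_eq_iff)
  show ?thesis
    unfolding rho_def 1 2 of_real_sum[symmetric] sum_distrib_left[symmetric] rho1_def
    by (simp add: complex_eq_iff)
qed

definition base_pt :: "'n::{finite,linorder} cvec" where
  "base_pt = axis last_ix \<i>"

text \<open>
  Holomorphy in several variables: Frechet differentiable with complex-linear derivative at
  every point. It is only used for the open set \<^const>\<open>T_B\<close>.
\<close>

definition holomorphic_several_on :: "('n::finite cvec \<Rightarrow> complex) \<Rightarrow> 'n cvec set \<Rightarrow> bool" where
  "holomorphic_several_on f S \<longleftrightarrow>
     (\<forall>z\<in>S. \<exists>f'. (f has_derivative f') (at z) \<and> (\<forall>c v. f' (c *s v) = c * f' v))"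

text \<open>
  All measures live on the space \<^const>\<open>T_B\<close> itself, so integrals against them are
  integrals over \<^const>\<open>T_B\<close>, and values of functions outside \<^const>\<open>T_B\<close> play no role.
\<close>

definition V_meas :: "real \<Rightarrow> 'n::{finite,linorder} cvec measure" where
  "V_meas \<alpha> = density (restrict_space lborel T_B) (\<lambda>z. ennreal (rho1 z powr \<alpha>))"

definition A_space :: "real \<Rightarrow> real \<Rightarrow> ('n::{finite,linorder} cvec \<Rightarrow> complex) set" where
  "A_space p \<alpha> = {f. holomorphic_several_on f T_B \<and>
                     (\<integral>\<^sup>+z. ennreal (norm (f z) powr p) \<partial>V_meas \<alpha>) < \<infinity>}"

text \<open>Real-valued, hence meaningful only where the integral is finite, as on \<^const>\<open>A_space\<close>.\<close>

definition A_norm :: "real \<Rightarrow> real \<Rightarrow> ('n::{finite,linorder} cvec \<Rightarrow> complex) \<Rightarrow> real" where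
  "A_norm p \<alpha> f = enn2real (\<integral>\<^sup>+z. ennreal (norm (f z) powr p) \<partial>V_meas \<alpha>) powr (1 / p)"

definition K_kernel ::
  "real \<Rightarrow> 'n::{finite,linorder} cvec \<Rightarrow> 'n cvec \<Rightarrow> complex" where
  "K_kernel \<alpha> z w =
     of_real (Gamma (real CARD('n) + \<alpha> + 1)) /
     (of_real (2 ^ (CARD('n) + 1) * pi ^ CARD('n) * Gamma (\<alpha> + 1)) *
      rho z w powr of_real (real CARD('n) + \<alpha> + 1))"

definition k_normalized ::
  "real \<Rightarrow> 'n::{finite,linorder} cvec \<Rightarrow> 'n cvec \<Rightarrow> complex" where
  "k_normalized \<alpha> z w = K_kernel \<alpha> z w / csqrt (K_kernel \<alpha> z z)"

definition bergman_dist :: "'n::{finite,linorder} cvec \<Rightarrow> 'n cvec \<Rightarrow> real" where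
  "bergman_dist z w = artanh (sqrt (1 - rho1 z * rho1 w / (norm (rho z w))\<^sup>2))"

definition D_ball :: "'n::{finite,linorder} cvec \<Rightarrow> real \<Rightarrow> 'n cvec set" where
  "D_ball z r = {w \<in> T_B. bergman_dist z w < r}"

definition M_plus :: "'n::{finite,linorder} cvec measure set" where
  "M_plus = {\<mu>. sets \<mu> = sets (restrict_space borel T_B) \<and>
                (\<exists>t>0. (\<integral>\<^sup>+z. ennreal (norm (rho z base_pt) powr (- t)) \<partial>\<mu>) < \<infinity>)}"

definition berezin ::
  "real \<Rightarrow> 'n::{finite,linorder} cvec measure \<Rightarrow> 'n cvec \<Rightarrow> ennreal" where
  "berezin \<alpha> \<mu> z = (\<integral>\<^sup>+w. ennreal ((norm (k_normalized \<alpha> z w))\<^sup>2) \<partial>\<mu>)"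

definition averaging ::
  "real \<Rightarrow> real \<Rightarrow> 'n::{finite,linorder} cvec measure \<Rightarrow> 'n cvec \<Rightarrow> ennreal" where
  "averaging \<alpha> r \<mu> z = emeasure \<mu> (D_ball z r) / emeasure (V_meas \<alpha>) (D_ball z r)"

definition bounded_on_T_B :: "('n::{finite,linorder} cvec \<Rightarrow> ennreal) \<Rightarrow> bool" where
  "bounded_on_T_B g \<longleftrightarrow> (\<exists>C::real. \<forall>z\<in>T_B. g z \<le> ennreal C)"

definition carleson ::
  "real \<Rightarrow> real \<Rightarrow> 'n::{finite,linorder} cvec measure \<Rightarrow> bool" where
  "carleson q \<alpha> \<mu> \<longleftrightarrow>
     (\<exists>C>0. \<forall>f\<in>A_space q \<alpha>.
        (\<integral>\<^sup>+z. ennreal (norm (f z) powr q) \<partial>\<mu>) \<le> ennreal (C * A_norm q \<alpha> f powr q))"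

definition S_space :: "real \<Rightarrow> ('n::{finite,linorder} cvec \<Rightarrow> complex) set" where
  "S_space t = {f. holomorphic_several_on f T_B \<and>
                   bdd_above ((\<lambda>z. norm (rho z base_pt) powr t * norm (f z)) ` T_B)}"

definition toeplitz ::
  "real \<Rightarrow> 'n::{finite,linorder} cvec measure \<Rightarrow>
   ('n cvec \<Rightarrow> complex) \<Rightarrow> 'n cvec \<Rightarrow> complex" where
  "toeplitz \<alpha> \<mu> f z = (\<integral>w. K_kernel \<alpha> z w * f w \<partial>\<mu>)"

text \<open>
  Boundedness on \<open>A\<^sup>p\<^sub>\<alpha>\<close> of the operator densely defined on \<^term>\<open>S_space t\<close>; the two
  conditions on \<open>t\<close> make \<^term>\<open>S_space t\<close> a dense subspace of \<open>A\<^sup>p\<^sub>\<alpha>\<close> on which the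
  integral defining \<^const>\<open>toeplitz\<close> converges absolutely.
\<close>

definition toeplitz_bounded ::
  "real \<Rightarrow> real \<Rightarrow> 'n::{finite,linorder} cvec measure \<Rightarrow> bool" where
  "toeplitz_bounded p \<alpha> \<mu> \<longleftrightarrow>
     (\<exists>t > real CARD('n) + (\<alpha> + 1) / p.
        (\<integral>\<^sup>+z. ennreal (norm (rho z base_pt) powr (- t)) \<partial>\<mu>) < \<infinity> \<and>
        (\<exists>C>0. \<forall>f\<in>S_space t.
           toeplitz \<alpha> \<mu> f \<in> A_space p \<alpha> \<and> A_norm p \<alpha> (toeplitz \<alpha> \<mu> f) \<le> C * A_norm p \<alpha> f))"

end

theory Submission
  imports Defs "HOL-Complex_Analysis.Cauchy_Integral_Formula"
begin

text \<open>
  Affine automorphisms act transitively on \<^const>\<open>T_B\<close> and scale \<^const>\<open>rho\<close>, so kernel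
  integrals, volumes of Bergman balls and the sub-mean value inequality need to be estimated at
  the base point only. All four conditions are equivalent to \<open>\<mu>(D(z,r)) \<le> C \<rho>(z)\<^bsup>n+\<alpha>+1\<^esup>\<close>. This bound
  gives the Carleson inequality for every \<open>q\<close> by integrating the sub-mean value inequality of
  \<open>|f|\<^sup>q\<close> over \<open>D(z,r)\<close> against \<open>\<mu>\<close> and exchanging the integrals, and the case \<open>q = 1\<close> dominates
  \<open>T\<^sub>\<mu>\<close> by a positive integral operator that is bounded by Schur's test. Conversely, the Carleson
  inequality is tested on powers of \<open>\<rho>(\<cdot>,z)\<close>. The kernel itself need not lie in \<open>S\<^sub>t\<close> for the given
  \<open>t\<close>, so the boundedness of \<open>T\<^sub>\<mu>\<close> is tested on \<open>f = \<rho>(\<cdot>,z)\<^bsup>-(n+\<alpha>+1+k)\<^esup>\<close> with \<open>k \<ge> t\<close>, and the \<open>k\<close>-th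
  derivative of \<open>T\<^sub>\<mu> f\<close> at \<open>z\<close> in the direction of the last coordinate is, up to a constant,
  \<open>\<integral>|\<rho>(z,w)|\<^bsup>-2(n+\<alpha>+1+k)\<^esup> d\<mu>(w)\<close>, an integral of a positive function.
\<close>

section \<open>Automorphisms and Bergman balls\<close>

text \<open>All exponents come from one scaling rule. The automorphism taking the base point to z
  multiplies \<open>rho\<close> by \<rho>(z) and Lebesgue measure by \<rho>(z)^(n+1), hence the
  weighted volume by \<rho>(z)^N with N = n+\<alpha>+1. So balls have volume a constant times
  \<rho>(z)^N, and |\<rho>(z,w)|^(-b) has weighted integral at most a constant times \<rho>(z)^(N-b)
  if b > N. The kernel itself has b = N, the borderline, which is why Schur's test comes with an
  auxiliary power of \<rho>. Two obstacles shape the rest. Invariance of Lebesgue measure is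
  obtained from coordinate shears, whose coefficients may be nonlinear; this also covers the
  quadratic map that flattens \<open>T_B\<close>. And the Toeplitz bound is known only for one t,
  possibly large: the test function must decay faster than the kernel, which keeps the exponent N.
  Along the last coordinate the derivative of \<rho> is the constant -i/2, so each derivative raises
  the exponent by exactly one, until kernel and test function are conjugate to each other. Cauchy's
  inequality on a disc of radius \<rho>(z)/2 pays a factor \<rho>(z)^(-k) for this, as the scaling
  predicts.\<close>

lemma T_B_iff: "z \<in> T_B \<longleftrightarrow> rho1 z > 0"
  by (simp add: T_B_def B_def rho1_def)

lemma cnj_rho: "cnj (rho z w) = rho w z"
  unfolding rho_def by (simp add: power2_commute algebra_simps)

lemma norm_rho_commute: "norm (rho z w) = norm (rho w z)"
  by (metis cnj_rho complex_mod_cnj)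

text \<open>In one coordinate, Re (a - cnj b)^2 is |a - b|^2 - 2 (Im a)^2 - 2 (Im b)^2, and the last
  two terms combine with Im z_n and Im w_n into the two values of \<open>rho1\<close>. Positivity of
  the real part, the use of the principal branch and the lower bounds on
  \<open>norm (rho z w)\<close> all rest on this identity.\<close>

lemma Re_rho:
  "Re (rho z w) = ((\<Sum>j\<in>UNIV - {last_ix}. (Re (z $ j) - Re (w $ j))\<^sup>2 + (Im (z $ j) - Im (w $ j))\<^sup>2)
      + 2 * rho1 z + 2 * rho1 w) / 4"
proof -
  have *: "Re (a - cnj b)^2 - Im (a - cnj b)^2 =
     (Re a - Re b)^2 + (Im a - Im b)^2 - 2 * (Im a)^2 - 2 * (Im b)^2" for a b
    by (simp add: power2_eq_square algebra_simps)
  have "(\<Sum>j\<in>UNIV - {last_ix}. Re ((z $ j - cnj (w $ j))\<^sup>2)) =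
    (\<Sum>j\<in>UNIV - {last_ix}. (Re (z $ j) - Re (w $ j))\<^sup>2 + (Im (z $ j) - Im (w $ j))\<^sup>2)
    - 2 * (\<Sum>j\<in>UNIV - {last_ix}. (Im (z $ j))\<^sup>2) - 2 * (\<Sum>j\<in>UNIV - {last_ix}. (Im (w $ j))\<^sup>2)"
    unfolding Re_power2 * by (simp add: sum.distrib sum_subtractf sum_distrib_left)
  then show ?thesis
    unfolding rho_def rho1_def by simp
qed

lemma Re_rho_ge: "Re (rho z w) \<ge> (rho1 z + rho1 w) / 2"
  unfolding Re_rho by (simp add: sum_nonneg)

lemma Re_rho_pos: "z \<in> T_B \<Longrightarrow> w \<in> T_B \<Longrightarrow> Re (rho z w) > 0"
  using Re_rho_ge[of z w] by (simp add: T_B_iff)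

lemma rho_nonzero: "z \<in> T_B \<Longrightarrow> w \<in> T_B \<Longrightarrow> rho z w \<noteq> 0"
  using Re_rho_pos by force

lemma rho_notin_nonpos: "z \<in> T_B \<Longrightarrow> w \<in> T_B \<Longrightarrow> rho z w \<notin> \<real>\<^sub>\<le>\<^sub>0"
  using Re_rho_pos by (force simp: complex_nonpos_Reals_iff)

lemma norm_rho_ge: "norm (rho z w) \<ge> (rho1 z + rho1 w) / 2"
  using Re_rho_ge[of z w] complex_Re_le_cmod[of "rho z w"] by linarith

lemma rho1_le_right: "z \<in> T_B \<Longrightarrow> rho1 w \<le> 2 * norm (rho z w)"
  using norm_rho_ge[of z w] by (simp add: T_B_iff)

lemma norm_rho_pos: "z \<in> T_B \<Longrightarrow> w \<in> T_B \<Longrightarrow> norm (rho z w) > 0"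
  using rho_nonzero by auto

text \<open>The arithmetic-geometric mean inequality on top of \<open>norm_rho_ge\<close>. It puts
  the argument of the square root in \<open>bergman_dist\<close> between 0 and 1.\<close>

lemma rho1_mult_le: "z \<in> T_B \<Longrightarrow> w \<in> T_B \<Longrightarrow> rho1 z * rho1 w \<le> (norm (rho z w))\<^sup>2"
proof -
  assume "z \<in> T_B" "w \<in> T_B"
  then have "((rho1 z + rho1 w) / 2)\<^sup>2 \<le> (norm (rho z w))\<^sup>2"
    by (intro power_mono norm_rho_ge) (simp add: T_B_iff)
  moreover have "rho1 z * rho1 w \<le> ((rho1 z + rho1 w) / 2)\<^sup>2"
    using sum_squares_bound[of "rho1 z" "rho1 w"] by (simp add: power2_eq_square field_simps)
  ultimately show ?thesis by simp
qed

lemma rho1_base_pt [simp]: "rho1 base_pt = 1"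
  by (simp add: rho1_def base_pt_def axis_def)

lemma base_pt_in_T_B [simp]: "base_pt \<in> T_B"
  by (simp add: T_B_iff)

lemma norm_rho_base_ge: "z \<in> T_B \<Longrightarrow> norm (rho z base_pt) \<ge> 1/2"
  using norm_rho_ge[of z base_pt] by (simp add: T_B_iff)

lemma continuous_on_rho [continuous_intros]:
  assumes "continuous_on S f" "continuous_on S g"
  shows "continuous_on S (\<lambda>x. rho (f x) (g x))"
  unfolding rho_def by (intro continuous_intros assms)

lemma continuous_on_rho1 [continuous_intros]:
  assumes "continuous_on S f"
  shows "continuous_on S (\<lambda>x. rho1 (f x))"
  unfolding rho1_def by (intro continuous_intros assms)

lemma open_T_B: "open (T_B :: 'n::{finite,linorder} cvec set)"
proof -
  have "open {z :: 'n cvec. 0 < rho1 z}"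
    by (intro open_Collect_less continuous_intros)
  then show ?thesis by (simp add: T_B_iff[symmetric])
qed

lemma T_B_borel [measurable]: "T_B \<in> sets borel"
  by (rule borel_open[OF open_T_B])

lemma rho1_measurable [measurable]: "rho1 \<in> borel_measurable borel"
  by (intro borel_measurable_continuous_onI continuous_intros)

lemma rho_measurable [measurable]: "(\<lambda>x. rho (fst x) (snd x)) \<in> borel_measurable borel"
  by (intro borel_measurable_continuous_onI continuous_intros)

lemma rho_measurable2 [measurable (raw)]:
  assumes "f \<in> borel_measurable M" "g \<in> borel_measurable M"
  shows "(\<lambda>x. rho (f x) (g x)) \<in> borel_measurable M"
proof -
  have "(\<lambda>x. (f x, g x)) \<in> borel_measurable M" using assms by simp
  from measurable_compose[OF this rho_measurable] show ?thesis by simp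
qed

text \<open>The Bergman ball in polynomial form, with c = (cosh r)^2 (see
  \<open>D_ball_eq_hball\<close>). In this form openness, measurability, symmetry in the two points
  and compatibility with automorphisms can be read off.\<close>

definition hball :: "real \<Rightarrow> 'n::{finite,linorder} cvec \<Rightarrow> 'n cvec set" where
  "hball c z = {w \<in> T_B. (norm (rho z w))\<^sup>2 < c * (rho1 z * rho1 w)}"

lemma hball_sym: "z \<in> T_B \<Longrightarrow> w \<in> T_B \<Longrightarrow> w \<in> hball c z \<longleftrightarrow> z \<in> hball c w"
  by (simp add: hball_def norm_rho_commute mult.commute)

lemma artanh_less_iff:
  fixes s r :: real
  assumes "0 \<le> s" "s < 1" "r > 0"
  shows "artanh s < r \<longleftrightarrow> s < tanh r"
proof -
  define u where "u = artanh s"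
  have "s = tanh u"
  proof -
    have "exp (- 2 * u) = (1 - s) / (1 + s)"
      using assms by (simp add: u_def artanh_def exp_minus)
    then have "tanh u = (1 - (1 - s) / (1 + s)) / (1 + (1 - s) / (1 + s))"
      by (simp only: tanh_real_altdef)
    also have "\<dots> = s" using assms by (simp add: field_simps)
    finally show ?thesis ..
  qed
  then show ?thesis using artanh_tanh_real[of u] by simp
qed

text \<open>With x = \<rho>(z)\<rho>(w)/|\<rho>(z,w)|^2 the condition is sqrt (1 - x) < tanh r, and
  tanh^2 = 1 - 1/cosh^2 turns it into x > 1/(cosh r)^2.\<close>

lemma D_ball_eq_hball:
  assumes z: "z \<in> T_B" and r: "r > 0"
  shows "D_ball z r = hball ((cosh r)\<^sup>2) z"
proof -
  have "bergman_dist z w < r \<longleftrightarrow> (norm (rho z w))\<^sup>2 < (cosh r)\<^sup>2 * (rho1 z * rho1 w)"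
    if w: "w \<in> T_B" for w
  proof -
    define x where "x = rho1 z * rho1 w / (norm (rho z w))\<^sup>2"
    have p: "(norm (rho z w))\<^sup>2 > 0" using norm_rho_pos[OF z w] by simp
    have x: "0 < x" "x \<le> 1"
      unfolding x_def using p z w rho1_mult_le[OF z w] by (auto simp: T_B_iff)
    have ch: "cosh r > 0" by simp
    have tr: "tanh r > 0" using r by simp
    have "bergman_dist z w < r \<longleftrightarrow> sqrt (1 - x) < tanh r"
      unfolding bergman_dist_def x_def[symmetric]
      using x r by (intro artanh_less_iff) auto
    also have "\<dots> \<longleftrightarrow> 1 - x < (tanh r)\<^sup>2"
      using tr x by (metis abs_of_pos real_sqrt_abs real_sqrt_less_iff)
    also have "(tanh r)\<^sup>2 = 1 - 1 / (cosh r)\<^sup>2"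
    proof -
      have "(tanh r)\<^sup>2 = ((cosh r)\<^sup>2 - 1) / (cosh r)\<^sup>2"
        unfolding tanh_def power_divide by (simp add: cosh_square_eq)
      then show ?thesis using ch by (simp add: diff_divide_distrib)
    qed
    also have "1 - x < 1 - 1 / (cosh r)\<^sup>2 \<longleftrightarrow> (norm (rho z w))\<^sup>2 < (cosh r)\<^sup>2 * (rho1 z * rho1 w)"
      unfolding x_def using p ch by (simp add: field_simps)
    finally show ?thesis .
  qed
  then show ?thesis by (auto simp: D_ball_def hball_def)
qed

text \<open>One of the two factors |\<rho>(z,w)| is cancelled against \<rho>(w) \<le>
  2|\<rho>(z,w)|. Together with \<open>rho1_le_right\<close> this gives \<rho>(w) \<le> 4c \<rho>(z)
  on the ball, so by symmetry \<rho> is comparable at the two points.\<close>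

lemma hball_norm_le:
  assumes "z \<in> T_B" "w \<in> hball c z" "c > 0"
  shows "norm (rho z w) \<le> 2 * c * rho1 z"
proof -
  have w: "w \<in> T_B" and *: "(norm (rho z w))\<^sup>2 < c * (rho1 z * rho1 w)"
    using assms by (auto simp: hball_def)
  have "c * (rho1 z * rho1 w) \<le> c * (rho1 z * (2 * norm (rho z w)))"
    using rho1_le_right[OF assms(1), of w] assms by (intro mult_left_mono) (auto simp: T_B_iff)
  with * have "norm (rho z w) * norm (rho z w) < (2 * c * rho1 z) * norm (rho z w)"
    by (simp add: power2_eq_square algebra_simps)
  then show ?thesis using norm_rho_pos[OF assms(1) w] by (simp add: mult_less_cancel_right)
qed

lemma hball_measurable [measurable]: "hball c z \<in> sets borel"
  unfolding hball_def by measurable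

lemma open_hball: "open (hball c (z :: 'n::{finite,linorder} cvec))"
proof -
  have "open {w :: 'n cvec. (norm (rho z w))\<^sup>2 < c * (rho1 z * rho1 w)}"
    by (intro open_Collect_less continuous_intros)
  moreover have "hball c z = T_B \<inter> {w. (norm (rho z w))\<^sup>2 < c * (rho1 z * rho1 w)}"
    by (auto simp: hball_def)
  ultimately show ?thesis using open_T_B by auto
qed

lemma center_in_hball: "z \<in> T_B \<Longrightarrow> c > 1 \<Longrightarrow> z \<in> hball c z"
  by (simp add: hball_def rho_diag T_B_iff power2_eq_square)

text \<open>
  The dilation \<open>(w', w\<^sub>n) \<mapsto> (t w', t\<^sup>2 w\<^sub>n)\<close> with \<open>t\<^sup>2 = \<rho>(z)\<close>, followed by the parabolic map
  \<open>(w', w\<^sub>n) \<mapsto> (w' + i b, w\<^sub>n + 2 b \<cdot> w' + i |b|\<^sup>2)\<close> with \<open>b = Im z'\<close>, which preserves \<open>\<rho>\<close>, and by a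
  real translation.
\<close>

definition aut :: "'n::{finite,linorder} cvec \<Rightarrow> 'n cvec \<Rightarrow> 'n cvec" where
  "aut z w = (\<chi> j. if j = last_ix
     then of_real (rho1 z) * w $ last_ix
       + 2 * of_real (sqrt (rho1 z)) * (\<Sum>k\<in>UNIV - {last_ix}. of_real (Im (z $ k)) * w $ k)
       + (of_real (Re (z $ last_ix)) + \<i> * of_real (\<Sum>k\<in>UNIV - {last_ix}. (Im (z $ k))\<^sup>2))
     else of_real (sqrt (rho1 z)) * w $ j + z $ j)"

lemma aut_base_pt: "z \<in> T_B \<Longrightarrow> aut z base_pt = z"
  by (auto simp: aut_def base_pt_def axis_def vec_eq_iff rho1_def complex_eq_iff)

text \<open>With b = Im z', the square of t(u_j - cnj w_j) + 2i b_j produces a cross term and the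
  constant -4 b_j^2. The linear term and the shift i|b|^2 in the last coordinate of
  \<open>aut\<close> are there to cancel both.\<close>

lemma rho_aut:
  fixes z u w :: "'n::{finite,linorder} cvec"
  assumes "z \<in> T_B"
  shows "rho (aut z u) (aut z w) = of_real (rho1 z) * rho u w"
proof -
  define t where "t = complex_of_real (sqrt (rho1 z))"
  have t2: "complex_of_real (rho1 z) = t\<^sup>2"
    using assms by (simp add: t_def T_B_iff flip: of_real_power)
  have ct: "cnj t = t" by (simp add: t_def)
  let ?I = "UNIV - {last_ix :: 'n}"
  let ?b = "\<lambda>k. complex_of_real (Im (z $ k))"
  have zc: "z $ j - cnj (z $ j) = 2 * \<i> * ?b j" for j
    by (simp add: complex_eq_iff)
  have "(\<Sum>j\<in>?I. (aut z u $ j - cnj (aut z w $ j))\<^sup>2) =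
        (\<Sum>j\<in>?I. (t * (u $ j - cnj (w $ j)) + (z $ j - cnj (z $ j)))\<^sup>2)"
    by (intro sum.cong) (auto simp: aut_def t_def[symmetric] ct algebra_simps)
  also have "\<dots> = t\<^sup>2 * (\<Sum>j\<in>?I. (u $ j - cnj (w $ j))\<^sup>2)
       + 4 * \<i> * t * (\<Sum>j\<in>?I. ?b j * (u $ j - cnj (w $ j))) - 4 * (\<Sum>j\<in>?I. (?b j)\<^sup>2)"
  proof -
    have "(t * (u $ j - cnj (w $ j)) + (z $ j - cnj (z $ j)))\<^sup>2 =
        t\<^sup>2 * (u $ j - cnj (w $ j))\<^sup>2 + 4 * \<i> * t * (?b j * (u $ j - cnj (w $ j))) - 4 * (?b j)\<^sup>2" for j
      unfolding zc by (simp add: power2_eq_square algebra_simps)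
    then show ?thesis
      by (simp only: sum.distrib sum_subtractf sum_distrib_left)
  qed
  finally have 1: "(\<Sum>j\<in>?I. (aut z u $ j - cnj (aut z w $ j))\<^sup>2) = \<dots>" .
  have 2: "aut z u $ last_ix - cnj (aut z w $ last_ix) =
      t\<^sup>2 * (u $ last_ix - cnj (w $ last_ix)) + 2 * t * (\<Sum>j\<in>?I. ?b j * (u $ j - cnj (w $ j)))
      + 2 * \<i> * (\<Sum>j\<in>?I. (?b j)\<^sup>2)"
    by (simp add: aut_def t_def[symmetric] t2 ct algebra_simps sum_subtractf sum_distrib_left
        sum_negf flip: sum.distrib)
  show ?thesis
    unfolding rho_def 1 2 t2 by (simp add: algebra_simps power2_eq_square)
qed

lemma rho1_aut: "z \<in> T_B \<Longrightarrow> rho1 (aut z u) = rho1 z * rho1 u"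
  using rho_aut[of z u u] unfolding rho_diag by (simp flip: of_real_mult)

lemma aut_in_T_B_iff: "z \<in> T_B \<Longrightarrow> aut z u \<in> T_B \<longleftrightarrow> u \<in> T_B"
  by (simp add: T_B_iff rho1_aut zero_less_mult_iff)

lemma rho_aut_right: "z \<in> T_B \<Longrightarrow> rho z (aut z u) = of_real (rho1 z) * rho base_pt u"
  using rho_aut[of z base_pt u] by (simp add: aut_base_pt)

lemma aut_in_hball_iff:
  "z \<in> T_B \<Longrightarrow> aut z u \<in> hball c z \<longleftrightarrow> u \<in> hball c base_pt"
  unfolding hball_def
  using aut_in_T_B_iff[of z u]
  by (auto simp: rho_aut_right rho1_aut norm_mult T_B_iff power2_eq_square zero_less_mult_iff ac_simps)

lemma continuous_on_If_const:
  assumes "continuous_on S f" "continuous_on S g"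
  shows "continuous_on S (\<lambda>x. if P then f x else g x)"
  using assms by (cases P) auto

lemma aut_measurable [measurable]: "aut z \<in> borel_measurable borel"
  unfolding aut_def
  by (intro borel_measurable_continuous_onI continuous_on_vec_lambda)
    (rule continuous_on_If_const; intro continuous_intros)

section \<open>Lebesgue measure under shears, rotations and automorphisms\<close>

text \<open>A class closed under composition, so that rotations, the shear factor of
  \<open>aut\<close> and the nonlinear flattening of \<open>T_B\<close> can all be assembled from
  shears of one coordinate.\<close>

definition lborel_preserving :: "('a::euclidean_space \<Rightarrow> 'a) \<Rightarrow> bool" where
  "lborel_preserving f \<longleftrightarrow> f \<in> borel_measurable borel \<and> distr lborel borel f = lborel"

lemma lborel_preservingI:
  fixes f :: "'a::euclidean_space \<Rightarrow> 'a"
  assumes [measurable]: "f \<in> borel_measurable borel"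
    and "\<And>A. A \<in> sets borel \<Longrightarrow> (\<integral>\<^sup>+x. indicator A (f x) \<partial>lborel) = emeasure lborel A"
  shows "lborel_preserving f"
proof -
  have "emeasure (distr lborel borel f) A = emeasure lborel A" if [measurable]: "A \<in> sets borel" for A
    using assms(2)[OF that]
    by (subst nn_integral_indicator[symmetric]) (simp_all add: nn_integral_distr del: nn_integral_indicator)
  then show ?thesis
    using assms(1) by (auto simp: lborel_preserving_def intro!: measure_eqI)
qed

lemma nn_integral_lborel_preserving:
  assumes "lborel_preserving f" and [measurable]: "h \<in> borel_measurable borel"
  shows "(\<integral>\<^sup>+x. h (f x) \<partial>lborel) = (\<integral>\<^sup>+x. h x \<partial>lborel)"
proof -
  have [measurable]: "f \<in> borel_measurable borel" and d: "distr lborel borel f = lborel"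
    using assms by (auto simp: lborel_preserving_def)
  have "(\<integral>\<^sup>+x. h x \<partial>lborel) = (\<integral>\<^sup>+x. h x \<partial>distr lborel borel f)" by (simp add: d)
  also have "\<dots> = (\<integral>\<^sup>+x. h (f x) \<partial>lborel)" by (subst nn_integral_distr) auto
  finally show ?thesis ..
qed

lemma lborel_preserving_id: "lborel_preserving (\<lambda>x. x)"
  by (simp add: lborel_preserving_def distr_id2)

lemma lborel_preserving_compose:
  assumes f: "lborel_preserving f" and g: "lborel_preserving g"
  shows "lborel_preserving (\<lambda>x. f (g x))"
proof (rule lborel_preservingI)
  have [measurable]: "f \<in> borel_measurable borel" "g \<in> borel_measurable borel"
    using assms by (auto simp: lborel_preserving_def)
  show "(\<lambda>x. f (g x)) \<in> borel_measurable borel" by measurable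
  fix A :: "'a set" assume [measurable]: "A \<in> sets borel"
  show "(\<integral>\<^sup>+x. indicator A (f (g x)) \<partial>lborel) = emeasure lborel A"
    using nn_integral_lborel_preserving[OF g, of "\<lambda>x. indicator A (f x)"]
      nn_integral_lborel_preserving[OF f, of "indicator A"] by simp
qed

text \<open>Fubini along e: with the other coordinates fixed, g is constant and the map is a
  translation of the line. The coefficient g may be nonlinear, as in the flattening of
  \<open>T_B\<close>.\<close>

lemma lborel_preserving_shear:
  fixes e :: "'a::euclidean_space" and g :: "'a \<Rightarrow> real"
  assumes e: "e \<in> Basis" and [measurable]: "g \<in> borel_measurable borel"
    and g: "\<And>x t. g (x + t *\<^sub>R e) = g x"
  shows "lborel_preserving (\<lambda>x. x + g x *\<^sub>R e)"
proof (rule lborel_preservingI)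
  show "(\<lambda>x. x + g x *\<^sub>R e) \<in> borel_measurable borel" by measurable
  fix A :: "'a set" assume [measurable]: "A \<in> sets borel"
  let ?I = "Basis - {e}"
  let ?s = "\<lambda>f :: 'a \<Rightarrow> real. \<Sum>b\<in>Basis. f b *\<^sub>R b"
  let ?r = "\<lambda>f :: 'a \<Rightarrow> real. \<Sum>b\<in>?I. f b *\<^sub>R b"
  interpret product_sigma_finite "\<lambda>b::'a. lborel :: real measure" ..
  have I: "insert e ?I = (Basis :: 'a set)" using e by auto
  have split: "?s (x(e := t)) = ?r x + t *\<^sub>R e" for x t
  proof -
    have "?s (x(e := t)) = t *\<^sub>R e + (\<Sum>b\<in>?I. (x(e := t)) b *\<^sub>R b)"
      using e by (subst sum.remove[of _ e]) auto
    also have "(\<Sum>b\<in>?I. (x(e := t)) b *\<^sub>R b) = ?r x" by (intro sum.cong) auto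
    finally show ?thesis by simp
  qed
  have main: "(\<integral>\<^sup>+x. h x \<partial>lborel) = (\<integral>\<^sup>+x. (\<integral>\<^sup>+t. h (?r x + t *\<^sub>R e) \<partial>lborel) \<partial>Pi\<^sub>M ?I (\<lambda>b. lborel))"
    if [measurable]: "h \<in> borel_measurable borel" for h :: "'a \<Rightarrow> ennreal"
  proof -
    have "(\<integral>\<^sup>+x. h x \<partial>lborel) = (\<integral>\<^sup>+x. h (?s x) \<partial>Pi\<^sub>M (insert e ?I) (\<lambda>b. lborel))"
      unfolding I by (subst lborel_eq) (simp add: nn_integral_distr)
    also have "\<dots> = (\<integral>\<^sup>+x. (\<integral>\<^sup>+t. h (?s (x(e := t))) \<partial>lborel) \<partial>Pi\<^sub>M ?I (\<lambda>b. lborel))"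
      by (rule product_nn_integral_insert) (auto simp: I)
    finally show ?thesis by (simp only: split)
  qed
  have "(\<integral>\<^sup>+x. indicator A (x + g x *\<^sub>R e) \<partial>lborel) =
    (\<integral>\<^sup>+x. (\<integral>\<^sup>+t. indicator A (?r x + t *\<^sub>R e + g (?r x + t *\<^sub>R e) *\<^sub>R e) \<partial>lborel) \<partial>Pi\<^sub>M ?I (\<lambda>b. lborel))"
    by (rule main) measurable
  also have "\<dots> = (\<integral>\<^sup>+x. (\<integral>\<^sup>+t. indicator A (?r x + t *\<^sub>R e) \<partial>lborel) \<partial>Pi\<^sub>M ?I (\<lambda>b. lborel))"
  proof (rule nn_integral_cong)
    fix x :: "'a \<Rightarrow> real"
    have "(\<integral>\<^sup>+t. indicator A (?r x + t *\<^sub>R e) \<partial>lborel) =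
       ennreal \<bar>1\<bar> * (\<integral>\<^sup>+t. indicator A (?r x + (g (?r x) + 1 * t) *\<^sub>R e) \<partial>lborel)"
      by (rule nn_integral_real_affine) auto
    then show "(\<integral>\<^sup>+t. indicator A (?r x + t *\<^sub>R e + g (?r x + t *\<^sub>R e) *\<^sub>R e) \<partial>lborel) =
        (\<integral>\<^sup>+t. indicator A (?r x + t *\<^sub>R e) \<partial>lborel)"
      unfolding g by (simp add: algebra_simps)
  qed
  also have "\<dots> = (\<integral>\<^sup>+x. indicator A x \<partial>lborel)"
    by (rule main[symmetric]) measurable
  finally show "(\<integral>\<^sup>+x. indicator A (x + g x *\<^sub>R e) \<partial>lborel) = emeasure lborel A" by simp
qed

text \<open>Each coefficient is constant along every direction of E, so performing the shears one
  after another is the same as performing them at once.\<close>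

lemma lborel_preserving_multi_shear:
  fixes E :: "'a::euclidean_space set" and g :: "'a \<Rightarrow> 'a \<Rightarrow> real"
  assumes "E \<subseteq> Basis" and "\<And>e. e \<in> E \<Longrightarrow> g e \<in> borel_measurable borel"
    and "\<And>d e x t. d \<in> E \<Longrightarrow> e \<in> E \<Longrightarrow> g e (x + t *\<^sub>R d) = g e x"
  shows "lborel_preserving (\<lambda>x. x + (\<Sum>e\<in>E. g e x *\<^sub>R e))"
proof -
  have "finite E" using assms(1) finite_Basis finite_subset by blast
  then show ?thesis using assms
  proof (induction E)
    case empty
    then show ?case by (simp add: lborel_preserving_id)
  next
    case (insert d E)
    have inv: "g d (x + (\<Sum>e\<in>F. c e *\<^sub>R e)) = g d x" if "F \<subseteq> E" for x c F
    proof -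
      have "finite F" using that insert.hyps finite_subset by blast
      then show ?thesis using that
      proof (induction F arbitrary: x)
        case (insert e F)
        have "g d (x + (\<Sum>e\<in>insert e F. c e *\<^sub>R e)) = g d ((x + c e *\<^sub>R e) + (\<Sum>e\<in>F. c e *\<^sub>R e))"
          using insert.hyps by (simp add: add.assoc)
        also have "\<dots> = g d (x + c e *\<^sub>R e)" using insert by auto
        also have "\<dots> = g d x" using insert.prems \<open>\<And>d' e x t. d' \<in> insert d E \<Longrightarrow> e \<in> insert d E \<Longrightarrow> g e (x + t *\<^sub>R d') = g e x\<close>
          by auto
        finally show ?case .
      qed simp
    qed
    have "lborel_preserving (\<lambda>x. x + g d x *\<^sub>R d)"
      using insert.prems by (intro lborel_preserving_shear) auto
    moreover have "lborel_preserving (\<lambda>x. x + (\<Sum>e\<in>E. g e x *\<^sub>R e))"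
      using insert.prems by (intro insert.IH) auto
    ultimately have "lborel_preserving (\<lambda>x. (x + (\<Sum>e\<in>E. g e x *\<^sub>R e))
        + g d (x + (\<Sum>e\<in>E. g e x *\<^sub>R e)) *\<^sub>R d)"
      by (rule lborel_preserving_compose)
    then show ?case using insert.hyps by (simp add: inv ac_simps)
  qed
qed

section \<open>Real coordinates of complex vectors, rotations, and the Jacobian of an
  automorphism\<close>

lemma Basis_cvec: "(Basis :: 'n::finite cvec set) = range (\<lambda>i. axis i 1) \<union> range (\<lambda>i. axis i \<i>)"
  by (auto simp: Basis_vec_def Basis_complex_def)

lemma axis_in_Basis [simp]:
  "axis i (1::complex) \<in> Basis" "axis i \<i> \<in> Basis"
  by (auto simp: Basis_cvec)

lemma Basis_cvec_disjoint: "range (\<lambda>i. axis i (1::complex)) \<inter> range (\<lambda>i. axis i \<i>) = {}"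
  by (auto simp: axis_eq_axis complex_eq_iff)

lemma prod_Basis_cvec:
  "(\<Prod>b\<in>(Basis :: 'n::finite cvec set). f b) = (\<Prod>i\<in>UNIV. f (axis i 1) * f (axis i \<i>))"
  unfolding Basis_cvec
  by (subst prod.union_disjoint[OF _ _ Basis_cvec_disjoint])
     (simp_all add: prod.distrib prod.reindex inj_on_def axis_eq_axis)

lemma sum_Basis_cvec:
  "(\<Sum>b\<in>(Basis :: 'n::finite cvec set). f b) = (\<Sum>i\<in>UNIV. f (axis i 1) + f (axis i \<i>))"
  unfolding Basis_cvec
  by (subst sum.union_disjoint[OF _ _ Basis_cvec_disjoint])
     (simp_all add: sum.distrib sum.reindex inj_on_def axis_eq_axis)

lemma sum_axis_nth: "(\<Sum>i\<in>UNIV. axis i (f i) :: 'a::comm_monoid_add ^ 'n::finite) $ j = f j"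
  by (simp add: axis_def sum.delta)

lemma lborel_preserving_scaleC:
  fixes \<theta> :: real
  assumes "\<theta> \<in> {-pi<..<pi}"
  shows "lborel_preserving (\<lambda>x :: 'n::finite cvec. cis \<theta> *s x)"
proof -
  define t where "t = tan (\<theta> / 2)"
  have c: "cos (\<theta>/2) > 0" using assms by (intro cos_gt_zero_pi) auto
  \<comment> \<open>a rotation by \<open>\<theta> \<noteq> \<plusminus>\<pi>\<close> is a product of three shears\<close>
  define A where "A = (\<lambda>x::'n cvec. x + (\<Sum>i\<in>UNIV. (- t * Im (x $ i)) *\<^sub>R axis i 1))"
  define B where "B = (\<lambda>x::'n cvec. x + (\<Sum>i\<in>UNIV. (sin \<theta> * Re (x $ i)) *\<^sub>R axis i \<i>))"
  have sc: "c *s axis i d = axis i (c * d)" for c d :: complex and i :: 'n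
    by (simp add: vec_eq_iff axis_def)
  have A: "lborel_preserving A"
  proof -
    have "lborel_preserving (\<lambda>x::'n cvec. x + (\<Sum>e\<in>range (\<lambda>i. axis i 1). (- t * (x \<bullet> (\<i> *s e))) *\<^sub>R e))"
      by (rule lborel_preserving_multi_shear)
         (auto simp: inner_add_left inner_axis_axis sc inner_complex_def split: if_splits)
    also have "(\<lambda>x::'n cvec. x + (\<Sum>e\<in>range (\<lambda>i. axis i 1). (- t * (x \<bullet> (\<i> *s e))) *\<^sub>R e)) = A"
      unfolding A_def
      by (subst sum.reindex) (auto simp: inj_on_def axis_eq_axis inner_axis sc inner_complex_def)
    finally show ?thesis .
  qed
  have B: "lborel_preserving B"
  proof -
    have "lborel_preserving (\<lambda>x::'n cvec. x + (\<Sum>e\<in>range (\<lambda>i. axis i \<i>). (sin \<theta> * (x \<bullet> (-\<i> *s e))) *\<^sub>R e))"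
      by (rule lborel_preserving_multi_shear)
         (auto simp: inner_add_left inner_axis_axis sc inner_complex_def split: if_splits)
    also have "(\<lambda>x::'n cvec. x + (\<Sum>e\<in>range (\<lambda>i. axis i \<i>). (sin \<theta> * (x \<bullet> (-\<i> *s e))) *\<^sub>R e)) = B"
      unfolding B_def
      by (subst sum.reindex) (auto simp: inj_on_def axis_eq_axis inner_axis sc inner_complex_def)
    finally show ?thesis .
  qed
  \<comment> \<open>The identities 1 - t sin \<theta> = cos \<theta> and t + t cos \<theta> = sin
    \<theta> identify the product of the shears \<open>A\<close>, \<open>B\<close>, \<open>A\<close>
    with the rotation matrix.\<close>
  have s: "sin \<theta> = 2 * sin (\<theta>/2) * cos (\<theta>/2)" "cos \<theta> = 1 - 2 * (sin (\<theta>/2))\<^sup>2"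
    using sin_double[of "\<theta>/2"] cos_double_sin[of "\<theta>/2"] by simp_all
  have tc: "t * cos (\<theta>/2) = sin (\<theta>/2)" using c by (simp add: t_def tan_def)
  have "t * sin \<theta> = 2 * sin (\<theta>/2) * (t * cos (\<theta>/2))" unfolding s by (simp only: ac_simps)
  then have st1: "1 - t * sin \<theta> = cos \<theta>" unfolding tc s by (simp add: power2_eq_square)
  have "t + t * cos \<theta> = 2 * t * (cos (\<theta>/2))\<^sup>2"
    unfolding s sin_squared_eq by (simp add: algebra_simps)
  also have "\<dots> = 2 * (t * cos (\<theta>/2)) * cos (\<theta>/2)" by (simp add: power2_eq_square)
  finally have "t + t * cos \<theta> = sin \<theta>" unfolding tc s(1) .
  note st = st1 this
  have scaleR_axis_nth: "(\<Sum>i\<in>UNIV. f i *\<^sub>R axis i d) $ j = f j *\<^sub>R d" for f and d :: complex and j :: 'n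
    by (simp add: axis_def if_distrib[of "\<lambda>y. _ *\<^sub>R y"] cong: if_cong)
  have RA: "Re (A x $ i) = Re (x $ i) - t * Im (x $ i)" "Im (A x $ i) = Im (x $ i)" for x i
    unfolding A_def vector_add_component scaleR_axis_nth by simp_all
  have RB: "Re (B x $ i) = Re (x $ i)" "Im (B x $ i) = Im (x $ i) + sin \<theta> * Re (x $ i)" for x i
    unfolding B_def vector_add_component scaleR_axis_nth by simp_all
  have "A (B (A x)) = cis \<theta> *s x" for x
  proof -
    have "A (B (A x)) $ i = cis \<theta> * x $ i" for i
    proof -
      have "Re (A (B (A x)) $ i) = (1 - t * sin \<theta>) * Re (x $ i) - (t + t * (1 - t * sin \<theta>)) * Im (x $ i)"
        by (simp add: RA RB algebra_simps)
      moreover have "Im (A (B (A x)) $ i) = (1 - t * sin \<theta>) * Im (x $ i) + sin \<theta> * Re (x $ i)"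
        by (simp add: RA RB algebra_simps)
      ultimately show ?thesis unfolding st by (simp add: complex_eq_iff)
    qed
    then show ?thesis by (simp add: vec_eq_iff)
  qed
  moreover have "lborel_preserving (\<lambda>x. A (B (A x)))"
    by (rule lborel_preserving_compose[OF A lborel_preserving_compose[OF B A]])
  ultimately show ?thesis by simp
qed

text \<open>\<open>aut z\<close> is \<open>T\<close> after \<open>S\<close>, where \<open>S\<close>
  is a complex shear of the last coordinate and \<open>T\<close> a diagonal real dilation with a
  translation. The Jacobian is t^4 from the last complex coordinate and t^2 from each of the others,
  in total t^(2n+2) = \<rho>(z)^(n+1).\<close>

lemma nn_integral_aut:
  fixes z :: "'n::{finite,linorder} cvec"
  assumes z: "z \<in> T_B" and [measurable]: "h \<in> borel_measurable borel"
  shows "(\<integral>\<^sup>+w. h w \<partial>lborel) = ennreal (rho1 z ^ (CARD('n) + 1)) * (\<integral>\<^sup>+w. h (aut z w) \<partial>lborel)"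
proof -
  define t where "t = sqrt (rho1 z)"
  have t: "t > 0" "t\<^sup>2 = rho1 z" using z by (auto simp: t_def T_B_iff)
  let ?I = "UNIV - {last_ix :: 'n}"
  let ?e1 = "axis last_ix 1 :: 'n cvec" and ?e2 = "axis last_ix \<i> :: 'n cvec"
  have ne: "?e1 \<noteq> ?e2" by (auto simp: axis_eq_axis complex_eq_iff)
  \<comment> \<open>\<open>T\<close> multiplies the last coordinate by t^2, so the displacement 2t
    (b . w') of \<open>aut\<close> must enter the shear divided by t^2; hence the factor
    2/t.\<close>
  define G where "G w = (\<Sum>k\<in>?I. of_real (2 / t * Im (z $ k)) * w $ k)" for w :: "'n cvec"
  have [measurable]: "G \<in> borel_measurable borel"
    unfolding G_def by (intro borel_measurable_continuous_onI continuous_intros)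
  have [measurable]: "(\<lambda>x. Re (G x)) \<in> borel_measurable borel" "(\<lambda>x. Im (G x)) \<in> borel_measurable borel"
    unfolding G_def by (intro borel_measurable_continuous_onI continuous_intros)+
  have Ginv: "G (w + s *\<^sub>R axis last_ix c) = G w" for w s c
    unfolding G_def by (intro sum.cong) (auto simp: axis_def)
  define S where "S w = w + (\<Sum>e\<in>{?e1, ?e2}. (if e = ?e1 then Re (G w) else Im (G w)) *\<^sub>R e)" for w
  have S: "lborel_preserving S"
    unfolding S_def by (rule lborel_preserving_multi_shear) (auto simp: Ginv)
  have S_nth: "S w $ j = w $ j + (if j = last_ix then G w else 0)" for w j
    using ne by (simp add: S_def axis_def complex_eq_iff)
  define \<tau> :: "'n cvec" where "\<tau> = (\<chi> j. if j = last_ix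
      then of_real (Re (z $ last_ix)) + \<i> * of_real (\<Sum>k\<in>?I. (Im (z $ k))\<^sup>2) else z $ j)"
  define c where "c e = (if e = ?e1 \<or> e = ?e2 then t\<^sup>2 else t)" for e :: "'n cvec"
  define T where "T x = \<tau> + (\<Sum>j\<in>Basis. (c j * (x \<bullet> j)) *\<^sub>R j)" for x
  have c_axis: "c (axis i 1) = (if i = last_ix then t\<^sup>2 else t)"
    "c (axis i \<i>) = (if i = last_ix then t\<^sup>2 else t)" for i
    using ne by (auto simp: c_def axis_eq_axis complex_eq_iff)
  have T_nth: "T x $ j = \<tau> $ j + of_real (if j = last_ix then t\<^sup>2 else t) * x $ j" for x j
  proof -
    have "(\<Sum>b\<in>Basis. (c b * (x \<bullet> b)) *\<^sub>R b) =
        (\<Sum>i\<in>UNIV. axis i (of_real (if i = last_ix then t\<^sup>2 else t) * x $ i))"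
      unfolding sum_Basis_cvec
      unfolding c_axis inner_axis
      by (intro sum.cong) (auto simp: inner_complex_def vec_eq_iff axis_def complex_eq_iff)
    then show ?thesis unfolding T_def by (simp only: vector_add_component sum_axis_nth)
  qed
  have tG: "of_real (t\<^sup>2) * G w = 2 * of_real t * (\<Sum>k\<in>?I. of_real (Im (z $ k)) * w $ k)" for w
    unfolding G_def sum_distrib_left
  proof (intro sum.cong refl)
    fix k
    have "t\<^sup>2 * (2 / t * Im (z $ k)) = 2 * t * Im (z $ k)"
      using t(1) by (simp add: power2_eq_square)
    then have "of_real (t\<^sup>2 * (2 / t * Im (z $ k))) * w $ k = of_real (2 * t * Im (z $ k)) * w $ k"
      by (simp only:)
    then show "of_real (t\<^sup>2) * (of_real (2 / t * Im (z $ k)) * w $ k) = 2 * of_real t * (of_real (Im (z $ k)) * w $ k)"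
      by (simp only: of_real_mult mult.assoc of_real_numeral)
  qed
  have aut_eq: "aut z w = T (S w)" for w
  proof -
    have "aut z w $ j = T (S w) $ j" for j
    proof (cases "j = last_ix")
      case True
      then show ?thesis unfolding T_nth S_nth
        by (simp add: distrib_left tG del: of_real_power) (use t(1) in \<open>simp add: \<tau>_def aut_def t_def[symmetric] t(2)[symmetric]\<close>)
    qed (simp add: T_nth S_nth \<tau>_def aut_def t_def[symmetric])
    then show ?thesis by (simp add: vec_eq_iff)
  qed
  have prodc: "(\<Prod>j\<in>(Basis :: 'n cvec set). \<bar>c j\<bar>) = rho1 z ^ (CARD('n) + 1)"
  proof -
    have "(\<Prod>j\<in>(Basis :: 'n cvec set). \<bar>c j\<bar>) = (\<Prod>i\<in>(UNIV :: 'n set). if i = last_ix then t\<^sup>2 * t\<^sup>2 else t\<^sup>2)"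
      unfolding prod_Basis_cvec using t by (intro prod.cong) (auto simp: c_axis power2_eq_square)
    also have "\<dots> = (t\<^sup>2 * t\<^sup>2) * (\<Prod>i\<in>?I. t\<^sup>2)"
      by (subst prod.remove[of _ "last_ix"]) (auto intro!: prod.cong)
    also have "\<dots> = rho1 z * rho1 z ^ (Suc (card ?I))" unfolding t by (simp del: card_Diff_insert)
    also have "Suc (card ?I) = CARD('n)"
      by (rule card_Suc_Diff1) auto
    finally show ?thesis by simp
  qed
  have [measurable]: "T \<in> borel_measurable borel"
    unfolding T_def by measurable
  have "c j \<noteq> 0" for j using t(1) by (simp add: c_def)
  then have L: "lborel = density (distr lborel borel T) (\<lambda>_. ennreal (\<Prod>j\<in>(Basis :: 'n cvec set). \<bar>c j\<bar>))"
    unfolding T_def by (intro lborel_affine_euclidean)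
  have "(\<integral>\<^sup>+w. h w \<partial>lborel) =
      (\<integral>\<^sup>+w. h w \<partial>density (distr lborel borel T) (\<lambda>_. ennreal (\<Prod>j\<in>(Basis :: 'n cvec set). \<bar>c j\<bar>)))"
    by (rule arg_cong[where f = "\<lambda>N. integral\<^sup>N N h", OF L])
  also have "\<dots> = ennreal (rho1 z ^ (CARD('n) + 1)) * (\<integral>\<^sup>+w. h (T w) \<partial>lborel)"
    unfolding prodc by (simp add: nn_integral_density nn_integral_distr nn_integral_cmult)
  also have "(\<integral>\<^sup>+w. h (T w) \<partial>lborel) = (\<integral>\<^sup>+w. h (T (S w)) \<partial>lborel)"
    by (rule nn_integral_lborel_preserving[OF S, symmetric]) measurable
  finally show ?thesis by (simp add: aut_eq)
qed

section \<open>Integrability of the kernel\<close>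

text \<open>On (0,1) the integrand is at most x^a, from 1 on at most x^(-1-\<epsilon>).\<close>

lemma nn_integral_power_quotient_finite:
  fixes a \<epsilon> :: real
  assumes a: "a > -1" and \<epsilon>: "\<epsilon> > 0"
  shows "(\<integral>\<^sup>+x. ennreal (indicator {0<..} x * x powr a * (1 + x) powr (- (a + 1 + \<epsilon>))) \<partial>lborel) < \<infinity>"
proof -
  have 1: "(\<integral>\<^sup>+x. ennreal (x powr a) * indicator {0..1} x \<partial>lborel) < \<infinity>"
    using nn_integral_has_integral_lebesgue'[OF _ has_integral_powr_from_0[OF a, of 1]] by simp
  have 2: "(\<integral>\<^sup>+x. ennreal (x powr (-1 - \<epsilon>)) * indicator {1..} x \<partial>lborel) < \<infinity>"
    using nn_integral_has_integral_lebesgue'[OF _ has_integral_powr_to_inf[of "-1 - \<epsilon>" 1]] \<epsilon> by simp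
  have "(\<integral>\<^sup>+x. ennreal (indicator {0<..} x * x powr a * (1 + x) powr (- (a + 1 + \<epsilon>))) \<partial>lborel) \<le>
    (\<integral>\<^sup>+x. ennreal (x powr a) * indicator {0..1} x + ennreal (x powr (-1 - \<epsilon>)) * indicator {1..} x \<partial>lborel)"
  proof (rule nn_integral_mono)
    fix x :: real
    consider "x \<le> 0" | "0 < x" "x < 1" | "1 \<le> x" by linarith
    then show "ennreal (indicator {0<..} x * x powr a * (1 + x) powr (- (a + 1 + \<epsilon>))) \<le>
        ennreal (x powr a) * indicator {0..1} x + ennreal (x powr (-1 - \<epsilon>)) * indicator {1..} x"
    proof cases
      case 2
      have "(1 + x) powr (- (a + 1 + \<epsilon>)) \<le> (1 + x) powr 0"
        using 2 a \<epsilon> by (intro powr_mono) auto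
      then show ?thesis using 2 by (auto simp: mult_left_le intro!: ennreal_leI)
    next
      case 3
      have "(1 + x) powr (- (a + 1 + \<epsilon>)) \<le> x powr (- (a + 1 + \<epsilon>))"
        using 3 a \<epsilon> by (intro powr_mono2') auto
      then have "x powr a * (1 + x) powr (- (a + 1 + \<epsilon>)) \<le> x powr a * x powr (- (a + 1 + \<epsilon>))"
        by (intro mult_left_mono) auto
      also have "\<dots> = x powr (-1 - \<epsilon>)" using 3 by (simp flip: powr_add)
      finally have "ennreal (x powr a * (1 + x) powr (- (a + 1 + \<epsilon>))) \<le> ennreal (x powr (-1 - \<epsilon>))"
        by (rule ennreal_leI)
      then have "ennreal (x powr a * (1 + x) powr (- (a + 1 + \<epsilon>))) \<le>
          ennreal (x powr a) * indicator {0..1} x + ennreal (x powr (-1 - \<epsilon>))"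
        by (rule add_increasing[OF zero_le])
      then show ?thesis using 3 by simp
    qed simp
  qed
  also have "\<dots> < \<infinity>"
    using 1 2 by (subst nn_integral_add) auto
  finally show ?thesis .
qed

lemma nn_integral_abs_powr_finite:
  fixes \<epsilon> :: real
  assumes \<epsilon>: "\<epsilon> > 0"
  shows "(\<integral>\<^sup>+x. ennreal ((1 + \<bar>x::real\<bar>) powr (- (1 + \<epsilon>))) \<partial>lborel) < \<infinity>"
proof -
  let ?f = "\<lambda>x::real. ennreal (indicator {0<..} x * x powr 0 * (1 + x) powr (- (0 + 1 + \<epsilon>)))"
  have fin: "(\<integral>\<^sup>+x. ?f x \<partial>lborel) < \<infinity>"
    using \<epsilon> by (intro nn_integral_power_quotient_finite) auto
  have neg: "(\<integral>\<^sup>+x. ?f (- x) \<partial>lborel) = (\<integral>\<^sup>+x. ?f x \<partial>lborel)"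
    using nn_integral_real_affine[of ?f "-1" 0] by simp
  have "(\<integral>\<^sup>+x. ennreal ((1 + \<bar>x::real\<bar>) powr (- (1 + \<epsilon>))) \<partial>lborel) \<le>
      (\<integral>\<^sup>+x. ?f x + ?f (- x) + indicator {0} x \<partial>lborel)"
    by (intro nn_integral_mono) (auto simp: indicator_def ennreal_1[symmetric] simp del: ennreal_1)
  also have "\<dots> = (\<integral>\<^sup>+x. ?f x \<partial>lborel) + (\<integral>\<^sup>+x. ?f (- x) \<partial>lborel)"
    by (subst nn_integral_add; simp?)+
  also have "\<dots> < \<infinity>" unfolding neg using fin by simp
  finally show ?thesis .
qed

lemma prod_ennreal_less_top:
  fixes f :: "'a \<Rightarrow> ennreal"
  shows "(\<And>x. x \<in> A \<Longrightarrow> f x < top) \<Longrightarrow> (\<Prod>x\<in>A. f x) < top"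
  by (induction A rule: infinite_finite_induct) (auto simp: ennreal_mult_less_top)

text \<open>
  After flattening \<^const>\<open>T_B\<close> to a half space by two shears, the integrand is dominated by a
  product of functions of one real variable.
\<close>

lemma nn_integral_rho_finite:
  fixes a b :: real
  assumes a: "a > -1" and b: "b > a + real CARD('n) + 1"
  shows "(\<integral>\<^sup>+w. indicator T_B w * ennreal (rho1 w powr a * norm (rho w base_pt) powr (- b))
           \<partial>(lborel :: 'n::{finite,linorder} cvec measure)) < \<infinity>"
proof -
  let ?I = "UNIV - {last_ix :: 'n}"
  let ?e1 = "axis last_ix 1 :: 'n cvec" and ?e2 = "axis last_ix \<i> :: 'n cvec"
  have ne: "?e1 \<noteq> ?e2" by (auto simp: axis_eq_axis complex_eq_iff)
  \<comment> \<open>The excess of b over a + n + 1, divided equally among the 2n real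
    coordinates.\<close>
  define \<epsilon> where "\<epsilon> = (b - (a + real CARD('n) + 1)) / (2 * real CARD('n))"
  have \<epsilon>: "\<epsilon> > 0" using b by (simp add: \<epsilon>_def)
  have card: "real (card ?I) = real CARD('n) - 1"
    by (simp add: card_Diff_singleton of_nat_diff)
  \<comment> \<open>\<open>G\<close> is chosen so that the imaginary part of \<rho>(w,i) becomes
    -1/2 times the new real last coordinate, and \<open>H\<close> so that the new imaginary last
    coordinate is \<rho>(w), which makes \<open>T_B\<close> a half space.\<close>
  define G :: "'n cvec \<Rightarrow> real" where "G w = - (\<Sum>k\<in>?I. Re (w $ k) * Im (w $ k))" for w
  define H :: "'n cvec \<Rightarrow> real" where "H w = - (\<Sum>k\<in>?I. (Im (w $ k))\<^sup>2)" for w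
  define M where "M w = w + (\<Sum>e\<in>{?e1, ?e2}. (if e = ?e1 then G w else H w) *\<^sub>R e)" for w
  have [measurable]: "G \<in> borel_measurable borel" "H \<in> borel_measurable borel"
    unfolding G_def H_def by (intro borel_measurable_continuous_onI continuous_intros)+
  have inv: "G (w + s *\<^sub>R axis last_ix c) = G w" "H (w + s *\<^sub>R axis last_ix c) = H w" for w s c
    unfolding G_def H_def by (auto simp: axis_def intro!: sum.cong)
  have M: "lborel_preserving M"
    unfolding M_def by (rule lborel_preserving_multi_shear) (auto simp: inv)
  have M_nth: "M w $ j = (if j = last_ix then Complex (Re (w $ j) + G w) (Im (w $ j) + H w) else w $ j)" for w j
    using ne by (simp add: M_def axis_def complex_eq_iff)
  have M_rho1: "Im (M w $ last_ix) = rho1 w" for w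
    by (simp add: M_nth H_def rho1_def)
  \<comment> \<open>The share of the exponent spent on each coordinate; the shares add up to b. The
    coordinates of w' get only 1/2 + \<epsilon>, because |\<rho>(w,i)| controls their
    squares.\<close>
  define expo where "expo e = (if e = ?e2 then a + 1 + \<epsilon> else if e = ?e1 then 1 + \<epsilon> else 1/2 + \<epsilon>)" for e
  define \<phi> where "\<phi> e x = (if e = ?e2 then indicator {0<..} x * x powr a * (1 + x) powr (- (a + 1 + \<epsilon>))
      else if e = ?e1 then (1 + \<bar>x\<bar>) powr (- (1 + \<epsilon>))
      else 2 powr (1/2 + \<epsilon>) * (1 + \<bar>x\<bar>) powr (- (1 + 2 * \<epsilon>)))" for e and x :: real
  have [measurable]: "\<phi> e \<in> borel_measurable borel" for e
    unfolding \<phi>_def by measurable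
  have \<phi>_nonneg: "\<phi> e x \<ge> 0" for e x by (simp add: \<phi>_def)
  have fin: "(\<integral>\<^sup>+x. (\<Prod>e\<in>Basis. ennreal (\<phi> e (x \<bullet> e))) \<partial>lborel) < \<infinity>"
  proof -
    have "(\<integral>\<^sup>+x. ennreal (\<phi> e x) \<partial>lborel) < \<infinity>" for e
    proof -
      have "(\<integral>\<^sup>+x. ennreal (2 powr (1/2 + \<epsilon>) * (1 + \<bar>x\<bar>) powr (- (1 + 2 * \<epsilon>))) \<partial>lborel) < \<infinity>"
        using nn_integral_abs_powr_finite[of "2 * \<epsilon>"] \<epsilon>
        by (simp add: ennreal_mult nn_integral_cmult ennreal_mult_less_top)
      then show ?thesis
        using nn_integral_power_quotient_finite[OF a \<epsilon>] nn_integral_abs_powr_finite[OF \<epsilon>] ne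
        by (cases "e = ?e2"; cases "e = ?e1") (simp_all add: \<phi>_def)
    qed
    then show ?thesis
      by (subst nn_integral_lborel_prod) (auto intro!: prod_ennreal_less_top)
  qed
  have expo_sum: "(\<Sum>e\<in>Basis. expo e) = b"
  proof -
    have "(\<Sum>e\<in>Basis. expo e) = (\<Sum>i\<in>UNIV. expo (axis i 1) + expo (axis i \<i>))"
      by (rule sum_Basis_cvec)
    also have "\<dots> = (expo ?e1 + expo ?e2) + (\<Sum>i\<in>?I. expo (axis i 1) + expo (axis i \<i>))"
      by (subst sum.remove[of _ last_ix]) auto
    also have "(\<Sum>i\<in>?I. expo (axis i 1) + expo (axis i \<i>)) = (\<Sum>i\<in>?I. 1 + 2 * \<epsilon>)"
      by (intro sum.cong) (auto simp: expo_def axis_eq_axis)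
    also have "\<dots> = (real CARD('n) - 1) * (1 + 2 * \<epsilon>)" by (simp add: card)
    also have "expo ?e1 + expo ?e2 = a + 2 + 2 * \<epsilon>" using ne by (simp add: expo_def)
    also have "a + 2 + 2 * \<epsilon> + (real CARD('n) - 1) * (1 + 2 * \<epsilon>) = a + real CARD('n) + 1 + 2 * real CARD('n) * \<epsilon>"
      by (simp add: algebra_simps)
    also have "\<dots> = b" by (simp add: \<epsilon>_def)
    finally show ?thesis .
  qed
  have key: "indicator T_B w * ennreal (rho1 w powr a * norm (rho w base_pt) powr (- b))
      \<le> ennreal (8 powr b) * (\<Prod>e\<in>Basis. ennreal (\<phi> e (M w \<bullet> e)))" for w
  proof (cases "w \<in> T_B")
    case False
    then show ?thesis by simp
  next
    case True
    then have r: "rho1 w > 0" by (simp add: T_B_iff)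
    define s where "s = Re (M w $ last_ix)"
    define Q where "Q = (\<Sum>k\<in>?I. (Re (w $ k))\<^sup>2 + (Im (w $ k))\<^sup>2)"
    have Q: "Q \<ge> 0" by (auto simp: Q_def intro!: sum_nonneg)
    have base: "base_pt $ k = 0" if "k \<noteq> last_ix" for k
      using that by (simp add: base_pt_def axis_def)
    have Re: "Re (rho w base_pt) = (Q + 2 * rho1 w + 2) / 4"
      unfolding Re_rho Q_def by (simp add: base)
    have Im: "Im (rho w base_pt) = - s / 2"
    proof -
      have "Im (\<Sum>j\<in>?I. (w $ j - cnj (base_pt $ j))\<^sup>2) = (\<Sum>j\<in>?I. 2 * (Re (w $ j) * Im (w $ j)))"
        by (simp add: base Im_power2 mult.assoc)
      also have "\<dots> = - 2 * G w" by (simp add: G_def sum_distrib_left sum_negf)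
      finally have *: "Im (\<Sum>j\<in>?I. (w $ j - cnj (base_pt $ j))\<^sup>2) = - 2 * G w" .
      have "Im (rho w base_pt) = (Im (\<Sum>j\<in>?I. (w $ j - cnj (base_pt $ j))\<^sup>2) - 2 * Re (w $ last_ix)) / 4"
        unfolding rho_def by (simp add: base_pt_def axis_def)
      also have "\<dots> = - s / 2" unfolding * s_def by (simp add: M_nth)
      finally show ?thesis .
    qed
    \<comment> \<open>\<open>X\<close> collects all coordinates and is at most 8|\<rho>(w,i)|. Its
      power -b is split into one factor per coordinate, and each factor then keeps only its own
      coordinate from \<open>X\<close>.\<close>
    define X where "X = 1 + rho1 w + \<bar>s\<bar> + Q"
    have X1: "X \<ge> 1" using r Q by (simp add: X_def)
    have X_le: "X \<le> 8 * norm (rho w base_pt)"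
      using abs_Re_le_cmod[of "rho w base_pt"] abs_Im_le_cmod[of "rho w base_pt"] r Q
      unfolding Re Im X_def by (simp add: field_simps)
    have "norm (rho w base_pt) powr (- b) \<le> (X / 8) powr (- b)"
      using X_le X1 a b by (intro powr_mono2') auto
    also have "\<dots> = 8 powr b * X powr (- b)"
      using X1 by (simp add: powr_divide powr_minus_divide)
    also have "X powr (- b) = (\<Prod>e\<in>(Basis :: 'n cvec set). X powr (- expo e))"
      using X1 expo_sum by (subst powr_sum[symmetric]) (auto simp: sum_negf)
    finally have 1: "norm (rho w base_pt) powr (- b) \<le> 8 powr b * (\<Prod>e\<in>(Basis :: 'n cvec set). X powr (- expo e))" .
    have 2: "(\<Prod>e\<in>(Basis :: 'n cvec set). (if e = ?e2 then rho1 w powr a else 1)) = rho1 w powr a"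
      by (simp add: prod.delta)
    have "rho1 w powr a * norm (rho w base_pt) powr (- b) \<le>
       rho1 w powr a * (8 powr b * (\<Prod>e\<in>(Basis :: 'n cvec set). X powr (- expo e)))"
      using 1 by (intro mult_left_mono) auto
    also have "\<dots> = 8 powr b * (\<Prod>e\<in>(Basis :: 'n cvec set). (if e = ?e2 then rho1 w powr a else 1) * X powr (- expo e))"
      by (simp add: prod.distrib 2)
    also have "\<dots> \<le> 8 powr b * (\<Prod>e\<in>Basis. \<phi> e (M w \<bullet> e))"
    proof (intro mult_left_mono prod_mono conjI)
      fix e :: "'n cvec" assume "e \<in> Basis"
      then obtain i where "e = axis i 1 \<or> e = axis i \<i>" by (auto simp: Basis_cvec)
      then consider "e = ?e2" | "e = ?e1" | k where "k \<noteq> last_ix" "e = axis k 1 \<or> e = axis k \<i>"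
        by (cases "i = last_ix") blast+
      then show "(if e = ?e2 then rho1 w powr a else 1) * X powr (- expo e) \<le> \<phi> e (M w \<bullet> e)"
      proof cases
        case 1
        have "M w \<bullet> e = rho1 w" unfolding 1 inner_axis M_rho1[symmetric] by (simp add: inner_complex_def)
        moreover have "X powr (- (a + 1 + \<epsilon>)) \<le> (1 + rho1 w) powr (- (a + 1 + \<epsilon>))"
          using X1 r Q a \<epsilon> by (intro powr_mono2') (auto simp: X_def)
        ultimately show ?thesis using 1 r by (simp add: \<phi>_def expo_def mult_left_mono)
      next
        case 2
        have "M w \<bullet> e = s" unfolding 2 inner_axis s_def by (simp add: inner_complex_def)
        moreover have "X powr (- (1 + \<epsilon>)) \<le> (1 + \<bar>s\<bar>) powr (- (1 + \<epsilon>))"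
          using X1 r Q \<epsilon> by (intro powr_mono2') (auto simp: X_def)
        ultimately show ?thesis using 2 ne by (simp add: \<phi>_def expo_def)
      next
        case 3
        define x where "x = M w \<bullet> e"
        have x: "x = Re (w $ k) \<or> x = Im (w $ k)"
          using 3 unfolding x_def by (auto simp: inner_axis M_nth inner_complex_def)
        have ee: "e \<noteq> ?e1" "e \<noteq> ?e2" using 3 by (auto simp: axis_eq_axis)
        have "x\<^sup>2 \<le> (Re (w $ k))\<^sup>2 + (Im (w $ k))\<^sup>2" using x by auto
        also have "\<dots> \<le> Q" unfolding Q_def
          using 3 by (intro member_le_sum) auto
        finally have "1 + x\<^sup>2 \<le> X" using r by (simp add: X_def)
        moreover have "(1 + \<bar>x\<bar>)\<^sup>2 \<le> 2 * (1 + x\<^sup>2)"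
          using zero_le_power2[of "1 - \<bar>x\<bar>"] by (simp add: power2_eq_square algebra_simps)
        ultimately have "(1 + \<bar>x\<bar>)\<^sup>2 / 2 \<le> X" by simp
        then have "X powr (- (1/2 + \<epsilon>)) \<le> ((1 + \<bar>x\<bar>)\<^sup>2 / 2) powr (- (1/2 + \<epsilon>))"
          using \<epsilon> by (intro powr_mono2') auto
        also have "\<dots> = 2 powr (1/2 + \<epsilon>) * ((1 + \<bar>x\<bar>) powr 2) powr (- (1/2 + \<epsilon>))"
        proof -
          have "(u / 2) powr (- d) = 2 powr d * u powr (- d)" if "u \<ge> 0" for u d :: real
            using that by (simp add: powr_divide powr_minus_divide)
          from this[of "(1 + \<bar>x\<bar>)\<^sup>2" "1/2 + \<epsilon>"] show ?thesis by (simp only: powr_numeral zero_le_power2)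
        qed
        also have "((1 + \<bar>x\<bar>) powr 2) powr (- (1/2 + \<epsilon>)) = (1 + \<bar>x\<bar>) powr (- (1 + 2 * \<epsilon>))"
        proof -
          have "2 * - (1/2 + \<epsilon>) = - (1 + 2 * \<epsilon>)" by simp
          then show ?thesis by (simp only: powr_powr)
        qed
        finally show ?thesis using ee by (simp add: \<phi>_def expo_def x_def)
      qed
    qed auto
    finally have "ennreal (rho1 w powr a * norm (rho w base_pt) powr (- b)) \<le> ennreal (8 powr b * (\<Prod>e\<in>Basis. \<phi> e (M w \<bullet> e)))"
      by (rule ennreal_leI)
    then show ?thesis using True by (simp add: ennreal_mult prod_ennreal \<phi>_nonneg prod_nonneg)
  qed
  have "(\<integral>\<^sup>+w. indicator T_B w * ennreal (rho1 w powr a * norm (rho w base_pt) powr (- b)) \<partial>(lborel :: 'n cvec measure))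
      \<le> (\<integral>\<^sup>+w. ennreal (8 powr b) * (\<Prod>e\<in>Basis. ennreal (\<phi> e (M w \<bullet> e))) \<partial>lborel)"
    by (intro nn_integral_mono key)
  also have "\<dots> = (\<integral>\<^sup>+w. ennreal (8 powr b) * (\<Prod>e\<in>Basis. ennreal (\<phi> e (w \<bullet> e))) \<partial>lborel)"
    by (rule nn_integral_lborel_preserving[OF M]) measurable
  also have "\<dots> < \<infinity>"
    using fin by (subst nn_integral_cmult) (auto simp: ennreal_mult_less_top)
  finally show ?thesis .
qed

section \<open>Sub-mean value inequalities\<close>

lemma scaleC_simps:
  fixes v :: "'n::finite cvec"
  shows "norm (\<zeta> *s v) = norm \<zeta> * norm v" and "\<i> *s (\<i> *s v) = - v"
    and "(\<zeta> + \<xi>) *s v = \<zeta> *s v + \<xi> *s v" and "r *\<^sub>R (\<zeta> *s v) = (r *\<^sub>R \<zeta>) *s v"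
  by (simp_all add: norm_vec_def norm_mult L2_set_right_distrib vec_eq_iff algebra_simps)

lemma bounded_linear_scaleC_left: "bounded_linear (\<lambda>\<zeta>. \<zeta> *s (v :: 'n::finite cvec))"
  by (rule bounded_linear_intro[where K = "norm v"]) (simp_all add: scaleC_simps)

lemma continuous_on_scaleC [continuous_intros]:
  assumes "continuous_on S f" "continuous_on S g"
  shows "continuous_on S (\<lambda>x. f x *s (g x :: 'n::finite cvec))"
  unfolding vector_scalar_mult_def
  by (intro continuous_on_vec_lambda continuous_intros assms)

lemma lborel_preserving_unit_scaleC:
  assumes "norm \<zeta> = 1"
  shows "lborel_preserving (\<lambda>x :: 'n::finite cvec. \<zeta> *s x)"
proof (cases "\<zeta> = -1")
  case True
  \<comment> \<open>The angle \<pi> is outside the range of \<open>lborel_preserving_scaleC\<close>;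
    -1 is reached as the square of i.\<close>
  have "lborel_preserving (\<lambda>x :: 'n cvec. cis (pi/2) *s x)"
    by (rule lborel_preserving_scaleC) (auto intro: less_trans[of _ 0])
  from lborel_preserving_compose[OF this this] show ?thesis
    using True by (simp add: scaleC_simps vector_scalar_mult_def vec_eq_iff uminus_vec_def)
next
  case False
  have cis: "cis (Arg \<zeta>) = \<zeta>"
    using assms cis_Arg[of \<zeta>] by (force simp: sgn_eq)
  then have "Arg \<zeta> \<noteq> pi"
    using False cis_pi by metis
  then have "Arg \<zeta> \<in> {-pi<..<pi}"
    using Arg_bounded[of \<zeta>] by auto
  then show ?thesis using lborel_preserving_scaleC[of "Arg \<zeta>"] cis by simp
qed

section \<open>Complex slices and mean values\<close>

lemma holomorphic_several_continuous_on:
  "holomorphic_several_on f S \<Longrightarrow> continuous_on S f"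
  unfolding holomorphic_several_on_def
  by (meson continuous_at_imp_continuous_on has_derivative_continuous)

text \<open>Complex linearity of the Frechet derivative makes the restriction to a complex line
  complex differentiable. Through this lemma Cauchy's theory in one variable becomes
  available.\<close>

lemma holomorphic_several_slice:
  assumes f: "holomorphic_several_on f S" and U: "\<And>\<zeta>. \<zeta> \<in> U \<Longrightarrow> a + \<zeta> *s v \<in> S"
  shows "(\<lambda>\<zeta>. f (a + \<zeta> *s v)) holomorphic_on U"
proof (rule holomorphic_onI)
  fix \<zeta> assume "\<zeta> \<in> U"
  then obtain f' where f': "(f has_derivative f') (at (a + \<zeta> *s v))" and lin: "\<And>c v. f' (c *s v) = c * f' v"
    using f U unfolding holomorphic_several_on_def by blast
  have "((\<lambda>\<zeta>. a + \<zeta> *s v) has_derivative (\<lambda>h. h *s v)) (at \<zeta>)"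
    using bounded_linear.has_derivative[OF bounded_linear_scaleC_left has_derivative_ident]
    by (auto intro!: derivative_eq_intros)
  from has_derivative_compose[OF this f']
  have "((\<lambda>\<zeta>. f (a + \<zeta> *s v)) has_derivative (\<lambda>h. h * f' v)) (at \<zeta>)"
    by (simp add: lin)
  then have "((\<lambda>\<zeta>. f (a + \<zeta> *s v)) has_field_derivative f' v) (at \<zeta>)"
    by (rule has_derivative_imp_has_field_derivative) simp
  then show "(\<lambda>\<zeta>. f (a + \<zeta> *s v)) field_differentiable at \<zeta> within U"
    using field_differentiable_at_within field_differentiable_def by blast
qed

text \<open>Cauchy's formula at the centre, where 1/u cancels against the derivative 2\<pi>i u of
  the circle. The mean is written as a nonnegative integral so that it can be exchanged with an
  integral over a ball.\<close>

lemma holomorphic_norm_le_circle_mean: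
  assumes f: "f holomorphic_on cball 0 1"
  shows "ennreal (norm (f 0)) \<le> (\<integral>\<^sup>+t. ennreal (norm (f (exp (2 * of_real pi * \<i> * of_real t)))) * indicator {0..1} t \<partial>lborel)"
proof -
  let ?e = "\<lambda>t::real. exp (2 * of_real pi * \<i> * of_real t)"
  have "((\<lambda>u. f u / (u - 0)) has_contour_integral (2 * of_real pi * \<i> * f 0)) (circlepath 0 1)"
    using f by (intro Cauchy_integral_circlepath_simple) auto
  then have "((\<lambda>t. f (circlepath 0 1 t) / circlepath 0 1 t * vector_derivative (circlepath 0 1) (at t within {0..1}))
      has_integral (2 * of_real pi * \<i> * f 0)) {0..1}"
    unfolding has_contour_integral_def by simp
  then have "((\<lambda>t. (2 * of_real pi * \<i>) * f (?e t)) has_integral (2 * of_real pi * \<i> * f 0)) {0..1}"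
  proof (rule has_integral_eq[rotated])
    fix t :: real assume "t \<in> {0..1}"
    then have *: "vector_derivative (circlepath 0 1) (at t within {0..1}) = 2 * of_real pi * \<i> * ?e t"
      using vector_derivative_circlepath01[of t 0 1] by simp
    show "f (circlepath 0 1 t) / circlepath 0 1 t * vector_derivative (circlepath 0 1) (at t within {0..1}) =
        (2 * of_real pi * \<i>) * f (?e t)"
      unfolding * by (simp add: circlepath)
  qed
  then have "((\<lambda>t. (1 / (2 * of_real pi * \<i>)) * ((2 * of_real pi * \<i>) * f (?e t)))
      has_integral ((1 / (2 * of_real pi * \<i>)) * (2 * of_real pi * \<i> * f 0))) {0..1}"
    by (rule has_integral_mult_right)
  then have I: "((\<lambda>t. f (?e t)) has_integral f 0) {0..1}" by simp
  have "continuous_on {0..1} (\<lambda>t. f (?e t))"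
    by (rule continuous_on_compose2[OF holomorphic_on_imp_continuous_on[OF f]])
       (auto intro!: continuous_intros)
  then have J: "((\<lambda>t. norm (f (?e t))) has_integral integral {0..1} (\<lambda>t. norm (f (?e t)))) {0..1}"
    by (intro integrable_integral integrable_continuous_interval continuous_intros)
  have "norm (f 0) \<le> integral {0..1} (\<lambda>t. norm (f (?e t)))"
    unfolding integral_unique[OF I, symmetric]
    by (rule integral_norm_bound_integral[OF has_integral_integrable[OF I] has_integral_integrable[OF J]]) simp
  then show ?thesis
    by (subst nn_integral_has_integral_lebesgue'[OF _ J]) (auto intro: ennreal_leI)
qed

lemma nn_integral_lborel_translate:
  fixes c :: "'a::euclidean_space"
  assumes [measurable]: "h \<in> borel_measurable borel"
  shows "(\<integral>\<^sup>+x. h (c + x) \<partial>lborel) = (\<integral>\<^sup>+x. h x \<partial>lborel)"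
  by (rule nn_integral_lborel_preserving) (simp_all add: lborel_preserving_def lborel_distr_plus)

text \<open>For each v in the ball about 0 the circle mean is taken on the slice through c in
  direction v, and the result is integrated over v. After the exchange the inner integral is the
  same for every t, since unimodular multiples preserve Lebesgue measure.\<close>

lemma norm_holomorphic_several_mean:
  fixes g :: "'n::finite cvec \<Rightarrow> complex"
  assumes g: "holomorphic_several_on g S" and S: "open S" "cball c \<delta> \<subseteq> S" and \<delta>: "\<delta> > 0"
  shows "emeasure lborel (ball c \<delta>) * ennreal (norm (g c)) \<le>
     (\<integral>\<^sup>+w. ennreal (norm (g w)) * indicator (ball c \<delta>) w \<partial>lborel)"
proof -
  let ?e = "\<lambda>t::real. exp (2 * of_real pi * \<i> * of_real t) :: complex"
  have ne: "norm (?e t) = 1" for t by (simp add: norm_exp_eq_Re)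
  define G where "G v = ennreal (norm (g v)) * indicator (ball c \<delta>) v" for v
  have [measurable]: "G \<in> borel_measurable borel"
  proof -
    have "continuous_on (ball c \<delta>) g"
      using holomorphic_several_continuous_on[OF g] S(2)
      by (meson ball_subset_cball continuous_on_subset subset_trans)
    then have "(\<lambda>v. indicator (ball c \<delta>) v *\<^sub>R g v) \<in> borel_measurable borel"
      by (intro borel_measurable_continuous_on_indicator) auto
    then have "(\<lambda>v. ennreal (norm (indicator (ball c \<delta>) v *\<^sub>R g v))) \<in> borel_measurable borel"
      by measurable
    also have "(\<lambda>v. ennreal (norm (indicator (ball c \<delta>) v *\<^sub>R g v))) = G"
      by (auto simp: G_def indicator_def)
    finally show ?thesis .
  qed
  have [measurable]: "(\<lambda>p. ?e (fst p) *s (snd p :: 'n cvec)) \<in> borel_measurable borel"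
    by (intro borel_measurable_continuous_onI continuous_intros)
  have [measurable]: "(\<lambda>p. ?e (fst p) *s (snd p :: 'n cvec)) \<in> borel_measurable (lborel \<Otimes>\<^sub>M lborel)"
    by (simp add: lborel_prod)
  have "emeasure lborel (ball c \<delta>) * ennreal (norm (g c)) = emeasure lborel (ball (0::'n cvec) \<delta>) * ennreal (norm (g c))"
    using \<delta> by (simp add: emeasure_ball)
  also have "\<dots> = (\<integral>\<^sup>+v. ennreal (norm (g c)) * indicator (ball (0::'n cvec) \<delta>) v \<partial>lborel)"
    by (subst nn_integral_cmult) (auto simp: mult.commute intro!: borel_measurable_indicator)
  also have "\<dots> \<le> (\<integral>\<^sup>+v. (\<integral>\<^sup>+t. G (c + ?e t *s v) * indicator {0..1} t \<partial>lborel) \<partial>lborel)"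
  proof (rule nn_integral_mono)
    fix v :: "'n cvec"
    show "ennreal (norm (g c)) * indicator (ball 0 \<delta>) v \<le> (\<integral>\<^sup>+t. G (c + ?e t *s v) * indicator {0..1} t \<partial>lborel)"
    proof (cases "v \<in> ball 0 \<delta>")
      case True
      have "(\<lambda>\<zeta>. g (c + \<zeta> *s v)) holomorphic_on cball 0 1"
      proof (rule holomorphic_several_slice[OF g])
        fix \<zeta> :: complex assume "\<zeta> \<in> cball 0 1"
        then have "norm \<zeta> * norm v \<le> 1 * norm v" by (intro mult_right_mono) auto
        then have "c + \<zeta> *s v \<in> cball c \<delta>"
          using True by (simp add: dist_norm scaleC_simps)
        then show "c + \<zeta> *s v \<in> S" using S by blast
      qed
      from holomorphic_norm_le_circle_mean[OF this]
      have "ennreal (norm (g c)) \<le> (\<integral>\<^sup>+t. ennreal (norm (g (c + ?e t *s v))) * indicator {0..1} t \<partial>lborel)"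
        by simp
      also have "\<dots> = (\<integral>\<^sup>+t. G (c + ?e t *s v) * indicator {0..1} t \<partial>lborel)"
        using True by (intro nn_integral_cong) (simp add: G_def dist_norm scaleC_simps ne)
      finally show ?thesis using True by simp
    qed simp
  qed
  also have "\<dots> = (\<integral>\<^sup>+t. (\<integral>\<^sup>+v. G (c + ?e t *s v) * indicator {0..1} t \<partial>lborel) \<partial>lborel)"
    by (rule lborel_pair.Fubini') measurable
  also have "\<dots> = (\<integral>\<^sup>+t. (\<integral>\<^sup>+v. G v \<partial>lborel) * indicator {0..1::real} t \<partial>lborel)"
  proof (rule nn_integral_cong)
    fix t
    have [measurable]: "(\<lambda>v::'n cvec. ?e t *s v) \<in> borel_measurable borel"
      by (intro borel_measurable_continuous_onI continuous_intros)
    have "(\<integral>\<^sup>+v. G (c + ?e t *s v) * indicator {0..1} t \<partial>lborel) = (\<integral>\<^sup>+v. G (c + ?e t *s v) \<partial>lborel) * indicator {0..1} t"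
      by (rule nn_integral_multc) measurable
    also have "(\<integral>\<^sup>+v. G (c + ?e t *s v) \<partial>lborel) = (\<integral>\<^sup>+v. G (c + v) \<partial>lborel)"
      by (rule nn_integral_lborel_preserving[OF lborel_preserving_unit_scaleC]) (auto simp: ne)
    also have "\<dots> = (\<integral>\<^sup>+v. G v \<partial>lborel)" by (rule nn_integral_lborel_translate) measurable
    finally show "(\<integral>\<^sup>+v. G (c + ?e t *s v) * indicator {0..1} t \<partial>lborel) = (\<integral>\<^sup>+v. G v \<partial>lborel) * indicator {0..1::real} t" .
  qed
  also have "\<dots> = (\<integral>\<^sup>+v. G v \<partial>lborel)"
    by (subst nn_integral_cmult) auto
  finally show ?thesis by (simp add: G_def)
qed

text \<open>The constant does not depend on g or S, so that one constant serves all functions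
  transported by automorphisms. The power q is reached by absorption: for q \<ge> 1 above the level
  |g c|/2, for q < 1 at a weighted maximum.\<close>

lemma norm_powr_holomorphic_several_submean:
  fixes c :: "'n::finite cvec"
  assumes q: "q > 0" and \<delta>: "\<delta> > 0"
  obtains C :: real where "C > 0"
    and "\<And>g S. holomorphic_several_on g S \<Longrightarrow> open S \<Longrightarrow> cball c \<delta> \<subseteq> S \<Longrightarrow>
      ennreal (norm (g c) powr q) \<le> ennreal C * (\<integral>\<^sup>+w. ennreal (norm (g w) powr q) * indicator (ball c \<delta>) w \<partial>lborel)"
proof -
  define d where "d = DIM('n cvec)"
  define v where "v = unit_ball_vol (real d)"
  have v: "v > 0" by (simp add: v_def)
  have vol: "emeasure lborel (ball x r) = ennreal (v * r ^ d)" if "r \<ge> 0" for x :: "'n cvec" and r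
    unfolding v_def d_def using that by (rule emeasure_ball)
  have meas: "(\<lambda>w. ennreal (norm (g w) powr s) * indicator (ball x r) w) \<in> borel_measurable borel"
    if "continuous_on S g" "ball x r \<subseteq> S" for S g s r and x :: "'n cvec"
  proof -
    have "continuous_on (ball x r) g" using that continuous_on_subset by blast
    then have "g \<in> borel_measurable (restrict_space borel (ball x r))"
      by (rule borel_measurable_continuous_on_restrict)
    then have "(\<lambda>w. ennreal (norm (g w) powr s)) \<in> borel_measurable (restrict_space borel (ball x r))"
      by measurable
    then show ?thesis by (subst (asm) borel_measurable_restrict_space_iff_ennreal) auto
  qed
  show thesis
  proof (cases "q \<ge> 1")
    case True
    define C where "C = 2 powr q / (v * \<delta> ^ d)"
    show thesis
    proof (rule that)
      show "C > 0" using v \<delta> by (simp add: C_def)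
      fix g S assume g: "holomorphic_several_on g S" and S: "open S" "cball c \<delta> \<subseteq> S"
      define I where "I = (\<integral>\<^sup>+w. ennreal (norm (g w) powr q) * indicator (ball c \<delta>) w \<partial>lborel)"
      \<comment> \<open>Where |g| > s one has |g| \<le> s^(1-q) |g|^q. The part below the level s
        contributes at most s times the volume, half of the left-hand side, and is absorbed
        there.\<close>
      define s where "s = norm (g c) / 2"
      have cont: "continuous_on S g" using g by (rule holomorphic_several_continuous_on)
      show "ennreal (norm (g c) powr q) \<le> ennreal C * I"
      proof (cases "g c = 0 \<or> I = \<infinity>")
        case True
        then show ?thesis using \<open>C > 0\<close> by (auto simp: ennreal_mult_top)
      next
        case False
        then have s: "s > 0" and gs: "norm (g c) = 2 * s" by (auto simp: s_def)
        obtain J where J: "J \<ge> 0" "I = ennreal J" using False by (cases I) auto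
        have "ennreal (v * \<delta> ^ d) * ennreal (2 * s) \<le> (\<integral>\<^sup>+w. ennreal (norm (g w)) * indicator (ball c \<delta>) w \<partial>lborel)"
          using norm_holomorphic_several_mean[OF g S \<delta>] vol[of \<delta> c] \<delta> gs by simp
        also have "\<dots> \<le> (\<integral>\<^sup>+w. ennreal s * indicator (ball c \<delta>) w + ennreal (s powr (1 - q)) * (ennreal (norm (g w) powr q) * indicator (ball c \<delta>) w) \<partial>lborel)"
        proof (rule nn_integral_mono)
          fix w
          have "norm (g w) \<le> s + s powr (1 - q) * norm (g w) powr q"
          proof (cases "norm (g w) \<le> s")
            case False
            have "norm (g w) = norm (g w) powr (1 - q) * norm (g w) powr q"
              using False s by (simp flip: powr_add)
            also have "\<dots> \<le> s powr (1 - q) * norm (g w) powr q"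
              using False s True \<open>q \<ge> 1\<close> by (intro mult_right_mono powr_mono2') auto
            finally show ?thesis using s by linarith
          qed (simp add: add_increasing2)
          then have "ennreal (norm (g w)) \<le> ennreal s + ennreal (s powr (1 - q)) * ennreal (norm (g w) powr q)"
            using s by (simp add: ennreal_leI flip: ennreal_mult ennreal_plus)
          then show "ennreal (norm (g w)) * indicator (ball c \<delta>) w \<le>
             ennreal s * indicator (ball c \<delta>) w + ennreal (s powr (1 - q)) * (ennreal (norm (g w) powr q) * indicator (ball c \<delta>) w)"
            by (auto simp: indicator_def)
        qed
        also have "\<dots> = ennreal s * ennreal (v * \<delta> ^ d) + ennreal (s powr (1 - q)) * I"
        proof -
          have [measurable]: "(\<lambda>w. ennreal (norm (g w) powr q) * indicator (ball c \<delta>) w) \<in> borel_measurable borel"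
            using meas[OF cont] S(2) by (meson ball_subset_cball subset_trans)
          have [measurable]: "ball c \<delta> \<in> sets borel" by simp
          show ?thesis
            using \<delta> by (subst nn_integral_add) (simp_all add: nn_integral_cmult I_def vol)
        qed
        finally have "v * \<delta> ^ d * (2 * s) \<le> s * (v * \<delta> ^ d) + s powr (1 - q) * J"
          using s J v \<delta> by (simp add: ennreal_mult'[symmetric] ennreal_le_iff flip: ennreal_plus)
        then have "s * (v * \<delta> ^ d) \<le> s powr (1 - q) * J" by (simp add: algebra_simps)
        then have "s powr (q - 1) * (s * (v * \<delta> ^ d)) \<le> s powr (q - 1) * (s powr (1 - q) * J)"
          by (rule mult_left_mono) simp
        moreover have "s powr (q - 1) * s = s powr q"
          using s by (metis powr_mult_base mult.commute diff_add_cancel powr_add powr_one less_imp_le)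
        moreover have "s powr (q - 1) * s powr (1 - q) = 1"
          using s by (simp flip: powr_add)
        ultimately have "s powr q * (v * \<delta> ^ d) \<le> J"
          by (metis mult.assoc mult_1)
        then have "2 powr q * s powr q \<le> C * J"
          using v \<delta> by (simp add: C_def field_simps)
        then show ?thesis unfolding gs J(2) using \<open>C > 0\<close> J(1) s
          by (simp add: powr_mult ennreal_leI flip: ennreal_mult')
      qed
    qed
  next
    case False
    then have q1: "q < 1" by simp
    \<comment> \<open>With e q = d the q-th power of the weight (2\<eta>)^e is (2\<eta>)^d, which
      matches the volume of a ball of radius \<eta>.\<close>
    define e where "e = real d / q"
    have e: "e > 0" "e * q = real d" using q by (auto simp: e_def d_def)
    define A where "A = 2 powr e"
    have A: "A > 0" by (simp add: A_def)
    define C where "C = 2 ^ d * A powr (1 - q) / (v * \<delta> ^ d)"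
    show thesis
    proof (rule that)
      show "C > 0" using v \<delta> A by (simp add: C_def)
      fix g S assume g: "holomorphic_several_on g S" and S: "open S" "cball c \<delta> \<subseteq> S"
      define I where "I = (\<integral>\<^sup>+w. ennreal (norm (g w) powr q) * indicator (ball c \<delta>) w \<partial>lborel)"
      have cont: "continuous_on S g" using g by (rule holomorphic_several_continuous_on)
      show "ennreal (norm (g c) powr q) \<le> ennreal C * I"
      proof (cases "g c = 0 \<or> I = \<infinity>")
        case True
        then show ?thesis using \<open>C > 0\<close> by (auto simp: ennreal_mult_top)
      next
        case False
        obtain J where J: "J \<ge> 0" "I = ennreal J" using False by (cases I) auto
        \<comment> \<open>at a maximum \<open>w0\<close> of \<open>\<phi>\<close>, \<open>|g|\<close> is controlled by \<open>|g w0|\<close> on a ball about \<open>w0\<close>,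
          which absorbs the power \<open>1 - q\<close> in \<open>|g| = |g|\<^bsup>1 - q\<^esup> |g|\<^sup>q\<close>\<close>
        define \<phi> where "\<phi> w = (\<delta> - dist w c) powr e * norm (g w)" for w
        have "continuous_on (cball c \<delta>) \<phi>"
          unfolding \<phi>_def using e \<delta> continuous_on_subset[OF cont S(2)]
          by (intro continuous_intros continuous_on_powr') (auto simp: dist_commute)
        then obtain w0 where w0: "w0 \<in> cball c \<delta>" and max: "\<And>w. w \<in> cball c \<delta> \<Longrightarrow> \<phi> w \<le> \<phi> w0"
          using continuous_attains_sup[of "cball c \<delta>" \<phi>] \<delta> by auto
        have \<phi>c: "\<phi> c = \<delta> powr e * norm (g c)" by (simp add: \<phi>_def)
        then have "\<phi> c > 0" using False \<delta> by simp
        then have pos: "\<phi> w0 > 0" using max[of c] \<delta> by simp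
        \<comment> \<open>Half the distance from \<open>w0\<close> to the boundary sphere: on the
          ball of radius \<eta> about \<open>w0\<close> the distance to the sphere still exceeds
          \<eta>, so maximality gives |g| \<le> 2^e |g w0| there.\<close>
        define \<eta> where "\<eta> = (\<delta> - dist w0 c) / 2"
        have \<eta>0: "dist w0 c = \<delta> - 2 * \<eta>" by (simp add: \<eta>_def field_simps)
        have "dist w0 c \<noteq> \<delta>" using pos by (auto simp: \<phi>_def)
        then have \<eta>: "\<eta> > 0" using w0 by (simp add: \<eta>_def dist_commute)
        have \<phi>w0: "\<phi> w0 = (2 * \<eta>) powr e * norm (g w0)" by (simp add: \<phi>_def \<eta>0)
        have g0: "norm (g w0) > 0" using pos \<eta> by (auto simp: \<phi>w0)
        have near: "dist w c < \<delta> - \<eta>" if "dist w0 w < \<eta>" for w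
          using that dist_triangle[of w c w0] \<eta>0 by (simp add: dist_commute[of w w0])
        have sub: "cball w0 \<eta> \<subseteq> S"
        proof
          fix w assume "w \<in> cball w0 \<eta>"
          then have "dist w c \<le> \<delta>" using dist_triangle[of w c w0] \<eta> \<eta>0 by (simp add: dist_commute[of w w0])
          then show "w \<in> S" using S(2) by (auto simp: dist_commute)
        qed
        have bound: "norm (g w) \<le> A * norm (g w0)" if "w \<in> ball w0 \<eta>" for w
        proof -
          have n: "dist w c < \<delta> - \<eta>" using that near by auto
          have "\<eta> powr e * norm (g w) \<le> \<phi> w"
            unfolding \<phi>_def using n \<eta> e by (intro mult_right_mono powr_mono2) auto
          also have "\<dots> \<le> \<phi> w0" using n \<eta> by (intro max) (simp add: dist_commute)
          also have "\<dots> = \<eta> powr e * (A * norm (g w0))"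
            using \<eta> by (simp add: \<phi>w0 A_def powr_mult)
          finally show ?thesis using \<eta> by (simp add: mult_le_cancel_left)
        qed
        define K where "K = (A * norm (g w0)) powr (1 - q)"
        have "ennreal (v * \<eta> ^ d) * ennreal (norm (g w0)) \<le> (\<integral>\<^sup>+w. ennreal (norm (g w)) * indicator (ball w0 \<eta>) w \<partial>lborel)"
          using norm_holomorphic_several_mean[OF g S(1) sub \<eta>] vol[of \<eta> w0] \<eta> by simp
        also have "\<dots> \<le> (\<integral>\<^sup>+w. ennreal K * (ennreal (norm (g w) powr q) * indicator (ball c \<delta>) w) \<partial>lborel)"
        proof (rule nn_integral_mono)
          fix w
          show "ennreal (norm (g w)) * indicator (ball w0 \<eta>) w \<le> ennreal K * (ennreal (norm (g w) powr q) * indicator (ball c \<delta>) w)"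
          proof (cases "w \<in> ball w0 \<eta>")
            case True
            then have "w \<in> ball c \<delta>" using near[of w] \<eta> by (simp add: dist_commute)
            moreover have "norm (g w) \<le> K * norm (g w) powr q"
            proof -
              have "norm (g w) = norm (g w) powr (1 - q) * norm (g w) powr q"
                by (cases "g w = 0") (simp_all flip: powr_add)
              also have "\<dots> \<le> K * norm (g w) powr q"
                unfolding K_def using bound[OF True] q1 by (intro mult_right_mono powr_mono2) auto
              finally show ?thesis .
            qed
            ultimately show ?thesis using True by (simp add: K_def ennreal_leI flip: ennreal_mult)
          qed simp
        qed
        also have "\<dots> = ennreal K * I"
        proof -
          have "ball c \<delta> \<subseteq> S" using S(2) ball_subset_cball by blast
          from meas[OF cont this] show ?thesis
            unfolding I_def by (intro nn_integral_cmult) simp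
        qed
        finally have 1: "v * \<eta> ^ d * norm (g w0) \<le> K * J"
          using J v \<eta> by (simp add: K_def ennreal_le_iff flip: ennreal_mult')
        have K: "K = A powr (1 - q) * norm (g w0) / norm (g w0) powr q"
          using A g0 by (simp add: K_def powr_mult powr_diff)
        have 2: "v * (\<eta> ^ d * norm (g w0) powr q) \<le> A powr (1 - q) * J"
          using 1 g0 by (simp add: K field_simps)
        have "\<phi> c powr q \<le> \<phi> w0 powr q"
          using max[of c] \<delta> \<open>\<phi> c > 0\<close> q by (intro powr_mono2) auto
        then have "\<delta> ^ d * norm (g c) powr q \<le> 2 ^ d * (\<eta> ^ d * norm (g w0) powr q)"
          using \<delta> \<eta> unfolding \<phi>c \<phi>w0
          by (simp add: powr_mult powr_powr e powr_realpow power_mult_distrib mult.assoc)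
        then have "v * (\<delta> ^ d * norm (g c) powr q) \<le> 2 ^ d * (v * (\<eta> ^ d * norm (g w0) powr q))"
          using v by (simp add: mult.left_commute)
        also have "\<dots> \<le> 2 ^ d * (A powr (1 - q) * J)"
          using 2 by (intro mult_left_mono) auto
        finally have "norm (g c) powr q \<le> C * J"
          using v \<delta> by (simp add: C_def field_simps)
        then show ?thesis unfolding J(2) using \<open>C > 0\<close> J(1)
          by (simp add: ennreal_leI flip: ennreal_mult')
      qed
    qed
  qed
qed

section \<open>Functions and weighted integrals under automorphisms\<close>

lemma holomorphic_several_aut:
  fixes f :: "'n::{finite,linorder} cvec \<Rightarrow> complex"
  assumes z: "z \<in> T_B" and f: "holomorphic_several_on f T_B"
  shows "holomorphic_several_on (\<lambda>w. f (aut z w)) T_B"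
proof -
  define L :: "'n cvec \<Rightarrow> 'n cvec" where "L w = (\<chi> j. if j = last_ix
     then of_real (rho1 z) * w $ last_ix
       + 2 * of_real (sqrt (rho1 z)) * (\<Sum>k\<in>UNIV - {last_ix}. of_real (Im (z $ k)) * w $ k)
     else of_real (sqrt (rho1 z)) * w $ j)" for w
  have L_scaleC: "L (c *s w) = c *s L w" for c w
    by (auto simp: L_def vec_eq_iff algebra_simps sum_distrib_left)
  have "linear L"
  proof (rule linearI)
    show "L (v + w) = L v + L w" for v w
      by (auto simp: L_def vec_eq_iff algebra_simps sum.distrib)
    show "L (r *\<^sub>R w) = r *\<^sub>R L w" for r w
    proof -
      have "r *\<^sub>R v = of_real r *s v" for v :: "'n cvec"
        by (simp add: vec_eq_iff complex_eq_iff)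
      then show ?thesis by (simp only: L_scaleC)
    qed
  qed
  then have "bounded_linear L" by (simp add: linear_conv_bounded_linear)
  have aut_L: "aut z w = aut z 0 + L w" for w
    by (auto simp: aut_def L_def vec_eq_iff)
  have D: "(aut z has_derivative L) (at w)" for w
  proof -
    have "((\<lambda>w. aut z 0 + L w) has_derivative (\<lambda>h. 0 + L h)) (at w)"
      by (intro has_derivative_add has_derivative_const bounded_linear_imp_has_derivative \<open>bounded_linear L\<close>)
    moreover have "(\<lambda>w. aut z 0 + L w) = aut z" using aut_L by (intro ext) (rule sym)
    ultimately show ?thesis by simp
  qed
  show ?thesis
    unfolding holomorphic_several_on_def
  proof
    fix w assume "w \<in> (T_B :: 'n cvec set)"
    then obtain f' where f': "(f has_derivative f') (at (aut z w))" "\<And>c v. f' (c *s v) = c * f' v"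
      using f z unfolding holomorphic_several_on_def by (meson aut_in_T_B_iff)
    have "((\<lambda>w. f (aut z w)) has_derivative (\<lambda>h. f' (L h))) (at w)"
      by (rule has_derivative_compose[OF D f'(1)])
    then show "\<exists>f'. ((\<lambda>w. f (aut z w)) has_derivative f') (at w) \<and> (\<forall>c v. f' (c *s v) = c * f' v)"
      using f'(2) L_scaleC by metis
  qed
qed

text \<open>Integration against \<open>V_meas\<close>, written over the whole space, where the
  change of variables by \<open>aut\<close> and Fubini for Lebesgue measure apply directly.\<close>

abbreviation V_int :: "real \<Rightarrow> ('n::{finite,linorder} cvec \<Rightarrow> ennreal) \<Rightarrow> ennreal" where
  "V_int \<alpha> h \<equiv> (\<integral>\<^sup>+w. indicator T_B w * (ennreal (rho1 w powr \<alpha>) * h w) \<partial>lborel)"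

lemma nn_integral_V_meas:
  assumes "h \<in> borel_measurable (restrict_space borel T_B)"
  shows "(\<integral>\<^sup>+w. h w \<partial>V_meas \<alpha>) = V_int \<alpha> h"
proof -
  have h: "h \<in> borel_measurable (restrict_space lborel T_B)"
    using assms measurable_cong_sets[OF sets_restrict_space_cong[OF sets_lborel] refl] by blast
  have [measurable]: "rho1 \<in> borel_measurable (restrict_space lborel T_B)"
    by (intro measurable_restrict_space1) measurable
  have "(\<integral>\<^sup>+w. h w \<partial>V_meas \<alpha>) = (\<integral>\<^sup>+w. ennreal (rho1 w powr \<alpha>) * h w \<partial>restrict_space lborel T_B)"
    unfolding V_meas_def by (rule nn_integral_density) (use h in measurable)
  also have "\<dots> = V_int \<alpha> h"
    by (subst nn_integral_restrict_space) (auto simp: mult.commute)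
  finally show ?thesis .
qed

text \<open>The exponent is n + 1 from the Jacobian plus a from the weight, because
  \<open>rho1\<close> is multiplicative along \<open>aut\<close>.\<close>

lemma nn_integral_weighted_aut:
  fixes z :: "'n::{finite,linorder} cvec"
  assumes z: "z \<in> T_B" and [measurable]: "h \<in> borel_measurable borel"
  shows "V_int a h =
     ennreal (rho1 z powr (real CARD('n) + a + 1)) *
     V_int a (\<lambda>w :: 'n cvec. h (aut z w))"
proof -
  have r: "rho1 z > 0" using z by (simp add: T_B_iff)
  have "V_int a h =
     ennreal (rho1 z ^ (CARD('n) + 1)) *
     (\<integral>\<^sup>+w. indicator T_B (aut z w) * (ennreal (rho1 (aut z w) powr a) * h (aut z w)) \<partial>(lborel :: 'n cvec measure))"
    by (rule nn_integral_aut[OF z]) measurable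
  also have "(\<integral>\<^sup>+w. indicator T_B (aut z w) * (ennreal (rho1 (aut z w) powr a) * h (aut z w)) \<partial>(lborel :: 'n cvec measure)) =
    (\<integral>\<^sup>+w. ennreal (rho1 z powr a) * (indicator T_B w * (ennreal (rho1 w powr a) * h (aut z w))) \<partial>(lborel :: 'n cvec measure))"
  proof (rule nn_integral_cong)
    fix w :: "'n cvec"
    show "indicator T_B (aut z w) * (ennreal (rho1 (aut z w) powr a) * h (aut z w)) =
        ennreal (rho1 z powr a) * (indicator T_B w * (ennreal (rho1 w powr a) * h (aut z w)))"
    proof (cases "w \<in> T_B")
      case True
      then have "rho1 w > 0" by (simp add: T_B_iff)
      then show ?thesis
        using True z r by (simp add: aut_in_T_B_iff rho1_aut powr_mult ennreal_mult mult_ac)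
    qed (simp add: z aut_in_T_B_iff)
  qed
  also have "\<dots> = ennreal (rho1 z powr a) * V_int a (\<lambda>w :: 'n cvec. h (aut z w))"
    by (rule nn_integral_cmult) measurable
  also have "ennreal (rho1 z ^ (CARD('n) + 1)) * (ennreal (rho1 z powr a) * X) =
      ennreal (rho1 z powr (real CARD('n) + a + 1)) * X" for X
  proof -
    have "rho1 z ^ (CARD('n) + 1) * rho1 z powr a = rho1 z powr (real CARD('n) + a + 1)"
      using r by (subst powr_realpow[symmetric]) (simp_all add: algebra_simps flip: powr_add)
    then have "ennreal (rho1 z ^ (CARD('n) + 1)) * ennreal (rho1 z powr a) = ennreal (rho1 z powr (real CARD('n) + a + 1))"
      using r by (subst ennreal_mult[symmetric]) auto
    then show ?thesis by (simp only: mult.assoc[symmetric])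
  qed
  finally show ?thesis .
qed

text \<open>By homogeneity the integral at z is \<rho>(z)^(n+a+1-b) times its value at the base
  point, which is finite for b > a + n + 1. Schur's test uses it with weights a smaller than
  \<alpha>.\<close>

lemma nn_integral_rho_kernel:
  fixes a b :: real
  assumes a: "a > -1" and b: "b > a + real CARD('n) + 1"
  obtains J :: real where "J > 0" and "\<And>z :: 'n::{finite,linorder} cvec. z \<in> T_B \<Longrightarrow>
    V_int a (\<lambda>w :: 'n cvec. ennreal (norm (rho z w) powr (- b)))
      \<le> ennreal (J * rho1 z powr (real CARD('n) + a + 1 - b))"
proof -
  let ?J = "V_int a (\<lambda>w :: 'n cvec. ennreal (norm (rho base_pt w) powr (- b)))"
  have "?J < \<infinity>"
    using nn_integral_rho_finite[OF assms] by (simp add: ennreal_mult norm_rho_commute)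
  then obtain J0 where J0: "?J = ennreal J0" "J0 \<ge> 0" by (cases ?J) auto
  show thesis
  proof (rule that[of "J0 + 1"])
    fix z :: "'n cvec" assume z: "z \<in> T_B"
    then have r: "rho1 z > 0" by (simp add: T_B_iff)
    have "V_int a (\<lambda>w :: 'n cvec. ennreal (norm (rho z w) powr (- b))) =
       ennreal (rho1 z powr (real CARD('n) + a + 1)) *
       V_int a (\<lambda>w :: 'n cvec. ennreal (norm (rho z (aut z w)) powr (- b)))"
      by (rule nn_integral_weighted_aut[OF z]) measurable
    also have "V_int a (\<lambda>w :: 'n cvec. ennreal (norm (rho z (aut z w)) powr (- b))) =
       (\<integral>\<^sup>+w. ennreal (rho1 z powr (- b)) * (indicator T_B w * (ennreal (rho1 w powr a) * ennreal (norm (rho base_pt w) powr (- b)))) \<partial>(lborel :: 'n cvec measure))"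
      using z r by (intro nn_integral_cong) (simp add: rho_aut_right norm_mult powr_mult ennreal_mult mult_ac)
    also have "\<dots> = ennreal (rho1 z powr (- b)) * ?J" by (rule nn_integral_cmult) measurable
    also have "ennreal (rho1 z powr (real CARD('n) + a + 1)) * (ennreal (rho1 z powr (- b)) * ?J)
        = ennreal (J0 * rho1 z powr (real CARD('n) + a + 1 - b))"
      using J0 r by (simp add: powr_diff powr_minus_divide mult_ac flip: ennreal_mult)
    also have "\<dots> \<le> ennreal ((J0 + 1) * rho1 z powr (real CARD('n) + a + 1 - b))"
      by (intro ennreal_leI mult_right_mono) auto
    finally show "V_int a (\<lambda>w :: 'n cvec. ennreal (norm (rho z w) powr (- b)))
      \<le> ennreal ((J0 + 1) * rho1 z powr (real CARD('n) + a + 1 - b))" .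
  qed (use J0 in auto)
qed

text \<open>Automorphisms carry balls to balls, so the volume is that at the base point times
  \<rho>(z)^(n+\<alpha>+1). The volume at the base point is positive because the ball contains a
  Euclidean one, and finite because |\<rho>(w,i)| \<le> 2c on it, so that an integrable power of the
  kernel dominates the indicator.\<close>

lemma emeasure_V_meas_hball:
  fixes \<alpha> c :: real
  assumes \<alpha>: "\<alpha> > -1" and c: "c > 1"
  obtains v :: real where "v > 0" and "\<And>z :: 'n::{finite,linorder} cvec. z \<in> T_B \<Longrightarrow>
    emeasure (V_meas \<alpha>) (hball c z) = ennreal (v * rho1 z powr (real CARD('n) + \<alpha> + 1))"
proof -
  let ?N = "real CARD('n) + \<alpha> + 1"
  define V where "V z = V_int \<alpha> (\<lambda>w :: 'n cvec. indicator (hball c z) w)" for z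
  have eV: "emeasure (V_meas \<alpha>) (hball c z) = V z" for z :: "'n cvec"
  proof -
    have sub: "hball c z \<subseteq> T_B" by (auto simp: hball_def)
    have "hball c z \<in> sets (V_meas \<alpha>)"
      using sub by (simp add: V_meas_def sets_restrict_space_iff)
    then have "emeasure (V_meas \<alpha>) (hball c z) = (\<integral>\<^sup>+w. indicator (hball c z) w \<partial>V_meas \<alpha>)" by simp
    also have "\<dots> = V z"
      unfolding V_def by (rule nn_integral_V_meas) (intro measurable_restrict_space1 borel_measurable_indicator hball_measurable)
    finally show ?thesis .
  qed
  have VN: "V z = ennreal (rho1 z powr ?N) * V base_pt" if z: "z \<in> T_B" for z
  proof -
    have "V z = ennreal (rho1 z powr ?N) *
       V_int \<alpha> (\<lambda>w :: 'n cvec. indicator (hball c z) (aut z w))"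
      unfolding V_def by (rule nn_integral_weighted_aut[OF z]) measurable
    then show ?thesis using z by (simp add: V_def indicator_def aut_in_hball_iff)
  qed
  have "V base_pt < \<infinity>"
  proof -
    let ?b = "?N + 1"
    have "V base_pt \<le> (\<integral>\<^sup>+w. ennreal ((2 * c) powr ?b) * (indicator T_B w * ennreal (rho1 w powr \<alpha> * norm (rho w base_pt) powr (- ?b))) \<partial>(lborel :: 'n cvec measure))"
      unfolding V_def
    proof (rule nn_integral_mono)
      fix w :: "'n cvec"
      show "indicator T_B w * (ennreal (rho1 w powr \<alpha>) * indicator (hball c base_pt) w) \<le>
        ennreal ((2 * c) powr ?b) * (indicator T_B w * ennreal (rho1 w powr \<alpha> * norm (rho w base_pt) powr (- ?b)))"
      proof (cases "w \<in> hball c base_pt")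
        case True
        then have w: "w \<in> T_B" by (simp add: hball_def)
        have n: "norm (rho w base_pt) \<le> 2 * c"
          using hball_norm_le[OF base_pt_in_T_B True] c by (simp add: norm_rho_commute)
        have p: "norm (rho w base_pt) > 0" using norm_rho_pos[OF w base_pt_in_T_B] .
        have "1 = (2 * c) powr ?b * (2 * c) powr (- ?b)" using c by (simp flip: powr_add)
        also have "\<dots> \<le> (2 * c) powr ?b * norm (rho w base_pt) powr (- ?b)"
          using n p \<alpha> by (intro mult_left_mono powr_mono2') auto
        finally have "rho1 w powr \<alpha> * 1 \<le> rho1 w powr \<alpha> * ((2 * c) powr ?b * norm (rho w base_pt) powr (- ?b))"
          by (rule mult_left_mono) simp
        then have "ennreal (rho1 w powr \<alpha>) \<le> ennreal ((2 * c) powr ?b * (rho1 w powr \<alpha> * norm (rho w base_pt) powr (- ?b)))"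
          by (intro ennreal_leI) (simp add: mult_ac)
        then show ?thesis using True w by (simp add: ennreal_mult)
      qed simp
    qed
    also have "\<dots> = ennreal ((2 * c) powr ?b) * (\<integral>\<^sup>+w. (indicator T_B w * ennreal (rho1 w powr \<alpha> * norm (rho w base_pt) powr (- ?b))) \<partial>(lborel :: 'n cvec measure))"
      by (rule nn_integral_cmult) measurable
    also have "\<dots> < \<infinity>"
      using nn_integral_rho_finite[where 'n = 'n, OF \<alpha>, of ?b] by (simp add: ennreal_mult_less_top)
    finally show ?thesis .
  qed
  then obtain v where v: "V base_pt = ennreal v" "v \<ge> 0" by (cases "V base_pt") auto
  have "V base_pt \<noteq> 0"
  proof
    assume "V base_pt = 0"
    then have "AE w in (lborel :: 'n cvec measure). indicator T_B w * (ennreal (rho1 w powr \<alpha>) * indicator (hball c base_pt) w) = 0"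
      unfolding V_def by (subst (asm) nn_integral_0_iff_AE) measurable
    then have "AE w in (lborel :: 'n cvec measure). w \<notin> hball c base_pt"
      by eventually_elim (auto simp: hball_def T_B_iff split: split_indicator_asm)
    then have "emeasure (lborel :: 'n cvec measure) (hball c base_pt) = 0"
      by (subst (asm) AE_iff_measurable[of "hball c base_pt"]) auto
    moreover obtain \<delta> where "\<delta> > 0" "ball base_pt \<delta> \<subseteq> hball c (base_pt :: 'n cvec)"
      using open_hball[of c "base_pt :: 'n cvec"] center_in_hball[OF base_pt_in_T_B c] open_contains_ball by blast
    ultimately have "emeasure lborel (ball (base_pt :: 'n cvec) \<delta>) = 0"
      by (metis emeasure_mono hball_measurable le_zero_eq sets_lborel)
    then have "ennreal (unit_ball_vol (real DIM('n cvec)) * \<delta> ^ DIM('n cvec)) = 0"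
      using emeasure_ball[of \<delta> "base_pt :: 'n cvec"] \<open>\<delta> > 0\<close> by simp
    moreover have "unit_ball_vol (real DIM('n cvec)) * \<delta> ^ DIM('n cvec) > 0"
      using \<open>\<delta> > 0\<close> by (intro mult_pos_pos unit_ball_vol_pos zero_less_power) auto
    ultimately show False by (metis ennreal_eq_0_iff not_le)
  qed
  then have "v > 0" using v by (cases "v = 0") auto
  then show thesis
    using eV VN v by (intro that[of v]) (auto simp: mult.commute simp flip: ennreal_mult)
qed

text \<open>At the base point it follows from the Euclidean inequality on a small ball inside the
  Bergman ball, where \<rho>^\<alpha> is bounded below. Applied to f composed with
  \<open>aut z\<close>, it reaches every z with the same constant.\<close>

lemma norm_powr_submean:
  fixes q \<alpha> c :: real
  assumes q: "q > 0" and c: "c > 1"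
  obtains C :: real where "C > 0"
    and "\<And>(z :: 'n::{finite,linorder} cvec) f. z \<in> T_B \<Longrightarrow> holomorphic_several_on f T_B \<Longrightarrow>
      ennreal (norm (f z) powr q) \<le> ennreal (C * rho1 z powr (- (real CARD('n) + \<alpha> + 1))) *
        V_int \<alpha> (\<lambda>w :: 'n cvec. ennreal (norm (f w) powr q) * indicator (hball c z) w)"
proof -
  let ?N = "real CARD('n) + \<alpha> + 1"
  obtain \<delta> where \<delta>: "\<delta> > 0" "cball base_pt \<delta> \<subseteq> hball c (base_pt :: 'n cvec)"
    using open_hball[of c "base_pt :: 'n cvec"] center_in_hball[OF base_pt_in_T_B c] open_contains_cball by blast
  have sub: "cball base_pt \<delta> \<subseteq> (T_B :: 'n cvec set)" using \<delta>(2) by (auto simp: hball_def)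
  \<comment> \<open>The sign of \<alpha> is arbitrary, so the lower bound \<open>m\<close> of the
    weight is taken from compactness.\<close>
  have "continuous_on (cball base_pt \<delta>) (\<lambda>w :: 'n cvec. rho1 w powr \<alpha>)"
    using sub by (intro continuous_intros) (auto simp: T_B_iff subset_iff)
  then have "\<exists>x\<in>cball (base_pt :: 'n cvec) \<delta>. \<forall>w\<in>cball (base_pt :: 'n cvec) \<delta>. rho1 x powr \<alpha> \<le> rho1 w powr \<alpha>"
    using \<delta>(1) by (intro continuous_attains_inf) auto
  then obtain w0 :: "'n cvec" where w0: "w0 \<in> cball base_pt \<delta>" "\<And>w. w \<in> cball (base_pt :: 'n cvec) \<delta> \<Longrightarrow> rho1 w0 powr \<alpha> \<le> rho1 w powr \<alpha>"
    by blast
  define m where "m = rho1 w0 powr \<alpha>"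
  have m: "m > 0" using w0(1) sub by (auto simp: m_def T_B_iff subset_iff)
  obtain C0 :: real where C0: "C0 > 0"
    "\<And>g S. holomorphic_several_on g S \<Longrightarrow> open S \<Longrightarrow> cball (base_pt :: 'n cvec) \<delta> \<subseteq> S \<Longrightarrow>
      ennreal (norm (g base_pt) powr q) \<le> ennreal C0 * (\<integral>\<^sup>+w. ennreal (norm (g w) powr q) * indicator (ball base_pt \<delta>) w \<partial>(lborel :: 'n cvec measure))"
    by (rule norm_powr_holomorphic_several_submean[OF q \<delta>(1), of "base_pt :: 'n cvec"], rule that)
  show thesis
  proof (rule that[of "C0 / m"])
    show "C0 / m > 0" using C0 m by simp
    fix z :: "'n cvec" and f :: "'n cvec \<Rightarrow> complex" assume z: "z \<in> T_B" and f: "holomorphic_several_on f T_B"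
    have r: "rho1 z > 0" using z by (simp add: T_B_iff)
    define h where "h w = (ennreal (norm (f w) powr q) * indicator T_B w) * indicator (hball c z) w" for w
    have "f \<in> borel_measurable (restrict_space borel T_B)"
      using holomorphic_several_continuous_on[OF f] by (rule borel_measurable_continuous_on_restrict)
    then have "(\<lambda>w. ennreal (norm (f w) powr q)) \<in> borel_measurable (restrict_space borel T_B)" by measurable
    then have [measurable]: "(\<lambda>w. ennreal (norm (f w) powr q) * indicator T_B w) \<in> borel_measurable borel"
      by (subst (asm) borel_measurable_restrict_space_iff_ennreal) auto
    have [measurable]: "h \<in> borel_measurable borel" unfolding h_def by measurable
    let ?I = "\<integral>\<^sup>+w. indicator T_B w * (ennreal (rho1 w powr \<alpha>) * h (aut z w)) \<partial>lborel"
    have "V_int \<alpha> (\<lambda>w :: 'n cvec. ennreal (norm (f w) powr q) * indicator (hball c z) w)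
       = V_int \<alpha> h"
      by (intro nn_integral_cong) (auto simp: h_def split: split_indicator)
    also have "\<dots> = ennreal (rho1 z powr ?N) * ?I"
      by (rule nn_integral_weighted_aut[OF z]) measurable
    finally have 1: "V_int \<alpha> (\<lambda>w :: 'n cvec. ennreal (norm (f w) powr q) * indicator (hball c z) w)
       = ennreal (rho1 z powr ?N) * ?I" .
    have "ennreal (norm (f (aut z base_pt)) powr q) \<le> ennreal C0 * (\<integral>\<^sup>+w. ennreal (norm (f (aut z w)) powr q) * indicator (ball base_pt \<delta>) w \<partial>(lborel :: 'n cvec measure))"
      by (rule C0(2)[OF holomorphic_several_aut[OF z f] open_T_B sub])
    also have "\<dots> \<le> ennreal C0 * (\<integral>\<^sup>+w. ennreal (1 / m) * (indicator T_B w * (ennreal (rho1 w powr \<alpha>) * h (aut z w))) \<partial>(lborel :: 'n cvec measure))"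
    proof (intro mult_left_mono nn_integral_mono)
      fix w :: "'n cvec"
      show "ennreal (norm (f (aut z w)) powr q) * indicator (ball base_pt \<delta>) w \<le>
          ennreal (1 / m) * (indicator T_B w * (ennreal (rho1 w powr \<alpha>) * h (aut z w)))"
      proof (cases "w \<in> ball base_pt \<delta>")
        case True
        then have wc: "w \<in> cball base_pt \<delta>" by auto
        then have w: "w \<in> T_B" "w \<in> hball c base_pt" using sub \<delta>(2) by auto
        have h: "h (aut z w) = ennreal (norm (f (aut z w)) powr q)"
          using w z by (simp add: h_def aut_in_hball_iff aut_in_T_B_iff)
        have "1 \<le> 1 / m * rho1 w powr \<alpha>" using w0(2)[OF wc] m by (simp add: m_def field_simps)
        then have "1 * norm (f (aut z w)) powr q \<le> (1 / m * rho1 w powr \<alpha>) * norm (f (aut z w)) powr q"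
          by (rule mult_right_mono) simp
        then have "ennreal (norm (f (aut z w)) powr q) \<le> ennreal (1 / m * (rho1 w powr \<alpha> * norm (f (aut z w)) powr q))"
          by (intro ennreal_leI) (simp add: mult_ac)
        also have "\<dots> = ennreal (1 / m) * (ennreal (rho1 w powr \<alpha>) * h (aut z w))"
          using m unfolding h by (subst ennreal_mult; simp add: ennreal_mult)
        finally show ?thesis using True w by simp
      qed simp
    qed simp
    also have "\<dots> = ennreal C0 * (ennreal (1 / m) * ?I)"
      by (subst nn_integral_cmult) measurable
    also have "\<dots> = ennreal (C0 / m * rho1 z powr (- ?N)) * (ennreal (rho1 z powr ?N) * ?I)"
    proof -
      have *: "ennreal (C0 / m * rho1 z powr (- ?N)) * ennreal (rho1 z powr ?N) = ennreal C0 * ennreal (1 / m)"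
        using C0(1) m r by (simp flip: ennreal_mult) (simp add: mult.assoc flip: powr_add)
      show ?thesis unfolding mult.assoc[symmetric] * ..
    qed
    finally show "ennreal (norm (f z) powr q) \<le> ennreal (C0 / m * rho1 z powr (- ?N)) *
        V_int \<alpha> (\<lambda>w :: 'n cvec. ennreal (norm (f w) powr q) * indicator (hball c z) w)"
      unfolding 1 aut_base_pt[OF z] .
  qed
qed

section \<open>Differentiation of kernel integrals\<close>

definition drho :: "'n::{finite,linorder} cvec \<Rightarrow> 'n cvec \<Rightarrow> 'n cvec \<Rightarrow> complex" where
  "drho z w h = 1/4 * ((\<Sum>j\<in>UNIV - {last_ix}. 2 * h $ j * (z $ j - cnj (w $ j))) - 2 * \<i> * h $ last_ix)"

lemma drho_scaleC: "drho z w (c *s v) = c * drho z w v"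
  by (simp add: drho_def sum_distrib_left algebra_simps)

lemma drho_add: "drho z w (u + v) = drho z w u + drho z w v"
  by (simp add: drho_def sum.distrib sum_subtractf algebra_simps)

lemma drho_scaleR: "drho z w (r *\<^sub>R v) = r *\<^sub>R drho z w v"
proof -
  have "r *\<^sub>R v = of_real r *s v" by (simp add: vec_eq_iff complex_eq_iff)
  then show ?thesis by (simp only: drho_scaleC scaleR_conv_of_real)
qed

text \<open>Along the last coordinate the derivative is the same constant for all z and w. Hence
  differentiating a power of \<rho> in this direction gives a pure power again, on which the lower
  estimate for the Toeplitz operator relies.\<close>

lemma drho_axis: "drho z w (axis last_ix 1) = - \<i> / 2"
proof -
  have "(\<Sum>j\<in>UNIV - {last_ix}. 2 * axis last_ix 1 $ j * (z $ j - cnj (w $ j))) = 0"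
    by (intro sum.neutral) (auto simp: axis_def)
  then show ?thesis by (simp add: drho_def)
qed

lemma has_derivative_rho: "((\<lambda>z. rho z w) has_derivative drho z w) (at z)"
proof -
  have nth: "((\<lambda>z :: 'a cvec. z $ j) has_derivative (\<lambda>h. h $ j)) (at z)" for j
    by (rule bounded_linear_imp_has_derivative[OF bounded_linear_vec_nth])
  show ?thesis
    unfolding rho_def[abs_def]
    by (rule derivative_eq_intros nth refl | simp)+
       (auto simp: drho_def fun_eq_iff sum_distrib_left sum_divide_distrib diff_divide_distrib add_divide_distrib algebra_simps)
qed

text \<open>\<rho> is a quadratic polynomial in its first variable, so the expansion is exact and
  bounds increments of any size.\<close>

lemma rho_add_left: "rho (z + h) w = rho z w + drho z w h + 1/4 * (\<Sum>j\<in>UNIV - {last_ix}. (h $ j)\<^sup>2)"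
proof -
  have "(\<Sum>j\<in>UNIV - {last_ix}. ((z + h) $ j - cnj (w $ j))\<^sup>2) =
     (\<Sum>j\<in>UNIV - {last_ix}. (z $ j - cnj (w $ j))\<^sup>2) +
     (\<Sum>j\<in>UNIV - {last_ix}. 2 * h $ j * (z $ j - cnj (w $ j))) + (\<Sum>j\<in>UNIV - {last_ix}. (h $ j)\<^sup>2)"
    unfolding sum.distrib[symmetric] by (intro sum.cong) (auto simp: power2_eq_square algebra_simps)
  then show ?thesis by (simp add: rho_def drho_def algebra_simps)
qed

text \<open>Bounds relative to |\<rho>(z,w)| are uniform in w over the unbounded domain and provide
  the integrable majorants below. The point is |z_j - cnj w_j| \<le> E|\<rho>(z,w)| for j other than
  the last index: |z_j - w_j|^2 is at most 4 Re \<rho>(z,w), and constants are absorbed by Re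
  \<rho>(z,w) \<ge> \<rho>(z)/2.\<close>

lemma drho_bound:
  fixes z :: "'n::{finite,linorder} cvec"
  assumes z: "z \<in> T_B"
  obtains A :: real where "A > 0"
    and "\<And>w h. w \<in> T_B \<Longrightarrow> norm (drho z w h) \<le> A * norm h * norm (rho z w)"
    and "\<And>w h. w \<in> T_B \<Longrightarrow> norm (rho (z + h) w - rho z w) \<le> A * (norm h + (norm h)\<^sup>2) * norm (rho z w)"
proof -
  let ?I = "UNIV - {last_ix :: 'n}"
  have r: "rho1 z > 0" using z by (simp add: T_B_iff)
  \<comment> \<open>From x \<le> 1 + x^2 with x^2 \<le> 8R + 8|z|^2 and 1 \<le> 2R/\<rho>(z), where
    R = Re \<rho>(z,w).\<close>
  define E where "E = 8 + 2 * (1 + 8 * (norm z)\<^sup>2) / rho1 z"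
  have E: "E > 0" using r by (simp add: E_def add_pos_nonneg)
  have diff: "norm (z $ j - cnj (w $ j)) \<le> E * norm (rho z w)" if w: "w \<in> T_B" and j: "j \<in> ?I" for w j
  proof -
    define R where "R = Re (rho z w)"
    have R: "R \<ge> rho1 z / 2" "R \<le> norm (rho z w)"
      using Re_rho_ge[of z w] w complex_Re_le_cmod[of "rho z w"] by (auto simp: R_def T_B_iff)
    let ?d = "(Re (z $ j) - Re (w $ j))\<^sup>2 + (Im (z $ j) - Im (w $ j))\<^sup>2"
    have "?d \<le> (\<Sum>j\<in>?I. (Re (z $ j) - Re (w $ j))\<^sup>2 + (Im (z $ j) - Im (w $ j))\<^sup>2)"
      using j by (intro member_le_sum) auto
    also have "\<dots> \<le> 4 * R" unfolding R_def Re_rho using r w by (simp add: T_B_iff)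
    finally have d: "?d \<le> 4 * R" .
    have "\<bar>Im (z $ j)\<bar> \<le> norm z"
      using abs_Im_le_cmod[of "z $ j"] Finite_Cartesian_Product.norm_nth_le[of z j] by linarith
    then have y: "(Im (z $ j))\<^sup>2 \<le> (norm z)\<^sup>2" by (metis abs_ge_zero power2_abs power_mono)
    \<comment> \<open>The conjugate turns the difference of imaginary parts into a sum. The gap in
      the next estimate is exactly (Re z_j - Re w_j)^2 + (3 Im z_j - Im w_j)^2.\<close>
    have "(norm (z $ j - cnj (w $ j)))\<^sup>2 = (Re (z $ j) - Re (w $ j))\<^sup>2 + (Im (z $ j) + Im (w $ j))\<^sup>2"
      by (simp add: cmod_power2)
    also have "\<dots> \<le> 2 * ?d + 8 * (Im (z $ j))\<^sup>2"
      using zero_le_power2[of "Re (z $ j) - Re (w $ j)"] zero_le_power2[of "3 * Im (z $ j) - Im (w $ j)"]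
      by (simp add: power2_eq_square algebra_simps)
    also have "\<dots> \<le> 2 * (4 * R) + 8 * (norm z)\<^sup>2"
      using d y by (intro add_mono mult_left_mono) auto
    also have "\<dots> = 8 * R + 8 * (norm z)\<^sup>2" by simp
    finally have 1: "(norm (z $ j - cnj (w $ j)))\<^sup>2 \<le> 8 * R + 8 * (norm z)\<^sup>2" .
    have "norm (z $ j - cnj (w $ j)) \<le> 1 + (norm (z $ j - cnj (w $ j)))\<^sup>2"
      using zero_le_power2[of "norm (z $ j - cnj (w $ j)) - 1/2"] by (simp add: power2_eq_square algebra_simps)
    also have "\<dots> \<le> 8 * R + (1 + 8 * (norm z)\<^sup>2) * 1" using 1 by simp
    also have "\<dots> \<le> 8 * R + (1 + 8 * (norm z)\<^sup>2) * (2 * R / rho1 z)"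
      using R r by (intro add_left_mono mult_left_mono) (auto simp: field_simps)
    also have "\<dots> = E * R" using r by (simp add: E_def field_simps)
    also have "\<dots> \<le> E * norm (rho z w)" using R E by (intro mult_left_mono) auto
    finally show ?thesis .
  qed
  have one: "1 \<le> 2 / rho1 z * norm (rho z w)" if "w \<in> T_B" for w
    using norm_rho_ge[of z w] that r by (simp add: T_B_iff field_simps)
  define n where "n = real (card ?I)"
  define A where "A = n * E + n / rho1 z + 1 / rho1 z"
  have n: "n \<ge> 0" by (simp add: n_def)
  have A: "A > 0" using E r by (simp add: A_def n_def add_nonneg_pos)
  have d: "norm (drho z w h) \<le> (n * E / 2 + 1 / rho1 z) * norm h * norm (rho z w)" if w: "w \<in> T_B" for w h
  proof -
    have "norm (\<Sum>j\<in>?I. 2 * h $ j * (z $ j - cnj (w $ j))) \<le> (\<Sum>j\<in>?I. 2 * norm h * (E * norm (rho z w)))"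
      using diff[OF w] E
      by (intro sum_norm_le) (auto simp: norm_mult intro!: mult_mono Finite_Cartesian_Product.norm_nth_le)
    then have 1: "norm (\<Sum>j\<in>?I. 2 * h $ j * (z $ j - cnj (w $ j))) \<le> n * (2 * norm h * (E * norm (rho z w)))"
      by (simp only: sum_constant n_def)
    have "norm (2 * \<i> * h $ last_ix) \<le> 2 * norm h * 1" by (simp add: norm_mult Finite_Cartesian_Product.norm_nth_le)
    also have "\<dots> \<le> 2 * norm h * (2 / rho1 z * norm (rho z w))"
      using one[OF w] by (intro mult_left_mono) auto
    finally have 2: "norm (2 * \<i> * h $ last_ix) \<le> 2 * norm h * (2 / rho1 z * norm (rho z w))" .
    have "norm (drho z w h) \<le> 1/4 * (norm (\<Sum>j\<in>?I. 2 * h $ j * (z $ j - cnj (w $ j))) + norm (2 * \<i> * h $ last_ix))"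
    proof -
      have "norm (1/4 * (x - y)) \<le> 1/4 * (norm x + norm y)" for x y :: complex
        using norm_triangle_ineq4[of x y] by (simp add: norm_mult)
      then show ?thesis unfolding drho_def .
    qed
    also have "\<dots> \<le> 1/4 * (n * (2 * norm h * (E * norm (rho z w))) + 2 * norm h * (2 / rho1 z * norm (rho z w)))"
      using 1 2 by simp
    also have "\<dots> = (n * E / 2 + 1 / rho1 z) * norm h * norm (rho z w)" by (simp add: algebra_simps)
    finally show ?thesis .
  qed
  have A': "n * E / 2 + 1 / rho1 z \<le> A" using n E r by (simp add: A_def)
  show thesis
  proof (rule that[OF A])
    fix w h :: "'n cvec" assume w: "w \<in> T_B"
    have "(n * E / 2 + 1 / rho1 z) * norm h * norm (rho z w) \<le> A * norm h * norm (rho z w)"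
      using A' by (intro mult_right_mono) auto
    with d[OF w, of h] show dA: "norm (drho z w h) \<le> A * norm h * norm (rho z w)" by linarith
    have "norm (\<Sum>j\<in>?I. (h $ j)\<^sup>2) \<le> (\<Sum>j\<in>?I. (norm h)\<^sup>2)"
      by (intro sum_norm_le) (auto simp: norm_power intro!: power_mono Finite_Cartesian_Product.norm_nth_le)
    also have "\<dots> = n * (norm h)\<^sup>2 * 1" by (simp only: sum_constant n_def mult_1_right)
    also have "\<dots> \<le> n * (norm h)\<^sup>2 * (2 / rho1 z * norm (rho z w))"
      using one[OF w] n by (intro mult_left_mono) auto
    finally have "norm (1/4 * (\<Sum>j\<in>?I. (h $ j)\<^sup>2)) \<le> n / (2 * rho1 z) * (norm h)\<^sup>2 * norm (rho z w)"
      by (simp add: norm_mult mult_ac)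
    also have "\<dots> \<le> A * (norm h)\<^sup>2 * norm (rho z w)"
      using n E r by (intro mult_right_mono) (auto simp: A_def field_simps)
    finally have q: "norm (1/4 * (\<Sum>j\<in>?I. (h $ j)\<^sup>2)) \<le> A * (norm h)\<^sup>2 * norm (rho z w)" .
    have "rho (z + h) w - rho z w = drho z w h + 1/4 * (\<Sum>j\<in>?I. (h $ j)\<^sup>2)"
      by (simp add: rho_add_left)
    then have "norm (rho (z + h) w - rho z w) \<le> norm (drho z w h) + norm (1/4 * (\<Sum>j\<in>?I. (h $ j)\<^sup>2))"
      by (metis norm_triangle_ineq)
    also have "\<dots> \<le> A * (norm h + (norm h)\<^sup>2) * norm (rho z w)"
      using dA q by (simp add: algebra_simps)
    finally show "norm (rho (z + h) w - rho z w) \<le> A * (norm h + (norm h)\<^sup>2) * norm (rho z w)" .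
  qed
qed

text \<open>\<open>drho_bound\<close> allows increments of any size, so h = u - z compares two
  arbitrary points with a constant independent of w.\<close>

lemma norm_rho_comparable:
  assumes "u \<in> T_B" "z \<in> T_B"
  obtains C :: real where "C > 0" and "\<And>w. w \<in> T_B \<Longrightarrow> norm (rho u w) \<le> C * norm (rho z w)"
proof -
  obtain A :: real where A: "A > 0"
    "\<And>w h. w \<in> T_B \<Longrightarrow> norm (rho (z + h) w - rho z w) \<le> A * (norm h + (norm h)\<^sup>2) * norm (rho z w)"
    using drho_bound[OF assms(2)] by metis
  show thesis
  proof (rule that)
    show "1 + A * (norm (u - z) + (norm (u - z))\<^sup>2) > 0"
      using A by (simp add: add_pos_nonneg)
    fix w assume "w \<in> (T_B :: 'a cvec set)"
    from A(2)[OF this, of "u - z"]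
    have "norm (rho u w - rho z w) \<le> A * (norm (u - z) + (norm (u - z))\<^sup>2) * norm (rho z w)" by simp
    then show "norm (rho u w) \<le> (1 + A * (norm (u - z) + (norm (u - z))\<^sup>2)) * norm (rho z w)"
      using norm_triangle_ineq2[of "rho u w" "rho z w"] by (simp add: distrib_right)
  qed
qed

section \<open>Powers of rho and their derivatives under the integral\<close>

lemma norm_powr_of_real: "norm ((z :: complex) powr of_real s) = norm z powr s"
  using norm_powr_real_powr'[of "of_real s" z] by simp

text \<open>The mean value inequality on the segment from a to a + b. It stays in the right half
  plane, where the principal branch is holomorphic, and |b| \<le> |a|/2 keeps its points at modulus
  at least |a|/2; hence the factor 2^(s+1).\<close>

lemma norm_powr_diff_le:
  fixes a b :: complex and s :: real
  assumes s: "s > 0" and a: "Re a > 0" and b: "Re (a + b) > 0" and small: "norm b \<le> norm a / 2"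
  shows "norm ((a + b) powr of_real (- s) - a powr of_real (- s)) \<le> s * 2 powr (s + 1) * norm a powr (- s - 1) * norm b"
proof -
  let ?S = "closed_segment a (a + b)"
  have "norm ((a + b) powr of_real (- s) - a powr of_real (- s)) \<le> (s * 2 powr (s + 1) * norm a powr (- s - 1)) * norm (a + b - a)"
  proof (rule field_differentiable_bound[where S = ?S and f' = "\<lambda>x. of_real (- s) * x powr (of_real (- s) - 1)"])
    fix x assume x: "x \<in> ?S"
    have "?S \<subseteq> {x. Re x > 0}"
      using a b by (intro closed_segment_subset) (auto simp: convex_halfspace_Re_gt)
    then have "Re x > 0" using x by auto
    then have "x \<notin> \<real>\<^sub>\<le>\<^sub>0" by (auto simp: complex_nonpos_Reals_iff)
    then show "((\<lambda>x. x powr of_real (- s)) has_field_derivative of_real (- s) * x powr (of_real (- s) - 1)) (at x within ?S)"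
      by (rule has_field_derivative_powr[THEN has_field_derivative_at_within])
    obtain u where u: "0 \<le> u" "u \<le> 1" "x = a + u *\<^sub>R b"
      using x by (auto simp: closed_segment_def algebra_simps)
    have "norm (u *\<^sub>R b) \<le> 1 * norm b" using u by (simp add: mult_left_le_one_le)
    then have "norm x \<ge> norm a / 2"
      using u(3) small norm_diff_ineq[of a "u *\<^sub>R b"] by simp
    then have "norm x powr (- s - 1) \<le> (norm a / 2) powr (- s - 1)"
      using s a by (intro powr_mono2') auto
    also have "\<dots> = 2 powr (s + 1) * norm a powr (- s - 1)"
      using powr_minus_divide[of 2 "s + 1"] by (simp add: powr_divide)
    finally have *: "norm x powr (- s - 1) \<le> 2 powr (s + 1) * norm a powr (- s - 1)" .
    have e: "of_real (- s) - 1 = complex_of_real (- s - 1)" by simp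
    show "norm (of_real (- s) * x powr (of_real (- s) - 1)) \<le> s * 2 powr (s + 1) * norm a powr (- s - 1)"
      unfolding e norm_mult norm_powr_of_real using s mult_left_mono[OF *, of s] by (simp add: mult.assoc)
  qed auto
  then show ?thesis by simp
qed

lemma has_derivative_rho_powr:
  assumes "z \<in> T_B" "w \<in> T_B"
  shows "((\<lambda>z. rho z w powr of_real (- s)) has_derivative
    (\<lambda>h. - of_real s * rho z w powr of_real (- s - 1) * drho z w h)) (at z)"
proof -
  have "((\<lambda>x. x powr of_real (- s)) has_field_derivative (of_real (- s) * rho z w powr (of_real (- s) - 1))) (at (rho z w))"
    by (rule has_field_derivative_powr[OF rho_notin_nonpos[OF assms]])
  from has_derivative_compose[OF has_derivative_rho this[unfolded has_field_derivative_def]]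
  show ?thesis by simp
qed

lemma rho_powr_measurable:
  assumes z: "z \<in> T_B"
  shows "(\<lambda>w. rho z w powr s) \<in> borel_measurable (restrict_space borel T_B)"
    and "(\<lambda>w. rho w z powr s) \<in> borel_measurable (restrict_space borel T_B)"
proof -
  have "continuous_on T_B (\<lambda>w. rho z w powr s)" "continuous_on T_B (\<lambda>w. rho w z powr s)"
    using z by (auto intro!: continuous_on_powr_complex continuous_intros
        dest: rho_notin_nonpos simp: complex_nonpos_Reals_iff Re_rho_pos less_imp_le)
  then show "(\<lambda>w. rho z w powr s) \<in> borel_measurable (restrict_space borel T_B)"
    "(\<lambda>w. rho w z powr s) \<in> borel_measurable (restrict_space borel T_B)"
    by (auto intro: borel_measurable_continuous_on_restrict)
qed

lemma norm_rho_powr_le: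
  assumes "z \<in> T_B" "w \<in> T_B" "s \<ge> 0"
  shows "norm (rho z w powr of_real (- s)) \<le> (rho1 z / 2) powr (- s)"
  unfolding norm_powr_of_real
  using assms norm_rho_ge[of z w] by (intro powr_mono2') (auto simp: T_B_iff)

text \<open>Only the sigma-algebra is fixed here. The decay of \<mu> is assumed lemma by lemma,
  because the exponent t changes from one use to the next.\<close>

locale measure_on_T_B =
  fixes \<mu> :: "'n::{finite,linorder} cvec measure"
  assumes sets_mu [measurable_cong]: "sets \<mu> = sets (restrict_space borel T_B)"
begin

lemma space_mu: "space \<mu> = T_B"
  using sets_eq_imp_space_eq[OF sets_mu] by (simp add: space_restrict_space)

lemma measurable_mu: "g \<in> borel_measurable (restrict_space borel T_B) \<Longrightarrow> g \<in> borel_measurable \<mu>"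
  using measurable_cong_sets[OF sets_mu refl] by blast

lemma integrable_rho_powr:
  assumes z: "z \<in> T_B" and \<phi>: "integrable \<mu> \<phi>" and s: "s \<ge> 0"
  shows "integrable \<mu> (\<lambda>w. rho z w powr of_real (- s) * \<phi> w)"
proof (rule Bochner_Integration.integrable_bound)
  show "integrable \<mu> (\<lambda>w. (rho1 z / 2) powr (- s) * norm (\<phi> w))"
    using \<phi> by simp
  show "(\<lambda>w. rho z w powr of_real (- s) * \<phi> w) \<in> borel_measurable \<mu>"
    using measurable_mu[OF rho_powr_measurable(1)[OF z]] borel_measurable_integrable[OF \<phi>] by measurable
  show "AE w in \<mu>. norm (rho z w powr of_real (- s) * \<phi> w) \<le> norm ((rho1 z / 2) powr (- s) * norm (\<phi> w))"
    using norm_rho_powr_le[OF z _ s] by (intro AE_I2) (auto simp: space_mu norm_mult intro!: mult_right_mono)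
qed

text \<open>Dominated convergence for the remainder quotient. The increments of \<rho> are bounded
  relative to |\<rho>(z,w)|, and this factor restores |\<rho>(z,w)|^(-s) from the exponent -s-1;
  that power is bounded in w, so a multiple of |\<phi>| is a majorant.\<close>

lemma has_derivative_integral_rho_powr:
  fixes \<phi> :: "'n cvec \<Rightarrow> complex"
  assumes \<phi>: "integrable \<mu> \<phi>" and s: "s > 0" and z: "z \<in> T_B"
  shows "((\<lambda>z. \<integral>w. rho z w powr of_real (- s) * \<phi> w \<partial>\<mu>) has_derivative
     (\<lambda>h. \<integral>w. - of_real s * rho z w powr of_real (- s - 1) * drho z w h * \<phi> w \<partial>\<mu>)) (at z)"
proof -
  have r: "rho1 z > 0" using z by (simp add: T_B_iff)
  obtain A :: real where A: "A > 0"
    "\<And>w h. w \<in> T_B \<Longrightarrow> norm (drho z w h) \<le> A * norm h * norm (rho z w)"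
    "\<And>w h. w \<in> T_B \<Longrightarrow> norm (rho (z + h) w - rho z w) \<le> A * (norm h + (norm h)\<^sup>2) * norm (rho z w)"
    using drho_bound[OF z] by metis
  define P where "P h w = rho (z + h) w powr of_real (- s)" for h w
  define D where "D h w = - of_real s * rho z w powr of_real (- s - 1) * drho z w h" for h w
  define F where "F z = (\<integral>w. rho z w powr of_real (- s) * \<phi> w \<partial>\<mu>)" for z
  define M where "M = (rho1 z / 2) powr (- s)"
  define CD where "CD = s * A * M"
  define CP where "CP = s * 2 powr (s + 1) * (2 * A) * M"
  have M: "M \<ge> 0" by (simp add: M_def)
  have normM: "norm (rho z w) powr (- s - 1) * norm (rho z w) \<le> M" if w: "w \<in> T_B" for w
  proof -
    have "norm (rho z w) powr (- s - 1) * norm (rho z w) = norm (rho z w) powr (- s)"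
      using norm_rho_pos[OF z w] by (simp add: powr_diff)
    also have "\<dots> \<le> M" using norm_rho_powr_le[OF z w, of s] s unfolding M_def norm_powr_of_real by simp
    finally show ?thesis .
  qed
  have D_le: "norm (D h w) \<le> CD * norm h" if w: "w \<in> T_B" for h w
  proof -
    have "norm (D h w) = s * norm (rho z w) powr (- s - 1) * norm (drho z w h)"
      unfolding D_def norm_mult norm_powr_of_real using s by simp
    also have "\<dots> \<le> s * norm (rho z w) powr (- s - 1) * (A * norm h * norm (rho z w))"
      using A(2)[OF w] s by (intro mult_left_mono) auto
    also have "\<dots> = s * A * norm h * (norm (rho z w) powr (- s - 1) * norm (rho z w))" by (simp add: mult_ac)
    also have "\<dots> \<le> s * A * norm h * M" using normM[OF w] s A by (intro mult_left_mono) auto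
    finally show ?thesis by (simp add: CD_def mult_ac)
  qed
  obtain \<delta>0 where \<delta>0: "\<delta>0 > 0" "ball z \<delta>0 \<subseteq> T_B" using open_T_B z open_contains_ball by blast
  \<comment> \<open>The three bounds keep z + h in \<open>T_B\<close>, make |h|^2 \<le> |h|, and
    make the increment of \<rho> at most |\<rho>(z,w)|/2, as \<open>norm_powr_diff_le\<close>
    asks.\<close>
  define \<delta> where "\<delta> = min (min \<delta>0 1) (1 / (4 * A))"
  have \<delta>: "\<delta> > 0" using \<delta>0 A by (simp add: \<delta>_def)
  have zh: "z + h \<in> T_B" if "norm h < \<delta>" for h
  proof -
    have "z + h \<in> ball z \<delta>0" using that by (simp add: \<delta>_def dist_norm)
    then show ?thesis using \<delta>0 by blast
  qed
  have P_le: "norm (P h w - P 0 w) \<le> CP * norm h" if w: "w \<in> T_B" and h: "norm h < \<delta>" for h w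
  proof -
    define b where "b = rho (z + h) w - rho z w"
    have h1: "norm h \<le> 1" "norm h \<le> 1 / (4 * A)" using h by (auto simp: \<delta>_def)
    have "(norm h)\<^sup>2 \<le> norm h" using h1 by (simp add: power2_eq_square mult_left_le)
    then have "A * (norm h + (norm h)\<^sup>2) * norm (rho z w) \<le> A * (2 * norm h) * norm (rho z w)"
      using A by (intro mult_right_mono mult_left_mono) auto
    then have b: "norm b \<le> 2 * A * norm h * norm (rho z w)"
      using A(3)[OF w, of h] unfolding b_def by (simp add: mult_ac)
    also have "2 * A * norm h \<le> 1/2" using h1(2) A by (simp add: field_simps)
    finally have small: "norm b \<le> norm (rho z w) / 2" by (simp add: mult_right_mono)
    have "norm (P h w - P 0 w) \<le> s * 2 powr (s + 1) * norm (rho z w) powr (- s - 1) * norm b"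
      using norm_powr_diff_le[OF s Re_rho_pos[OF z w] _ small] Re_rho_pos[OF zh[OF h] w]
      by (simp add: P_def b_def)
    also have "\<dots> \<le> s * 2 powr (s + 1) * norm (rho z w) powr (- s - 1) * (2 * A * norm h * norm (rho z w))"
      using b s by (intro mult_left_mono) auto
    also have "\<dots> = s * 2 powr (s + 1) * (2 * A) * norm h * (norm (rho z w) powr (- s - 1) * norm (rho z w))"
      by (simp add: mult_ac)
    also have "\<dots> \<le> s * 2 powr (s + 1) * (2 * A) * norm h * M"
      using normM[OF w] s A by (intro mult_left_mono) auto
    finally show ?thesis by (simp add: CP_def mult_ac)
  qed
  have P_int: "integrable \<mu> (\<lambda>w. P h w * \<phi> w)" if "norm h < \<delta>" for h
    unfolding P_def using s by (intro integrable_rho_powr zh that \<phi>) auto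
  have drho_meas: "(\<lambda>w. drho z w h) \<in> borel_measurable \<mu>" for h
    unfolding drho_def
    by (intro measurable_mu borel_measurable_continuous_on_restrict continuous_intros)
  have D_meas: "(\<lambda>w. D h w * \<phi> w) \<in> borel_measurable \<mu>" for h
    unfolding D_def
    by (intro borel_measurable_times borel_measurable_const drho_meas
        measurable_mu[OF rho_powr_measurable(1)[OF z]] borel_measurable_integrable[OF \<phi>])
  have D_int: "integrable \<mu> (\<lambda>w. D h w * \<phi> w)" for h
  proof (rule Bochner_Integration.integrable_bound)
    show "integrable \<mu> (\<lambda>w. CD * norm h * norm (\<phi> w))" using \<phi> by simp
    show "AE w in \<mu>. norm (D h w * \<phi> w) \<le> norm (CD * norm h * norm (\<phi> w))"
    proof (rule AE_I2)
      fix w assume "w \<in> space \<mu>"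
      then have "norm (D h w) * norm (\<phi> w) \<le> CD * norm h * norm (\<phi> w)"
        by (intro mult_right_mono D_le) (auto simp: space_mu)
      also have "\<dots> \<le> norm (CD * norm h * norm (\<phi> w))" by simp
      finally show "norm (D h w * \<phi> w) \<le> norm (CD * norm h * norm (\<phi> w))" by (simp only: norm_mult)
    qed
  qed (rule D_meas)
  have "bounded_linear (\<lambda>h. \<integral>w. D h w * \<phi> w \<partial>\<mu>)"
  proof (rule bounded_linear_intro[where K = "CD * (\<integral>w. norm (\<phi> w) \<partial>\<mu>)"])
    show "(\<integral>w. D (x + y) w * \<phi> w \<partial>\<mu>) = (\<integral>w. D x w * \<phi> w \<partial>\<mu>) + (\<integral>w. D y w * \<phi> w \<partial>\<mu>)" for x y
      unfolding Bochner_Integration.integral_add[OF D_int D_int, symmetric]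
      by (simp add: D_def drho_add algebra_simps)
    show "(\<integral>w. D (r *\<^sub>R x) w * \<phi> w \<partial>\<mu>) = r *\<^sub>R (\<integral>w. D x w * \<phi> w \<partial>\<mu>)" for r x
      unfolding Bochner_Integration.integral_scaleR_right[symmetric]
      by (simp add: D_def drho_scaleR)
    fix h
    have "norm (\<integral>w. D h w * \<phi> w \<partial>\<mu>) \<le> (\<integral>w. norm (D h w * \<phi> w) \<partial>\<mu>)" by (rule integral_norm_bound)
    also have "\<dots> \<le> (\<integral>w. CD * norm h * norm (\<phi> w) \<partial>\<mu>)"
      using \<phi> by (intro integral_mono integrable_norm D_int) (auto simp: space_mu norm_mult intro!: mult_right_mono D_le)
    finally show "norm (\<integral>w. D h w * \<phi> w \<partial>\<mu>) \<le> norm h * (CD * (\<integral>w. norm (\<phi> w) \<partial>\<mu>))"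
      by (simp add: mult_ac)
  qed
  moreover have "((\<lambda>h. norm (F (z + h) - F z - (\<integral>w. D h w * \<phi> w \<partial>\<mu>)) / norm h) \<longlongrightarrow> 0) (at 0)"
    unfolding tendsto_at_iff_sequentially comp_def
  proof (intro allI impI)
    fix X :: "nat \<Rightarrow> 'n cvec" assume X0: "\<forall>i. X i \<in> UNIV - {0}" and X: "X \<longlonglongrightarrow> 0"
    \<comment> \<open>The majorant holds only for |h| < \<delta>; the finitely many earlier terms
      are dropped by a shift, which is undone at the end.\<close>
    obtain n0 where n0: "\<And>i. i \<ge> n0 \<Longrightarrow> norm (X i) < \<delta>"
      using LIMSEQ_D[OF X \<delta>] by auto
    define Y where "Y i = X (i + n0)" for i
    have Y: "norm (Y i) < \<delta>" "norm (Y i) > 0" for i using n0 X0 by (auto simp: Y_def)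
    define R where "R i w = (1 / norm (Y i)) *\<^sub>R (P (Y i) w * \<phi> w - P 0 w * \<phi> w - D (Y i) w * \<phi> w)" for i w
    have YX: "Y \<longlonglongrightarrow> 0" unfolding Y_def using X by (rule LIMSEQ_ignore_initial_segment)
    have "Y i \<noteq> 0" for i using Y(2)[of i] by simp
    then have Y_at: "filterlim Y (at 0) sequentially"
      using YX by (simp add: filterlim_at)
    have "(\<lambda>i. \<integral>w. R i w \<partial>\<mu>) \<longlonglongrightarrow> (\<integral>w. 0 \<partial>\<mu>)"
    proof (rule integral_dominated_convergence[where w = "\<lambda>w. (CP + CD) * norm (\<phi> w)"])
      show "integrable \<mu> (\<lambda>w. (CP + CD) * norm (\<phi> w))" using \<phi> by simp
      show "R i \<in> borel_measurable \<mu>" for i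
        unfolding R_def using P_int[OF Y(1)[of i]] P_int[of 0] \<delta> D_int[of "Y i"]
        by (intro borel_measurable_scaleR borel_measurable_diff borel_measurable_const borel_measurable_integrable) auto
      show "AE w in \<mu>. (\<lambda>i. R i w) \<longlonglongrightarrow> 0"
      proof (rule AE_I2)
        fix w assume "w \<in> space \<mu>"
        then have w: "w \<in> T_B" by (simp add: space_mu)
        have "((\<lambda>h. norm (P h w - P 0 w - D h w) / norm h) \<longlongrightarrow> 0) (at 0)"
          using has_derivative_rho_powr[OF z w, of s] unfolding has_derivative_at P_def D_def by simp
        then have "(\<lambda>i. norm (P (Y i) w - P 0 w - D (Y i) w) / norm (Y i)) \<longlonglongrightarrow> 0"
          by (rule filterlim_compose[OF _ Y_at])
        from tendsto_mult_left_zero[OF this, of "norm (\<phi> w)"]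
        have "(\<lambda>i. norm (R i w)) \<longlonglongrightarrow> 0"
          unfolding R_def left_diff_distrib[symmetric] by (simp add: norm_mult)
        then show "(\<lambda>i. R i w) \<longlonglongrightarrow> 0" by (rule tendsto_norm_zero_cancel)
      qed
      show "AE w in \<mu>. norm (R i w) \<le> (CP + CD) * norm (\<phi> w)" for i
      proof (rule AE_I2)
        fix w assume "w \<in> space \<mu>"
        then have w: "w \<in> T_B" by (simp add: space_mu)
        have "norm (P (Y i) w - P 0 w - D (Y i) w) \<le> norm (P (Y i) w - P 0 w) + norm (D (Y i) w)"
          by (rule norm_triangle_ineq4)
        also have "\<dots> \<le> CP * norm (Y i) + CD * norm (Y i)"
          by (intro add_mono P_le D_le w Y)
        finally have "norm (P (Y i) w - P 0 w - D (Y i) w) / norm (Y i) \<le> CP + CD"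
          using Y(2)[of i] by (simp add: field_simps)
        then have "norm (P (Y i) w - P 0 w - D (Y i) w) / norm (Y i) * norm (\<phi> w) \<le> (CP + CD) * norm (\<phi> w)"
          by (rule mult_right_mono) simp
        then show "norm (R i w) \<le> (CP + CD) * norm (\<phi> w)"
          unfolding R_def left_diff_distrib[symmetric] by (simp add: norm_mult)
      qed
    qed auto
    then have "(\<lambda>i. norm (\<integral>w. R i w \<partial>\<mu>)) \<longlonglongrightarrow> 0" using tendsto_norm_zero by simp
    moreover have "norm (\<integral>w. R i w \<partial>\<mu>) = norm (F (z + Y i) - F z - (\<integral>w. D (Y i) w * \<phi> w \<partial>\<mu>)) / norm (Y i)" for i
    proof -
      have P0: "integrable \<mu> (\<lambda>w. P 0 w * \<phi> w)" using P_int[of 0] \<delta> by simp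
      have FP: "F (z + h) = (\<integral>w. P h w * \<phi> w \<partial>\<mu>)" "F z = (\<integral>w. P 0 w * \<phi> w \<partial>\<mu>)" for h
        by (simp_all add: F_def P_def)
      show ?thesis
        unfolding R_def Bochner_Integration.integral_scaleR_right FP
        using P_int[OF Y(1)[of i]] P0 D_int[of "Y i"] by simp
    qed
    ultimately have "(\<lambda>i. norm (F (z + Y i) - F z - (\<integral>w. D (Y i) w * \<phi> w \<partial>\<mu>)) / norm (Y i)) \<longlonglongrightarrow> 0" by simp
    then show "(\<lambda>i. norm (F (z + X i) - F z - (\<integral>w. D (X i) w * \<phi> w \<partial>\<mu>)) / norm (X i)) \<longlonglongrightarrow> 0"
      unfolding Y_def by (rule LIMSEQ_offset)
  qed
  ultimately have "(F has_derivative (\<lambda>h. \<integral>w. D h w * \<phi> w \<partial>\<mu>)) (at z)"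
    unfolding has_derivative_at by blast
  then show ?thesis unfolding F_def[abs_def] D_def .
qed

end

section \<open>Carleson measures\<close>

lemma holomorphic_several_measurable:
  assumes f: "holomorphic_several_on f T_B"
  shows "f \<in> borel_measurable (restrict_space borel T_B)"
    and "(\<lambda>w. ennreal (norm (f w) powr q)) \<in> borel_measurable (restrict_space borel T_B)"
    and "(\<lambda>w. indicator T_B w * ennreal (norm (f w) powr q)) \<in> borel_measurable borel"
proof -
  show 1: "f \<in> borel_measurable (restrict_space borel T_B)"
    using holomorphic_several_continuous_on[OF f] by (rule borel_measurable_continuous_on_restrict)
  show 2: "(\<lambda>w. ennreal (norm (f w) powr q)) \<in> borel_measurable (restrict_space borel T_B)"
    using 1 by measurable
  show "(\<lambda>w. indicator T_B w * ennreal (norm (f w) powr q)) \<in> borel_measurable borel"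
    using 2 by (subst (asm) borel_measurable_restrict_space_iff_ennreal) (auto simp: mult.commute)
qed

lemma holomorphic_several_mult:
  assumes f: "holomorphic_several_on f S" and g: "holomorphic_several_on g S"
  shows "holomorphic_several_on (\<lambda>z. f z * g z) S"
  unfolding holomorphic_several_on_def
proof
  fix z assume "z \<in> S"
  then obtain f' g' where *: "(f has_derivative f') (at z)" "\<And>c v. f' (c *s v) = c * f' v"
    "(g has_derivative g') (at z)" "\<And>c v. g' (c *s v) = c * g' v"
    using f g unfolding holomorphic_several_on_def by metis
  have "((\<lambda>z. f z * g z) has_derivative (\<lambda>h. f z * g' h + f' h * g z)) (at z)"
    by (rule has_derivative_mult[OF *(1) *(3)])
  then show "\<exists>f'. ((\<lambda>z. f z * g z) has_derivative f') (at z) \<and> (\<forall>c v. f' (c *s v) = c * f' v)"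
    using *(2,4) by (intro exI[of _ "\<lambda>h. f z * g' h + f' h * g z"]) (auto simp: algebra_simps)
qed

lemma holomorphic_several_rho_powr:
  assumes "z \<in> T_B"
  shows "holomorphic_several_on (\<lambda>w. rho w z powr of_real (- s)) T_B"
  unfolding holomorphic_several_on_def
proof
  fix w assume "w \<in> (T_B :: 'a cvec set)"
  from has_derivative_rho_powr[OF this assms, of s]
  show "\<exists>f'. ((\<lambda>w. rho w z powr of_real (- s)) has_derivative f') (at w) \<and> (\<forall>c v. f' (c *s v) = c * f' v)"
    by (intro exI conjI) (auto simp: drho_scaleC)
qed

lemma A_norm_powr: "p > 0 \<Longrightarrow> A_norm p \<alpha> f powr p = enn2real (\<integral>\<^sup>+z. ennreal (norm (f z) powr p) \<partial>V_meas \<alpha>)"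
  by (simp add: A_norm_def powr_powr)

text \<open>The kernel estimate with exponent b = s p. These powers are the test functions for the
  Carleson inequality and for the Toeplitz operator.\<close>

lemma rho_powr_A_space:
  fixes \<alpha> p s :: real
  assumes \<alpha>: "\<alpha> > -1" and p: "p > 0" and s: "s * p > real CARD('n) + \<alpha> + 1"
  obtains J :: real where "J > 0" and "\<And>z :: 'n::{finite,linorder} cvec. z \<in> T_B \<Longrightarrow>
     (\<lambda>w. rho w z powr of_real (- s)) \<in> A_space p \<alpha> \<and>
     A_norm p \<alpha> (\<lambda>w. rho w z powr of_real (- s)) powr p \<le> J * rho1 z powr (real CARD('n) + \<alpha> + 1 - s * p)"
proof (rule nn_integral_rho_kernel[where 'n = 'n, OF \<alpha>, of "s * p"])
  fix J :: real assume J: "J > 0" "\<And>z :: 'n cvec. z \<in> T_B \<Longrightarrow>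
    V_int \<alpha> (\<lambda>w. ennreal (norm (rho z w) powr (- (s * p))))
      \<le> ennreal (J * rho1 z powr (real CARD('n) + \<alpha> + 1 - s * p))"
  show thesis
  proof (rule that[OF J(1)])
    fix z :: "'n cvec" assume z: "z \<in> T_B"
    let ?f = "\<lambda>w. rho w z powr of_real (- s)"
    have hol: "holomorphic_several_on ?f T_B" by (rule holomorphic_several_rho_powr[OF z])
    have "(\<integral>\<^sup>+w. ennreal (norm (?f w) powr p) \<partial>V_meas \<alpha>) =
      V_int \<alpha> (\<lambda>w. ennreal (norm (?f w) powr p))"
      by (rule nn_integral_V_meas) (rule holomorphic_several_measurable(2)[OF hol])
    also have "\<dots> \<le> ennreal (J * rho1 z powr (real CARD('n) + \<alpha> + 1 - s * p))"
      using J(2)[OF z] unfolding norm_powr_of_real powr_powr by (simp add: norm_rho_commute)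
    finally have le: "(\<integral>\<^sup>+w. ennreal (norm (?f w) powr p) \<partial>V_meas \<alpha>) \<le> ennreal (J * rho1 z powr (real CARD('n) + \<alpha> + 1 - s * p))" .
    then have "?f \<in> A_space p \<alpha>"
      using hol by (auto simp: A_space_def intro: le_less_trans)
    moreover have "A_norm p \<alpha> ?f powr p \<le> J * rho1 z powr (real CARD('n) + \<alpha> + 1 - s * p)"
      unfolding A_norm_powr[OF p] using le J(1) by (intro enn2real_leI) auto
    ultimately show "?f \<in> A_space p \<alpha> \<and> A_norm p \<alpha> ?f powr p \<le> J * rho1 z powr (real CARD('n) + \<alpha> + 1 - s * p)"
      by blast
  qed
qed (use s in simp)

lemma K_kernel_eq:
  fixes \<alpha> :: real
  assumes \<alpha>: "\<alpha> > -1"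
  obtains \<kappa> :: real where "\<kappa> > 0" and
    "\<And>z w :: 'n::{finite,linorder} cvec. K_kernel \<alpha> z w = of_real \<kappa> * rho z w powr of_real (- (real CARD('n) + \<alpha> + 1))"
proof (rule that)
  let ?\<kappa> = "Gamma (real CARD('n) + \<alpha> + 1) / (2 ^ (CARD('n) + 1) * pi ^ CARD('n) * Gamma (\<alpha> + 1))"
  show "?\<kappa> > 0"
    using \<alpha> by (intro divide_pos_pos mult_pos_pos Gamma_real_pos) auto
  show "K_kernel \<alpha> z w = of_real ?\<kappa> * rho z w powr of_real (- (real CARD('n) + \<alpha> + 1))" for z w :: "'n cvec"
    unfolding K_kernel_def of_real_minus powr_minus_divide by simp
qed

text \<open>K(z,z) is \<kappa> \<rho>(z)^(-N), so up to a constant the Berezin transform is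
  \<rho>(z)^N times the integral of |\<rho>(z,w)|^(-2N). The branch of the square root is invisible
  in the modulus.\<close>

lemma norm_k_normalized:
  fixes \<alpha> :: real
  assumes \<alpha>: "\<alpha> > -1"
  obtains \<kappa> :: real where "\<kappa> > 0" and
    "\<And>z w :: 'n::{finite,linorder} cvec. z \<in> T_B \<Longrightarrow> (norm (k_normalized \<alpha> z w))\<^sup>2 =
      \<kappa> * rho1 z powr (real CARD('n) + \<alpha> + 1) * norm (rho z w) powr (- 2 * (real CARD('n) + \<alpha> + 1))"
proof (rule K_kernel_eq[where 'n = 'n, OF \<alpha>])
  let ?N = "real CARD('n) + \<alpha> + 1"
  fix \<kappa> :: real assume \<kappa>: "\<kappa> > 0"
    "\<And>z w :: 'n cvec. K_kernel \<alpha> z w = of_real \<kappa> * rho z w powr of_real (- (real CARD('n) + \<alpha> + 1))"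
  show thesis
  proof (rule that[OF \<kappa>(1)])
    fix z w :: "'n cvec" assume z: "z \<in> T_B"
    have K: "norm (K_kernel \<alpha> z u) = \<kappa> * norm (rho z u) powr (- ?N)" for u
      unfolding \<kappa>(2) norm_mult norm_powr_of_real using \<kappa>(1) by simp
    have "(norm (k_normalized \<alpha> z w))\<^sup>2 = (norm (K_kernel \<alpha> z w))\<^sup>2 / norm (K_kernel \<alpha> z z)"
    proof -
      have "(norm (csqrt (K_kernel \<alpha> z z)))\<^sup>2 = norm (K_kernel \<alpha> z z)"
        by (metis norm_power power2_csqrt)
      then show ?thesis by (simp add: k_normalized_def norm_divide power_divide)
    qed
    also have "\<dots> = \<kappa> * rho1 z powr ?N * (norm (rho z w) powr (- ?N))\<^sup>2"
    proof -
      have "norm (K_kernel \<alpha> z z) = \<kappa> * (1 / rho1 z powr ?N)"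
        unfolding K rho_diag powr_minus_divide using z by (simp add: T_B_iff)
      then show ?thesis using \<kappa>(1) unfolding K by (simp add: power2_eq_square)
    qed
    also have "(norm (rho z w) powr (- ?N))\<^sup>2 = norm (rho z w) powr (- 2 * ?N)"
    proof -
      have "- ?N + - ?N = - 2 * ?N" by simp
      then show ?thesis by (simp only: power2_eq_square powr_add[symmetric])
    qed
    finally show "(norm (k_normalized \<alpha> z w))\<^sup>2 = \<kappa> * rho1 z powr ?N * norm (rho z w) powr (- 2 * ?N)" .
  qed
qed

context measure_on_T_B
begin

lemma sets_mu_iff: "A \<in> sets \<mu> \<longleftrightarrow> A \<in> sets borel \<and> A \<subseteq> T_B"
  unfolding sets_mu by (subst sets_restrict_space_iff) auto

lemma measurable_ident_mu: "(\<lambda>x. x) \<in> borel_measurable \<mu>"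
  by (intro measurable_mu measurable_restrict_space1) simp

text \<open>The sets where |\<rho>(z,i)|^(-t) \<ge> 1/n exhaust \<open>T_B\<close> and have finite
  measure by Markov's inequality. This makes Fubini available for \<mu>.\<close>

lemma sigma_finite_mu:
  assumes fin: "(\<integral>\<^sup>+z. ennreal (norm (rho z base_pt) powr (- t)) \<partial>\<mu>) < \<infinity>"
  shows "sigma_finite_measure \<mu>"
proof
  note [measurable] = measurable_ident_mu
  define u where "u z = ennreal (norm (rho z base_pt) powr (- t))" for z :: "'n cvec"
  have [measurable]: "u \<in> borel_measurable \<mu>" unfolding u_def by measurable
  define A where "A n = {z \<in> space \<mu>. 1 \<le> of_nat n * u z}" for n :: nat
  have A[measurable]: "A n \<in> sets \<mu>" for n unfolding A_def by measurable
  have Af: "emeasure \<mu> (A n) < \<infinity>" for n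
  proof -
    have "emeasure \<mu> (A n) \<le> of_nat n * (\<integral>\<^sup>+x. u x * indicator (space \<mu>) x \<partial>\<mu>)"
      unfolding A_def by (rule nn_integral_Markov_inequality) measurable
    also have "(\<integral>\<^sup>+x. u x * indicator (space \<mu>) x \<partial>\<mu>) = (\<integral>\<^sup>+x. u x \<partial>\<mu>)"
      by (intro nn_integral_cong) simp
    also have "of_nat n * (\<integral>\<^sup>+x. u x \<partial>\<mu>) < \<infinity>"
      using fin by (simp add: u_def ennreal_mult_less_top of_nat_less_top)
    finally show ?thesis .
  qed
  have cover: "(\<Union>n. A n) = space \<mu>"
  proof -
    have "\<exists>n. z \<in> A n" if z: "z \<in> space \<mu>" for z
    proof -
      define x where "x = norm (rho z base_pt) powr (- t)"
      have x: "x > 0" using norm_rho_pos[of z base_pt] z by (simp add: x_def space_mu)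
      obtain n where "real n * x > 1" using reals_Archimedean3[OF x] by blast
      then have "ennreal 1 \<le> ennreal (real n * x)" by (intro ennreal_leI) simp
      also have "\<dots> = of_nat n * u z"
        using x by (simp add: u_def x_def ennreal_mult ennreal_of_nat_eq_real_of_nat)
      finally show ?thesis using z by (auto simp: A_def)
    qed
    then show ?thesis by (auto simp: A_def)
  qed
  show "\<exists>S. countable S \<and> S \<subseteq> sets \<mu> \<and> \<Union> S = space \<mu> \<and> (\<forall>a\<in>S. emeasure \<mu> a \<noteq> \<infinity>)"
    using A Af cover by (intro exI[of _ "range A"]) (auto simp: less_top[symmetric])
qed

text \<open>Stated for every holomorphic f, with a right-hand side that may be infinite, so that it
  also applies to a function times a kernel. After the exchange of integrals, symmetry turns w in
  the ball about z into z in the ball about w.\<close>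

lemma carleson_of_hball:
  fixes \<alpha> q c C :: real
  assumes sf: "sigma_finite_measure \<mu>" and q: "q > 0" and c: "c > 1" and C: "C \<ge> 0" and \<alpha>: "\<alpha> > -1"
    and avg: "\<And>z. z \<in> T_B \<Longrightarrow> emeasure \<mu> (hball c z) \<le> ennreal (C * rho1 z powr (real CARD('n) + \<alpha> + 1))"
  obtains C' :: real where "C' > 0" and "\<And>f. holomorphic_several_on f T_B \<Longrightarrow>
    (\<integral>\<^sup>+z. ennreal (norm (f z) powr q) \<partial>\<mu>) \<le>
      ennreal C' * V_int \<alpha> (\<lambda>w. ennreal (norm (f w) powr q))"
proof (rule norm_powr_submean[where 'n = 'n and \<alpha> = \<alpha>, OF q c])
  let ?N = "real CARD('n) + \<alpha> + 1"
  fix C0 :: real assume C0: "C0 > 0"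
    "\<And>(z :: 'n cvec) f. z \<in> T_B \<Longrightarrow> holomorphic_several_on f T_B \<Longrightarrow>
      ennreal (norm (f z) powr q) \<le> ennreal (C0 * rho1 z powr (- ?N)) *
        V_int \<alpha> (\<lambda>w. ennreal (norm (f w) powr q) * indicator (hball c z) w)"
  define C' where "C' = C0 * (4 * c) powr ?N * C + 1"
  interpret mu: sigma_finite_measure \<mu> by (rule sf)
  interpret pair_sigma_finite \<mu> "lborel :: 'n cvec measure" ..
  have [measurable]: "fst \<in> borel_measurable (\<mu> \<Otimes>\<^sub>M (lborel :: 'n cvec measure))"
    by (rule measurable_compose[OF measurable_fst measurable_ident_mu])
  have [measurable]: "snd \<in> borel_measurable (\<mu> \<Otimes>\<^sub>M (lborel :: 'n cvec measure))"
    using measurable_snd[of \<mu> "lborel :: 'n cvec measure"] by simp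
  show thesis
  proof (rule that)
    show "C' > 0" using C0 C c by (simp add: C'_def add_nonneg_pos)
    fix f :: "'n cvec \<Rightarrow> complex" assume f: "holomorphic_several_on f T_B"
    define F where "F w = ennreal (rho1 w powr \<alpha>) * (indicator T_B w * ennreal (norm (f w) powr q))" for w
    have [measurable]: "F \<in> borel_measurable borel"
      unfolding F_def using holomorphic_several_measurable(3)[OF f, of q] by measurable
    have [measurable]: "F \<in> borel_measurable lborel" by simp
    \<comment> \<open>The ball is spelled out as an inequality to get joint measurability in z and
      w.\<close>
    define G where "G z w = ennreal (C0 * rho1 z powr (- ?N)) *
        (F w * (if (norm (rho z w))\<^sup>2 < c * (rho1 z * rho1 w) then 1 else 0))" for z w
    have Gm: "case_prod G \<in> borel_measurable (\<mu> \<Otimes>\<^sub>M lborel)"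
      unfolding G_def by (simp add: case_prod_beta') measurable
    have "(\<integral>\<^sup>+z. ennreal (norm (f z) powr q) \<partial>\<mu>) \<le> (\<integral>\<^sup>+z. \<integral>\<^sup>+w. G z w \<partial>lborel \<partial>\<mu>)"
    proof (rule nn_integral_mono)
      fix z assume "z \<in> space \<mu>"
      then have z: "z \<in> T_B" by (simp add: space_mu)
      have [measurable]: "(\<lambda>w. F w * (if (norm (rho z w))\<^sup>2 < c * (rho1 z * rho1 w) then 1 else 0)) \<in> borel_measurable lborel"
        by measurable
      have "ennreal (norm (f z) powr q) \<le> ennreal (C0 * rho1 z powr (- ?N)) *
        V_int \<alpha> (\<lambda>w. ennreal (norm (f w) powr q) * indicator (hball c z) w)"
        by (rule C0(2)[OF z f])
      also have "V_int \<alpha> (\<lambda>w. ennreal (norm (f w) powr q) * indicator (hball c z) w)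
         = (\<integral>\<^sup>+w. F w * (if (norm (rho z w))\<^sup>2 < c * (rho1 z * rho1 w) then 1 else 0) \<partial>lborel)"
        by (intro nn_integral_cong) (auto simp: F_def hball_def indicator_def)
      also have "ennreal (C0 * rho1 z powr (- ?N)) * \<dots> = (\<integral>\<^sup>+w. G z w \<partial>lborel)"
        unfolding G_def by (rule nn_integral_cmult[symmetric]) measurable
      finally show "ennreal (norm (f z) powr q) \<le> (\<integral>\<^sup>+w. G z w \<partial>lborel)" .
    qed
    also have "\<dots> = (\<integral>\<^sup>+w. \<integral>\<^sup>+z. G z w \<partial>\<mu> \<partial>lborel)"
      by (rule Fubini'[OF Gm, symmetric])
    also have "\<dots> \<le> (\<integral>\<^sup>+w. ennreal C' * F w \<partial>lborel)"
    proof (rule nn_integral_mono)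
      fix w :: "'n cvec"
      show "(\<integral>\<^sup>+z. G z w \<partial>\<mu>) \<le> ennreal C' * F w"
      proof (cases "w \<in> T_B")
        case False
        then show ?thesis by (simp add: G_def F_def)
      next
        case w: True
        then have rw: "rho1 w > 0" by (simp add: T_B_iff)
        have hb: "hball c w \<in> sets \<mu>" by (auto simp: sets_mu_iff hball_def[of c w])
        have "(\<integral>\<^sup>+z. G z w \<partial>\<mu>) \<le> (\<integral>\<^sup>+z. (ennreal (C0 * (4 * c) powr ?N * rho1 w powr (- ?N)) * F w) * indicator (hball c w) z \<partial>\<mu>)"
        proof (rule nn_integral_mono)
          fix z assume "z \<in> space \<mu>"
          then have z: "z \<in> T_B" by (simp add: space_mu)
          show "G z w \<le> (ennreal (C0 * (4 * c) powr ?N * rho1 w powr (- ?N)) * F w) * indicator (hball c w) z"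
          proof (cases "(norm (rho z w))\<^sup>2 < c * (rho1 z * rho1 w)")
            case True
            then have wz: "w \<in> hball c z" using w by (simp add: hball_def)
            then have zw: "z \<in> hball c w" using hball_sym[OF z w] by blast
            \<comment> \<open>Within a ball \<rho>(z) is at least \<rho>(w)/(4c), which trades the
              weight at z for the weight at w at the cost of (4c)^N.\<close>
            have "rho1 w \<le> 2 * norm (rho z w)" by (rule rho1_le_right[OF z])
            also have "\<dots> \<le> 4 * c * rho1 z" using hball_norm_le[OF z wz] c by simp
            finally have "rho1 w / (4 * c) \<le> rho1 z" using c by (simp add: field_simps)
            then have "rho1 z powr (- ?N) \<le> (rho1 w / (4 * c)) powr (- ?N)"
              using rw c \<alpha> by (intro powr_mono2') auto
            also have "\<dots> = (4 * c) powr ?N * rho1 w powr (- ?N)"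
            proof -
              have "(x / y) powr (- s) = y powr s * x powr (- s)" if "x > 0" "y > 0" for x y s :: real
                using that by (simp add: powr_divide powr_minus_divide)
              from this[of "rho1 w" "4 * c" ?N] show ?thesis using rw c by linarith
            qed
            finally have "C0 * rho1 z powr (- ?N) \<le> C0 * (4 * c) powr ?N * rho1 w powr (- ?N)"
              using C0 by (simp add: mult.assoc)
            then show ?thesis using True zw by (simp add: G_def mult_right_mono ennreal_leI)
          qed (simp add: G_def)
        qed
        also have "\<dots> = (ennreal (C0 * (4 * c) powr ?N * rho1 w powr (- ?N)) * F w) * emeasure \<mu> (hball c w)"
          using hb by (rule nn_integral_cmult_indicator)
        also have "\<dots> \<le> (ennreal (C0 * (4 * c) powr ?N * rho1 w powr (- ?N)) * F w) * ennreal (C * rho1 w powr ?N)"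
          using avg[OF w] by (intro mult_left_mono) auto
        also have "\<dots> = ennreal (C0 * (4 * c) powr ?N * rho1 w powr (- ?N)) * ennreal (C * rho1 w powr ?N) * F w"
          by (simp add: mult_ac)
        also have "ennreal (C0 * (4 * c) powr ?N * rho1 w powr (- ?N)) * ennreal (C * rho1 w powr ?N)
            = ennreal (C0 * (4 * c) powr ?N * C * (rho1 w powr (- ?N) * rho1 w powr ?N))"
          using C0 C by (subst ennreal_mult[symmetric]) (auto simp: mult_ac)
        also have "rho1 w powr (- ?N) * rho1 w powr ?N = 1" using rw by (simp flip: powr_add)
        also have "ennreal (C0 * (4 * c) powr ?N * C * 1) * F w \<le> ennreal C' * F w"
          by (intro mult_right_mono ennreal_leI) (auto simp: C'_def)
        finally show ?thesis .
      qed
    qed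
    also have "\<dots> = ennreal C' * (\<integral>\<^sup>+w. F w \<partial>lborel)" by (rule nn_integral_cmult) measurable
    also have "(\<integral>\<^sup>+w. F w \<partial>lborel) = V_int \<alpha> (\<lambda>w. ennreal (norm (f w) powr q))"
      by (intro nn_integral_cong) (simp add: F_def mult_ac)
    finally show "(\<integral>\<^sup>+z. ennreal (norm (f z) powr q) \<partial>\<mu>) \<le>
      ennreal C' * V_int \<alpha> (\<lambda>w. ennreal (norm (f w) powr q))" .
  qed
qed

text \<open>On the ball |\<rho>(z,w)|^(-M) is at least (2c \<rho>(z))^(-M). It is used with M = 2N
  for the Berezin transform and with M = 2(N+k) for the Toeplitz operator.\<close>

lemma emeasure_hball_le_of_kernel:
  fixes \<alpha> c M C :: real
  assumes c: "c > 1" and z: "z \<in> T_B" and M: "M > 0" and C: "C \<ge> 0"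
    and le: "(\<integral>\<^sup>+w. ennreal (norm (rho z w) powr (- M)) \<partial>\<mu>) \<le> ennreal (C * rho1 z powr (- M + s))"
  shows "emeasure \<mu> (hball c z) \<le> ennreal ((2 * c) powr M * C * rho1 z powr s)"
proof -
  note [measurable] = measurable_ident_mu
  have r: "rho1 z > 0" using z by (simp add: T_B_iff)
  have hb: "hball c z \<in> sets \<mu>" using hball_measurable[of c z] by (auto simp: sets_mu_iff hball_def)
  let ?K = "ennreal ((2 * c * rho1 z) powr M)"
  have "emeasure \<mu> (hball c z) = (\<integral>\<^sup>+w. indicator (hball c z) w \<partial>\<mu>)" using hb by simp
  also have "\<dots> \<le> (\<integral>\<^sup>+w. ?K * ennreal (norm (rho z w) powr (- M)) \<partial>\<mu>)"
  proof (rule nn_integral_mono)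
    fix w
    show "indicator (hball c z) w \<le> ?K * ennreal (norm (rho z w) powr (- M))"
    proof (cases "w \<in> hball c z")
      case True
      then have w: "w \<in> T_B" by (simp add: hball_def)
      have "1 = (2 * c * rho1 z) powr M * (2 * c * rho1 z) powr (- M)"
        using c r by (simp flip: powr_add)
      also have "\<dots> \<le> (2 * c * rho1 z) powr M * norm (rho z w) powr (- M)"
        using hball_norm_le[OF z True] c norm_rho_pos[OF z w] M by (intro mult_left_mono powr_mono2') auto
      finally have "ennreal 1 \<le> ennreal ((2 * c * rho1 z) powr M * norm (rho z w) powr (- M))"
        by (rule ennreal_leI)
      then show ?thesis using True by (simp add: ennreal_mult)
    qed simp
  qed
  also have "\<dots> = ?K * (\<integral>\<^sup>+w. ennreal (norm (rho z w) powr (- M)) \<partial>\<mu>)"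
    by (rule nn_integral_cmult) measurable
  also have "\<dots> \<le> ?K * ennreal (C * rho1 z powr (- M + s))"
    using le by (rule mult_left_mono) simp
  also have "\<dots> = ennreal ((2 * c) powr M * C * rho1 z powr s)"
  proof -
    have "(2 * c * rho1 z) powr M * (C * rho1 z powr (- M + s)) =
        (2 * c) powr M * C * (rho1 z powr M * rho1 z powr (- M + s))"
      using c r by (simp add: powr_mult mult_ac)
    also have "rho1 z powr M * rho1 z powr (- M + s) = rho1 z powr s"
      using r by (simp flip: powr_add)
    finally have *: "(2 * c * rho1 z) powr M * (C * rho1 z powr (- M + s)) = (2 * c) powr M * C * rho1 z powr s" .
    show ?thesis unfolding *[symmetric] using C by (intro ennreal_mult[symmetric]) auto
  qed
  finally show ?thesis .
qed

end

section \<open>Schur's test\<close>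

text \<open>Young's inequality after normalising by U and W. Positive upper bounds in place of the
  norms themselves avoid case distinctions for vanishing or infinite norms.\<close>

lemma nn_integral_Holder:
  fixes f g :: "'a \<Rightarrow> real"
  assumes p: "p > 1" "q > 1" "1 / p + 1 / q = 1"
    and [measurable]: "f \<in> borel_measurable M" "g \<in> borel_measurable M"
    and nonneg: "\<And>x. f x \<ge> 0" "\<And>x. g x \<ge> 0"
    and f: "(\<integral>\<^sup>+x. ennreal (f x powr p) \<partial>M) \<le> ennreal U" and g: "(\<integral>\<^sup>+x. ennreal (g x powr q) \<partial>M) \<le> ennreal W"
    and UW: "U > 0" "W > 0"
  shows "(\<integral>\<^sup>+x. ennreal (f x * g x) \<partial>M) \<le> ennreal (U powr (1 / p) * W powr (1 / q))"
proof -
  define S where "S = U powr (1 / p) * W powr (1 / q)"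
  have S: "S > 0" using UW by (simp add: S_def)
  have lin: "ennreal (c * x + d * y) = ennreal c * ennreal x + ennreal d * ennreal y"
    if "c \<ge> 0" "d \<ge> 0" "x \<ge> 0" "y \<ge> 0" for c d x y :: real
    using that by (simp add: ennreal_mult)
  have c: "S / (p * U) \<ge> 0" "S / (q * W) \<ge> 0" using p UW S by simp_all
  have "(\<integral>\<^sup>+x. ennreal (f x * g x) \<partial>M) \<le>
     (\<integral>\<^sup>+x. ennreal (S / (p * U)) * ennreal (f x powr p) + ennreal (S / (q * W)) * ennreal (g x powr q) \<partial>M)"
  proof (rule nn_integral_mono)
    fix x
    have "(f x / U powr (1 / p)) * (g x / W powr (1 / q)) \<le>
       (f x / U powr (1 / p)) powr p / p + (g x / W powr (1 / q)) powr q / q"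
      using p nonneg by (intro Youngs_inequality) auto
    also have "\<dots> = f x powr p / U / p + g x powr q / W / q"
      using p UW nonneg[of x] by (simp add: powr_divide powr_powr)
    finally have "f x * g x / S \<le> f x powr p / U / p + g x powr q / W / q" by (simp add: S_def)
    then have "f x * g x \<le> S * (f x powr p / U / p + g x powr q / W / q)"
      using S by (simp add: field_simps)
    also have "\<dots> = S / (p * U) * f x powr p + S / (q * W) * g x powr q"
      by (simp add: algebra_simps)
    finally have "ennreal (f x * g x) \<le> ennreal (S / (p * U) * f x powr p + S / (q * W) * g x powr q)"
      by (rule ennreal_leI)
    then show "ennreal (f x * g x) \<le> ennreal (S / (p * U)) * ennreal (f x powr p) + ennreal (S / (q * W)) * ennreal (g x powr q)"
      unfolding lin[OF c powr_ge_zero powr_ge_zero] .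
  qed
  also have "\<dots> = ennreal (S / (p * U)) * (\<integral>\<^sup>+x. ennreal (f x powr p) \<partial>M) + ennreal (S / (q * W)) * (\<integral>\<^sup>+x. ennreal (g x powr q) \<partial>M)"
    by (simp add: nn_integral_add nn_integral_cmult)
  also have "\<dots> \<le> ennreal (S / (p * U)) * ennreal U + ennreal (S / (q * W)) * ennreal W"
    using f g by (intro add_mono mult_left_mono) auto
  also have "\<dots> = ennreal (S / (p * U) * U + S / (q * W) * W)"
    using lin[OF c, of U W] UW by simp
  also have "S / (p * U) * U + S / (q * W) * W = S * (1 / p + 1 / q)"
    using p UW by (simp add: field_simps)
  finally show ?thesis using p by (simp add: S_def)
qed

text \<open>The first half of Schur's test: Hoelder for the weighted measure with density
  |\<rho>(z,w)|^(-N), with g split into g \<rho>^\<sigma> and \<rho>^(-\<sigma>). The kernel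
  estimate asks for an exponent above weight + n + 1, and N equals \<alpha> + n + 1; the factor
  \<rho>^(-\<sigma>q) lowers the weight and makes the inequality strict. The choice of \<sigma> puts
  both \<sigma>q = (\<alpha>+1)/(2p) and \<sigma>p = (\<alpha>+1)/(2q) strictly between 0 and
  \<alpha>+1, so the lowered weights stay above -1.\<close>

lemma schur_pointwise:
  fixes \<alpha> p q :: real
  assumes \<alpha>: "\<alpha> > -1" and p: "p > 1" "q > 1" "1 / p + 1 / q = 1"
  defines "N \<equiv> real CARD('n) + \<alpha> + 1"
  defines "\<sigma> \<equiv> (\<alpha> + 1) / (2 * p * q)"
  obtains C1 :: real where "C1 > 0" and
    "\<And>(z :: 'n::{finite,linorder} cvec) g x. z \<in> T_B \<Longrightarrow> g \<in> borel_measurable borel \<Longrightarrow> (\<And>w. g w \<ge> 0) \<Longrightarrow> x \<ge> 0 \<Longrightarrow>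
      ennreal x \<le> V_int \<alpha> (\<lambda>w. ennreal (norm (rho z w) powr (- N) * g w)) \<Longrightarrow>
      ennreal (x powr p) \<le> ennreal (C1 * rho1 z powr (- \<sigma> * p)) *
       V_int \<alpha> (\<lambda>w. ennreal (norm (rho z w) powr (- N) * (g w powr p * rho1 w powr (\<sigma> * p))))"
proof -
  have \<sigma>q: "\<sigma> * q > 0" "\<sigma> * q < \<alpha> + 1"
  proof -
    have eq: "\<sigma> * q = (\<alpha> + 1) / (2 * p)" using p by (simp add: \<sigma>_def)
    show "\<sigma> * q > 0" "\<sigma> * q < \<alpha> + 1"
      unfolding eq using \<alpha> p mult_strict_left_mono[of 1 "2 * p" "\<alpha> + 1"] by (simp_all add: divide_less_eq)
  qed
  obtain J :: real where J: "J > 0" "\<And>z :: 'n cvec. z \<in> T_B \<Longrightarrow>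
    V_int (\<alpha> - \<sigma> * q) (\<lambda>w. ennreal (norm (rho z w) powr (- N)))
      \<le> ennreal (J * rho1 z powr (real CARD('n) + (\<alpha> - \<sigma> * q) + 1 - N))"
    by (rule nn_integral_rho_kernel[where 'n = 'n and a = "\<alpha> - \<sigma> * q" and b = N],
        use \<sigma>q in simp, use \<sigma>q in \<open>simp add: N_def\<close>, rule that)
  have expN: "real CARD('n) + (\<alpha> - \<sigma> * q) + 1 - N = - (\<sigma> * q)" by (simp add: N_def)
  define C1 where "C1 = J powr (p / q)"
  show thesis
  proof (rule that)
    show "C1 > 0" using J by (simp add: C1_def)
    fix z :: "'n cvec" and g :: "'n cvec \<Rightarrow> real" and x :: real
    assume z: "z \<in> T_B" and [measurable]: "g \<in> borel_measurable borel" and g: "\<And>w. g w \<ge> 0" and x: "x \<ge> 0"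
      and le: "ennreal x \<le> V_int \<alpha> (\<lambda>w. ennreal (norm (rho z w) powr (- N) * g w))"
    have r: "rho1 z > 0" using z by (simp add: T_B_iff)
    \<comment> \<open>Kernel and weight go into one density, so that Hoelder concerns
      \<open>f1\<close> and \<open>f2\<close> alone.\<close>
    define \<omega> where "\<omega> w = indicator T_B w * (rho1 w powr \<alpha> * norm (rho z w) powr (- N))" for w
    have [measurable]: "\<omega> \<in> borel_measurable borel" unfolding \<omega>_def by measurable
    define M where "M = density (lborel :: 'n cvec measure) (\<lambda>w. ennreal (\<omega> w))"
    have M: "(\<integral>\<^sup>+w. ennreal (h w) \<partial>M) = V_int \<alpha> (\<lambda>w. ennreal (norm (rho z w) powr (- N) * h w))"
      if [measurable]: "h \<in> borel_measurable borel" and h: "\<And>w. h w \<ge> 0" for h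
    proof -
      have "(\<integral>\<^sup>+w. ennreal (h w) \<partial>M) = (\<integral>\<^sup>+w. ennreal (\<omega> w) * ennreal (h w) \<partial>lborel)"
        unfolding M_def by (rule nn_integral_density) measurable
      also have "\<dots> = V_int \<alpha> (\<lambda>w. ennreal (norm (rho z w) powr (- N) * h w))"
        using h by (intro nn_integral_cong) (simp add: \<omega>_def ennreal_mult mult_ac split: split_indicator)
      finally show ?thesis .
    qed
    define f1 where "f1 w = g w * rho1 w powr \<sigma>" for w
    define f2 where "f2 w = rho1 w powr (- \<sigma>)" for w :: "'n cvec"
    have f12: "ennreal x \<le> (\<integral>\<^sup>+w. ennreal (f1 w * f2 w) \<partial>M)"
    proof -
      have "(\<integral>\<^sup>+w. ennreal (f1 w * f2 w) \<partial>M) = V_int \<alpha> (\<lambda>w. ennreal (norm (rho z w) powr (- N) * (f1 w * f2 w)))"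
        by (rule M) (auto simp: f1_def f2_def g)
      also have "\<dots> = V_int \<alpha> (\<lambda>w. ennreal (norm (rho z w) powr (- N) * g w))"
      proof (rule nn_integral_cong)
        fix w :: "'n cvec"
        show "indicator T_B w * (ennreal (rho1 w powr \<alpha>) * ennreal (norm (rho z w) powr (- N) * (f1 w * f2 w))) =
          indicator T_B w * (ennreal (rho1 w powr \<alpha>) * ennreal (norm (rho z w) powr (- N) * g w))"
        proof (cases "w \<in> T_B")
          case True
          then have "rho1 w powr \<sigma> * rho1 w powr (- \<sigma>) = 1" by (simp add: T_B_iff flip: powr_add)
          then have "f1 w * f2 w = g w" by (simp add: f1_def f2_def mult.assoc)
          then show ?thesis by simp
        qed simp
      qed
      finally show ?thesis using le by simp
    qed
    have f2: "(\<integral>\<^sup>+w. ennreal (f2 w powr q) \<partial>M) \<le> ennreal (J * rho1 z powr (- (\<sigma> * q)))"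
    proof -
      have "(\<integral>\<^sup>+w. ennreal (f2 w powr q) \<partial>M) = V_int \<alpha> (\<lambda>w. ennreal (norm (rho z w) powr (- N) * f2 w powr q))"
        by (rule M) (auto simp: f2_def)
      also have "\<dots> = V_int (\<alpha> - \<sigma> * q) (\<lambda>w. ennreal (norm (rho z w) powr (- N)))"
      proof (rule nn_integral_cong)
        fix w :: "'n cvec"
        have e2: "rho1 w powr \<alpha> * (norm (rho z w) powr (- N) * f2 w powr q) = rho1 w powr (\<alpha> - \<sigma> * q) * norm (rho z w) powr (- N)"
        proof -
          have "\<alpha> + (- \<sigma>) * q = \<alpha> - \<sigma> * q" by simp
          then have eq: "rho1 w powr \<alpha> * f2 w powr q = rho1 w powr (\<alpha> - \<sigma> * q)"
            unfolding f2_def powr_powr powr_add[symmetric] by (simp only:)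
          show ?thesis unfolding eq[symmetric] by (simp only: ac_simps)
        qed
        show "indicator T_B w * (ennreal (rho1 w powr \<alpha>) * ennreal (norm (rho z w) powr (- N) * f2 w powr q)) =
          indicator T_B w * (ennreal (rho1 w powr (\<alpha> - \<sigma> * q)) * ennreal (norm (rho z w) powr (- N)))"
          by (simp only: ennreal_mult[symmetric] powr_ge_zero mult_nonneg_nonneg e2)
      qed
      also have "\<dots> \<le> ennreal (J * rho1 z powr (- (\<sigma> * q)))"
        using J(2)[OF z] unfolding expN .
      finally show ?thesis .
    qed
    define A where "A = (\<integral>\<^sup>+w. ennreal (f1 w powr p) \<partial>M)"
    have A_eq: "A = V_int \<alpha> (\<lambda>w. ennreal (norm (rho z w) powr (- N) * (g w powr p * rho1 w powr (\<sigma> * p))))"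
    proof -
      have "A = V_int \<alpha> (\<lambda>w. ennreal (norm (rho z w) powr (- N) * f1 w powr p))"
        unfolding A_def by (rule M) (auto simp: f1_def)
      then show ?thesis using g by (simp add: f1_def powr_mult powr_powr)
    qed
    have fm: "f1 \<in> borel_measurable M" "f2 \<in> borel_measurable M"
      unfolding f1_def f2_def M_def by measurable
    define K where "K = C1 * rho1 z powr (- \<sigma> * p)"
    have K: "K > 0" using J r by (simp add: K_def C1_def)
    have "ennreal (x powr p) \<le> ennreal K * A"
    proof (cases A)
      case (real a)
      have "x powr p \<le> K * a"
      proof (rule field_le_epsilon)
        fix e :: real assume e: "e > 0"
        \<comment> \<open>The addition keeps the bound positive even if \<open>A\<close> vanishes,
          as \<open>nn_integral_Holder\<close> asks.\<close>
        define a' where "a' = a + e / K"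
        have a': "a' > 0" "a \<le> a'" using e K real by (auto simp: a'_def add_nonneg_pos)
        have "ennreal x \<le> ennreal (a' powr (1 / p) * (J * rho1 z powr (- (\<sigma> * q))) powr (1 / q))"
        proof (rule order_trans[OF f12 nn_integral_Holder[OF p fm]])
          show "(\<integral>\<^sup>+w. ennreal (f1 w powr p) \<partial>M) \<le> ennreal a'"
            using real a' by (simp add: A_def[symmetric] ennreal_leI)
          show "f1 w \<ge> 0" "f2 w \<ge> 0" for w using g by (simp_all add: f1_def f2_def)
          show "J * rho1 z powr (- (\<sigma> * q)) > 0" using J(1) r by simp
        qed (use f2 a'(1) in simp_all)
        then have "x \<le> a' powr (1 / p) * (J * rho1 z powr (- (\<sigma> * q))) powr (1 / q)"
          by (simp add: ennreal_le_iff)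
        then have "x powr p \<le> (a' powr (1 / p) * (J * rho1 z powr (- (\<sigma> * q))) powr (1 / q)) powr p"
          using x p by (intro powr_mono2) auto
        also have "\<dots> = a' * (J powr (p / q) * rho1 z powr (- \<sigma> * p))"
        proof -
          have "- (\<sigma> * q) * (1 / q) * p = - \<sigma> * p" using p by simp
          then show ?thesis
            using a' J p r by (simp add: powr_mult powr_powr)
        qed
        also have "\<dots> = a' * K" by (simp add: K_def C1_def)
        also have "\<dots> = K * a + e" using K by (simp add: a'_def field_simps)
        finally show "x powr p \<le> K * a + e" .
      qed
      then show ?thesis using real K by (simp add: ennreal_leI flip: ennreal_mult)
    next
      case top
      then show ?thesis using K by (simp add: ennreal_mult_top)
    qed
    then show "ennreal (x powr p) \<le> ennreal (C1 * rho1 z powr (- \<sigma> * p)) *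
       V_int \<alpha> (\<lambda>w. ennreal (norm (rho z w) powr (- N) * (g w powr p * rho1 w powr (\<sigma> * p))))"
      unfolding K_def A_eq .
  qed
qed

text \<open>The second half: the pointwise estimate is integrated over z and the order exchanged;
  the kernel integral in z with weight \<alpha> - \<sigma>p returns \<rho>(w)^(-\<sigma>p), which
  cancels \<rho>(w)^(\<sigma>p). The form with a dominated G lets G be the modulus of a Toeplitz
  image.\<close>

lemma schur_bound:
  fixes \<alpha> p :: real
  assumes \<alpha>: "\<alpha> > -1" and p: "p > 1"
  obtains C :: real where "C > 0" and
    "\<And>G (g :: 'n::{finite,linorder} cvec \<Rightarrow> real). g \<in> borel_measurable borel \<Longrightarrow> (\<And>w. g w \<ge> 0) \<Longrightarrow> (\<And>z. G z \<ge> 0) \<Longrightarrow>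
      (\<And>z. z \<in> T_B \<Longrightarrow> ennreal (G z) \<le> V_int \<alpha> (\<lambda>w. ennreal (norm (rho z w) powr (- (real CARD('n) + \<alpha> + 1)) * g w))) \<Longrightarrow>
      V_int \<alpha> (\<lambda>z. ennreal (G z powr p)) \<le>
       ennreal C * V_int \<alpha> (\<lambda>w. ennreal (g w powr p))"
proof -
  define N where "N = real CARD('n) + \<alpha> + 1"
  define q where "q = p / (p - 1)"
  have q: "q > 1" "1 / p + 1 / q = 1" using p by (simp_all add: q_def field_simps)
  define \<sigma> where "\<sigma> = (\<alpha> + 1) / (2 * p * q)"
  have \<sigma>p: "\<sigma> * p > 0" "\<sigma> * p < \<alpha> + 1"
  proof -
    have eq: "\<sigma> * p = (\<alpha> + 1) / (2 * q)" using p by (simp add: \<sigma>_def)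
    show "\<sigma> * p > 0" "\<sigma> * p < \<alpha> + 1"
      unfolding eq using \<alpha> q mult_strict_left_mono[of 1 "2 * q" "\<alpha> + 1"] by (simp_all add: divide_less_eq)
  qed
  obtain J :: real where J: "J > 0" "\<And>z :: 'n cvec. z \<in> T_B \<Longrightarrow>
    V_int (\<alpha> - \<sigma> * p) (\<lambda>w. ennreal (norm (rho z w) powr (- N)))
      \<le> ennreal (J * rho1 z powr (real CARD('n) + (\<alpha> - \<sigma> * p) + 1 - N))"
    by (rule nn_integral_rho_kernel[where 'n = 'n and a = "\<alpha> - \<sigma> * p" and b = N],
        use \<sigma>p in simp, use \<sigma>p in \<open>simp add: N_def\<close>, rule that)
  have expN: "real CARD('n) + (\<alpha> - \<sigma> * p) + 1 - N = - (\<sigma> * p)" by (simp add: N_def)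
  show thesis
  proof (rule schur_pointwise[where 'n = 'n, OF \<alpha> p q])
    fix C1 :: real
    assume C1: "C1 > 0" and C1':
    "\<And>(z :: 'n cvec) g x. z \<in> T_B \<Longrightarrow> g \<in> borel_measurable borel \<Longrightarrow> (\<And>w. g w \<ge> 0) \<Longrightarrow> x \<ge> 0 \<Longrightarrow>
      ennreal x \<le> V_int \<alpha> (\<lambda>w. ennreal (norm (rho z w) powr (- (real CARD('n) + \<alpha> + 1)) * g w)) \<Longrightarrow>
      ennreal (x powr p) \<le> ennreal (C1 * rho1 z powr (- ((\<alpha> + 1) / (2 * p * q)) * p)) *
       V_int \<alpha> (\<lambda>w. ennreal (norm (rho z w) powr (- (real CARD('n) + \<alpha> + 1)) * (g w powr p * rho1 w powr ((\<alpha> + 1) / (2 * p * q) * p))))"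
    show thesis
    proof (rule that)
      show "C1 * J > 0" using C1 J by simp
      fix G :: "'n cvec \<Rightarrow> real" and g :: "'n cvec \<Rightarrow> real"
      assume [measurable]: "g \<in> borel_measurable borel" and g: "\<And>w. g w \<ge> 0" and G: "\<And>z. G z \<ge> 0"
        and le: "\<And>z. z \<in> T_B \<Longrightarrow> ennreal (G z) \<le> V_int \<alpha> (\<lambda>w. ennreal (norm (rho z w) powr (- (real CARD('n) + \<alpha> + 1)) * g w))"
      define H where "H z w = (indicator T_B z * (ennreal (rho1 z powr \<alpha>) * ennreal (C1 * rho1 z powr (- \<sigma> * p)))) *
         (indicator T_B w * (ennreal (rho1 w powr \<alpha>) * ennreal (norm (rho z w) powr (- N) * (g w powr p * rho1 w powr (\<sigma> * p)))))" for z w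
      have Hm: "case_prod H \<in> borel_measurable (lborel \<Otimes>\<^sub>M lborel)"
        unfolding H_def by (simp add: case_prod_beta') measurable
      have "V_int \<alpha> (\<lambda>z. ennreal (G z powr p)) \<le>
         (\<integral>\<^sup>+z. \<integral>\<^sup>+w. H z w \<partial>lborel \<partial>lborel)"
      proof (rule nn_integral_mono)
        fix z :: "'n cvec"
        show "indicator T_B z * (ennreal (rho1 z powr \<alpha>) * ennreal (G z powr p)) \<le> (\<integral>\<^sup>+w. H z w \<partial>lborel)"
        proof (cases "z \<in> T_B")
          case True
          have "ennreal (G z powr p) \<le> ennreal (C1 * rho1 z powr (- \<sigma> * p)) *
             V_int \<alpha> (\<lambda>w. ennreal (norm (rho z w) powr (- N) * (g w powr p * rho1 w powr (\<sigma> * p))))"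
            unfolding \<sigma>_def N_def by (rule C1'[OF True _ g G le[OF True]]) measurable
          then have "indicator T_B z * (ennreal (rho1 z powr \<alpha>) * ennreal (G z powr p)) \<le>
            indicator T_B z * (ennreal (rho1 z powr \<alpha>) * (ennreal (C1 * rho1 z powr (- \<sigma> * p)) *
             V_int \<alpha> (\<lambda>w. ennreal (norm (rho z w) powr (- N) * (g w powr p * rho1 w powr (\<sigma> * p))))))"
            by (intro mult_left_mono) auto
          also have "\<dots> = (\<integral>\<^sup>+w. H z w \<partial>lborel)"
            unfolding H_def by (subst nn_integral_cmult) (simp_all add: mult.assoc)
          finally show ?thesis .
        qed simp
      qed
      also have "\<dots> = (\<integral>\<^sup>+w. \<integral>\<^sup>+z. H z w \<partial>lborel \<partial>lborel)"
        by (rule lborel_pair.Fubini'[OF Hm, symmetric])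
      also have "\<dots> \<le> (\<integral>\<^sup>+w. ennreal (C1 * J) * (indicator T_B w * (ennreal (rho1 w powr \<alpha>) * ennreal (g w powr p))) \<partial>lborel)"
      proof (rule nn_integral_mono)
        fix w :: "'n cvec"
        show "(\<integral>\<^sup>+z. H z w \<partial>lborel) \<le> ennreal (C1 * J) * (indicator T_B w * (ennreal (rho1 w powr \<alpha>) * ennreal (g w powr p)))"
        proof (cases "w \<in> T_B")
          case True
          then have r: "rho1 w > 0" by (simp add: T_B_iff)
          have "(\<integral>\<^sup>+z. H z w \<partial>lborel) = (\<integral>\<^sup>+z. ennreal (C1 * (rho1 w powr \<alpha> * (g w powr p * rho1 w powr (\<sigma> * p)))) *
             (indicator T_B z * (ennreal (rho1 z powr (\<alpha> - \<sigma> * p)) * ennreal (norm (rho w z) powr (- N)))) \<partial>lborel)"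
          proof (rule nn_integral_cong)
            fix z :: "'n cvec"
            show "H z w = ennreal (C1 * (rho1 w powr \<alpha> * (g w powr p * rho1 w powr (\<sigma> * p)))) *
             (indicator T_B z * (ennreal (rho1 z powr (\<alpha> - \<sigma> * p)) * ennreal (norm (rho w z) powr (- N))))"
            proof (cases "z \<in> T_B")
              case z: True
              have "rho1 z powr (\<alpha> - \<sigma> * p) = rho1 z powr \<alpha> * rho1 z powr (- \<sigma> * p)"
                by (simp flip: powr_add)
              then show ?thesis
                using True z C1 g[of w] unfolding H_def norm_rho_commute[of z w]
                by (simp add: ennreal_mult mult_ac)
            qed (simp add: H_def)
          qed
          also have "\<dots> = ennreal (C1 * (rho1 w powr \<alpha> * (g w powr p * rho1 w powr (\<sigma> * p)))) *
             V_int (\<alpha> - \<sigma> * p) (\<lambda>z. ennreal (norm (rho w z) powr (- N)))"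
            by (rule nn_integral_cmult) measurable
          also have "\<dots> \<le> ennreal (C1 * (rho1 w powr \<alpha> * (g w powr p * rho1 w powr (\<sigma> * p)))) * ennreal (J * rho1 w powr (- (\<sigma> * p)))"
            using J(2)[OF True] unfolding expN by (intro mult_left_mono) auto
          also have "\<dots> = ennreal (C1 * J * (rho1 w powr \<alpha> * (g w powr p * (rho1 w powr (\<sigma> * p) * rho1 w powr (- (\<sigma> * p))))))"
            using C1 J g[of w] by (subst ennreal_mult[symmetric]) (auto simp: mult_ac)
          also have "rho1 w powr (\<sigma> * p) * rho1 w powr (- (\<sigma> * p)) = 1"
            using r by (simp flip: powr_add)
          also have "ennreal (C1 * J * (rho1 w powr \<alpha> * (g w powr p * 1))) = ennreal (C1 * J) * (indicator T_B w * (ennreal (rho1 w powr \<alpha>) * ennreal (g w powr p)))"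
            using True C1 J by (simp add: ennreal_mult)
          finally show ?thesis .
        qed (simp add: H_def)
      qed
      also have "\<dots> = ennreal (C1 * J) * V_int \<alpha> (\<lambda>w. ennreal (g w powr p))"
        by (rule nn_integral_cmult) measurable
      finally show "V_int \<alpha> (\<lambda>z. ennreal (G z powr p)) \<le>
       ennreal (C1 * J) * V_int \<alpha> (\<lambda>w. ennreal (g w powr p))" .
    qed
  qed
qed

section \<open>Toeplitz operators\<close>

lemma S_space_bound:
  assumes "f \<in> S_space t"
  obtains M :: real where "M \<ge> 0" and "\<And>w. w \<in> T_B \<Longrightarrow> norm (f w) \<le> M * norm (rho w base_pt) powr (- t)"
proof -
  obtain M where M: "\<And>z. z \<in> T_B \<Longrightarrow> norm (rho z base_pt) powr t * norm (f z) \<le> M"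
    using assms by (auto simp: S_space_def bdd_above_def)
  show thesis
  proof (rule that[of "max M 0"])
    fix w assume w: "w \<in> (T_B :: 'a cvec set)"
    have p: "norm (rho w base_pt) powr t > 0" using norm_rho_pos[OF w base_pt_in_T_B] by simp
    have "norm (rho w base_pt) powr t * norm (f w) \<le> max M 0" using M[OF w] by simp
    then show "norm (f w) \<le> max M 0 * norm (rho w base_pt) powr (- t)"
      using p by (simp add: powr_minus field_simps)
  qed simp
qed

text \<open>t p exceeds n p + \<alpha> + 1 \<ge> n + \<alpha> + 1, so |\<rho>(w,i)|^(-tp) is
  integrable for the weight \<rho>^\<alpha>.\<close>

lemma S_space_subset_A_space:
  fixes \<alpha> p t :: real
  assumes \<alpha>: "\<alpha> > -1" and p: "p > 1" and t: "t > real CARD('n) + (\<alpha> + 1) / p"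
    and f: "f \<in> S_space t"
  shows "f \<in> (A_space p \<alpha> :: ('n::{finite,linorder} cvec \<Rightarrow> complex) set)"
proof (rule S_space_bound[OF f])
  fix M :: real assume M: "M \<ge> 0" "\<And>w. w \<in> T_B \<Longrightarrow> norm (f w) \<le> M * norm (rho w base_pt) powr (- t)"
  have hol: "holomorphic_several_on f T_B" using f by (simp add: S_space_def)
  have "(\<alpha> + 1) / p * p = \<alpha> + 1" using p by simp
  moreover have "(real CARD('n) + (\<alpha> + 1) / p) * p < t * p"
    using t p by (intro mult_strict_right_mono) auto
  ultimately have "real CARD('n) * p + (\<alpha> + 1) < t * p"
    by (simp only: distrib_right)
  moreover have "real CARD('n) * 1 \<le> real CARD('n) * p" using p by (intro mult_left_mono) auto
  ultimately have tp: "t * p > \<alpha> + real CARD('n) + 1" by linarith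
  have "(\<integral>\<^sup>+w. ennreal (norm (f w) powr p) \<partial>V_meas \<alpha>) =
     V_int \<alpha> (\<lambda>w. ennreal (norm (f w) powr p))"
    by (rule nn_integral_V_meas) (rule holomorphic_several_measurable(2)[OF hol])
  also have "\<dots> \<le> (\<integral>\<^sup>+w. ennreal (M powr p) * (indicator T_B w * ennreal (rho1 w powr \<alpha> * norm (rho w base_pt) powr (- (t * p)))) \<partial>(lborel :: 'n cvec measure))"
  proof (rule nn_integral_mono)
    fix w :: "'n cvec"
    show "indicator T_B w * (ennreal (rho1 w powr \<alpha>) * ennreal (norm (f w) powr p)) \<le>
      ennreal (M powr p) * (indicator T_B w * ennreal (rho1 w powr \<alpha> * norm (rho w base_pt) powr (- (t * p))))"
    proof (cases "w \<in> T_B")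
      case True
      have "norm (f w) powr p \<le> (M * norm (rho w base_pt) powr (- t)) powr p"
        using M(2)[OF True] p by (intro powr_mono2) auto
      also have "\<dots> = M powr p * norm (rho w base_pt) powr (- (t * p))"
        using M(1) by (simp add: powr_mult powr_powr)
      finally have "rho1 w powr \<alpha> * norm (f w) powr p \<le> rho1 w powr \<alpha> * (M powr p * norm (rho w base_pt) powr (- (t * p)))"
        by (rule mult_left_mono) simp
      then have "ennreal (rho1 w powr \<alpha> * norm (f w) powr p) \<le> ennreal (M powr p * (rho1 w powr \<alpha> * norm (rho w base_pt) powr (- (t * p))))"
        by (intro ennreal_leI) (simp only: ac_simps)
      then show ?thesis using True by (simp add: ennreal_mult)
    qed simp
  qed
  also have "\<dots> = ennreal (M powr p) * (\<integral>\<^sup>+w. indicator T_B w * ennreal (rho1 w powr \<alpha> * norm (rho w base_pt) powr (- (t * p))) \<partial>(lborel :: 'n cvec measure))"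
    by (rule nn_integral_cmult) measurable
  also have "\<dots> < \<infinity>"
    using nn_integral_rho_finite[where 'n = 'n, OF \<alpha> tp] by (simp add: ennreal_mult_less_top)
  finally show ?thesis using hol by (simp add: A_space_def)
qed

context measure_on_T_B
begin

lemma S_space_integrable:
  assumes fin: "(\<integral>\<^sup>+z. ennreal (norm (rho z base_pt) powr (- t)) \<partial>\<mu>) < \<infinity>" and f: "f \<in> S_space t"
  shows "integrable \<mu> f"
proof (rule S_space_bound[OF f])
  note [measurable] = measurable_ident_mu
  fix M :: real assume M: "M \<ge> 0" "\<And>w. w \<in> T_B \<Longrightarrow> norm (f w) \<le> M * norm (rho w base_pt) powr (- t)"
  have hol: "holomorphic_several_on f T_B" using f by (simp add: S_space_def)
  show ?thesis
  proof (rule integrableI_bounded)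
    show "f \<in> borel_measurable \<mu>" by (rule measurable_mu[OF holomorphic_several_measurable(1)[OF hol]])
    have "(\<integral>\<^sup>+w. ennreal (norm (f w)) \<partial>\<mu>) \<le> (\<integral>\<^sup>+w. ennreal M * ennreal (norm (rho w base_pt) powr (- t)) \<partial>\<mu>)"
      using M by (intro nn_integral_mono) (auto simp: space_mu ennreal_leI simp flip: ennreal_mult)
    also have "\<dots> = ennreal M * (\<integral>\<^sup>+w. ennreal (norm (rho w base_pt) powr (- t)) \<partial>\<mu>)"
      by (rule nn_integral_cmult) measurable
    also have "\<dots> < \<infinity>" using fin by (simp add: ennreal_mult_less_top)
    finally show "(\<integral>\<^sup>+w. ennreal (norm (f w)) \<partial>\<mu>) < \<infinity>" .
  qed
qed

lemma holomorphic_several_integral_rho_powr: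
  assumes \<phi>: "integrable \<mu> \<phi>" and s: "s > 0"
  shows "holomorphic_several_on (\<lambda>z. \<integral>w. rho z w powr of_real (- s) * \<phi> w \<partial>\<mu>) T_B"
  unfolding holomorphic_several_on_def
proof
  fix z assume "z \<in> (T_B :: 'n cvec set)"
  note D = has_derivative_integral_rho_powr[OF \<phi> s this]
  let ?D = "\<lambda>h. \<integral>w. - of_real s * rho z w powr of_real (- s - 1) * drho z w h * \<phi> w \<partial>\<mu>"
  have "?D (c *s v) = c * ?D v" for c v
  proof -
    have "?D (c *s v) = (\<integral>w. c * (- of_real s * rho z w powr of_real (- s - 1) * drho z w v * \<phi> w) \<partial>\<mu>)"
      by (intro Bochner_Integration.integral_cong) (auto simp: drho_scaleC)
    then show ?thesis by simp
  qed
  then show "\<exists>f'. ((\<lambda>z. \<integral>w. rho z w powr of_real (- s) * \<phi> w \<partial>\<mu>) has_derivative f') (at z) \<and> (\<forall>c v. f' (c *s v) = c * f' v)"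
    using D by (intro exI[of _ ?D]) auto
qed

lemma toeplitz_bounded_of_hball:
  fixes \<alpha> p c C t0 :: real
  assumes \<alpha>: "\<alpha> > -1" and p: "p > 1" and c: "c > 1" and C: "C \<ge> 0"
    and fin0: "(\<integral>\<^sup>+z. ennreal (norm (rho z base_pt) powr (- t0)) \<partial>\<mu>) < \<infinity>"
    and avg: "\<And>z. z \<in> T_B \<Longrightarrow> emeasure \<mu> (hball c z) \<le> ennreal (C * rho1 z powr (real CARD('n) + \<alpha> + 1))"
  shows "toeplitz_bounded p \<alpha> \<mu>"
proof -
  note [measurable] = measurable_ident_mu
  let ?N = "real CARD('n) + \<alpha> + 1"
  have N: "?N > 0" using \<alpha> by (simp add: add_pos_pos add.assoc)
  \<comment> \<open>Above both thresholds; raising the exponent keeps the integral finite because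
    |\<rho>(z,i)| \<ge> 1/2.\<close>
  define t where "t = max t0 (real CARD('n) + (\<alpha> + 1) / p) + 1"
  have t: "t > real CARD('n) + (\<alpha> + 1) / p" "t > t0" by (auto simp: t_def)
  have fin: "(\<integral>\<^sup>+z. ennreal (norm (rho z base_pt) powr (- t)) \<partial>\<mu>) < \<infinity>"
  proof -
    have "(\<integral>\<^sup>+z. ennreal (norm (rho z base_pt) powr (- t)) \<partial>\<mu>) \<le>
      (\<integral>\<^sup>+z. ennreal ((1/2) powr (t0 - t)) * ennreal (norm (rho z base_pt) powr (- t0)) \<partial>\<mu>)"
    proof (rule nn_integral_mono)
      fix z assume "z \<in> space \<mu>"
      then have z: "z \<in> T_B" by (simp add: space_mu)
      have "norm (rho z base_pt) powr (- t) = norm (rho z base_pt) powr (t0 - t) * norm (rho z base_pt) powr (- t0)"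
        by (simp flip: powr_add)
      also have "\<dots> \<le> (1/2) powr (t0 - t) * norm (rho z base_pt) powr (- t0)"
        using norm_rho_base_ge[OF z] t by (intro mult_right_mono powr_mono2') auto
      finally show "ennreal (norm (rho z base_pt) powr (- t)) \<le> ennreal ((1/2) powr (t0 - t)) * ennreal (norm (rho z base_pt) powr (- t0))"
        by (simp add: ennreal_leI flip: ennreal_mult)
    qed
    also have "\<dots> = ennreal ((1/2) powr (t0 - t)) * (\<integral>\<^sup>+z. ennreal (norm (rho z base_pt) powr (- t0)) \<partial>\<mu>)"
      by (rule nn_integral_cmult) measurable
    also have "\<dots> < \<infinity>" using fin0 by (simp add: ennreal_mult_less_top)
    finally show ?thesis .
  qed
  have sf: "sigma_finite_measure \<mu>" by (rule sigma_finite_mu[OF fin])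
  show ?thesis
  proof (rule K_kernel_eq[where 'n = 'n, OF \<alpha>])
   fix \<kappa> :: real assume \<kappa>: "\<kappa> > 0" "\<And>z w :: 'n cvec. K_kernel \<alpha> z w = of_real \<kappa> * rho z w powr of_real (- ?N)"
   show ?thesis
   proof (rule carleson_of_hball[OF sf zero_less_one c C \<alpha> avg])
    fix C' :: real assume C': "C' > 0" and carl: "\<And>f. holomorphic_several_on f T_B \<Longrightarrow>
      (\<integral>\<^sup>+z. ennreal (norm (f z) powr 1) \<partial>\<mu>) \<le>
      ennreal C' * V_int \<alpha> (\<lambda>w. ennreal (norm (f w) powr 1))"
    show ?thesis
    proof (rule schur_bound[where 'n = 'n, OF \<alpha> p])
     fix Cs :: real assume Cs: "Cs > 0" and schur: "\<And>G (g :: 'n cvec \<Rightarrow> real). g \<in> borel_measurable borel \<Longrightarrow> (\<And>w. g w \<ge> 0) \<Longrightarrow> (\<And>z. G z \<ge> 0) \<Longrightarrow>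
      (\<And>z. z \<in> T_B \<Longrightarrow> ennreal (G z) \<le> V_int \<alpha> (\<lambda>w. ennreal (norm (rho z w) powr (- ?N) * g w))) \<Longrightarrow>
      V_int \<alpha> (\<lambda>z. ennreal (G z powr p)) \<le>
       ennreal Cs * V_int \<alpha> (\<lambda>w. ennreal (g w powr p))"
     define D where "D = Cs * (\<kappa> * C') powr p"
     have D: "D > 0" using Cs \<kappa>(1) C' by (simp add: D_def)
     have main: "toeplitz \<alpha> \<mu> f \<in> A_space p \<alpha> \<and> A_norm p \<alpha> (toeplitz \<alpha> \<mu> f) \<le> D powr (1 / p) * A_norm p \<alpha> f"
       if f: "f \<in> S_space t" for f
     proof -
      have hol: "holomorphic_several_on f T_B" using f by (simp add: S_space_def)
      have int: "integrable \<mu> f" by (rule S_space_integrable[OF fin f])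
      have fA: "f \<in> A_space p \<alpha>" by (rule S_space_subset_A_space[OF \<alpha> p t(1) f])
      let ?T = "toeplitz \<alpha> \<mu> f"
      have T_eq: "?T z = of_real \<kappa> * (\<integral>w. rho z w powr of_real (- ?N) * f w \<partial>\<mu>)" for z
        unfolding toeplitz_def \<kappa>(2) mult.assoc by simp
      have "holomorphic_several_on (\<lambda>z. of_real \<kappa> * (\<integral>w. rho z w powr of_real (- ?N) * f w \<partial>\<mu>)) T_B"
      proof (rule holomorphic_several_mult[OF _ holomorphic_several_integral_rho_powr[OF int N]])
        show "holomorphic_several_on (\<lambda>z. of_real \<kappa>) T_B"
          unfolding holomorphic_several_on_def by (auto intro!: exI[of _ "\<lambda>h. 0"])
      qed
      then have Thol: "holomorphic_several_on ?T T_B" by (simp only: T_eq[symmetric])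
      define g where "g w = \<kappa> * C' * (indicator T_B w * norm (f w))" for w
      have gm: "g \<in> borel_measurable borel"
      proof -
        have "(\<lambda>w. indicator T_B w *\<^sub>R f w) \<in> borel_measurable borel"
          using holomorphic_several_measurable(1)[OF hol] by (subst (asm) borel_measurable_restrict_space_iff) auto
        then have "(\<lambda>w. \<kappa> * C' * norm (indicator T_B w *\<^sub>R f w)) \<in> borel_measurable borel" by measurable
        then show ?thesis by (simp add: g_def[abs_def])
      qed
      have g0: "g w \<ge> 0" for w using \<kappa>(1) C' by (simp add: g_def)
      have T_le: "ennreal (norm (?T z)) \<le> V_int \<alpha> (\<lambda>w. ennreal (norm (rho z w) powr (- ?N) * g w))"
        if z: "z \<in> T_B" for z
      proof -
        \<comment> \<open>The kernel is antiholomorphic in w. Swapping its arguments conjugates it,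
          so \<open>h\<close> is holomorphic with the modulus of the integrand, and the Carleson
          inequality with exponent 1 applies.\<close>
        define h where "h w = rho w z powr of_real (- ?N) * f w" for w
        have hh: "holomorphic_several_on h T_B"
          unfolding h_def by (rule holomorphic_several_mult[OF holomorphic_several_rho_powr[OF z] hol])
        have nh: "norm (h w) = norm (rho z w) powr (- ?N) * norm (f w)" for w
          unfolding h_def norm_mult norm_powr_of_real norm_rho_commute[of w z] ..
        have [measurable]: "(\<lambda>w. ennreal (norm (h w) powr 1)) \<in> borel_measurable \<mu>"
          by (rule measurable_mu[OF holomorphic_several_measurable(2)[OF hh]])
        have "ennreal (norm (?T z)) = ennreal \<kappa> * ennreal (norm (\<integral>w. rho z w powr of_real (- ?N) * f w \<partial>\<mu>))"
          unfolding T_eq norm_mult using \<kappa>(1) by (simp add: ennreal_mult)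
        also have "\<dots> \<le> ennreal \<kappa> * (\<integral>\<^sup>+w. ennreal (norm (rho z w powr of_real (- ?N) * f w)) \<partial>\<mu>)"
          using N by (intro mult_left_mono integral_norm_bound_ennreal integrable_rho_powr z int) auto
        also have "(\<integral>\<^sup>+w. ennreal (norm (rho z w powr of_real (- ?N) * f w)) \<partial>\<mu>) = (\<integral>\<^sup>+w. ennreal (norm (h w) powr 1) \<partial>\<mu>)"
          unfolding norm_mult norm_powr_of_real nh by (intro nn_integral_cong) (simp add: powr_one')
        also have "ennreal \<kappa> * \<dots> \<le> ennreal \<kappa> * (ennreal C' * V_int \<alpha> (\<lambda>w. ennreal (norm (h w) powr 1)))"
          using carl[OF hh] by (rule mult_left_mono) simp
        also have "\<dots> = ennreal (\<kappa> * C') * V_int \<alpha> (\<lambda>w. ennreal (norm (h w) powr 1))"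
          using \<kappa>(1) C' by (simp add: ennreal_mult mult.assoc)
        also have "\<dots> = (\<integral>\<^sup>+w. ennreal (\<kappa> * C') * (indicator T_B w * (ennreal (rho1 w powr \<alpha>) * ennreal (norm (h w) powr 1))) \<partial>lborel)"
        proof (rule nn_integral_cmult[symmetric])
          have "(\<lambda>w. ennreal (rho1 w powr \<alpha>) * (indicator T_B w * ennreal (norm (h w) powr 1))) \<in> borel_measurable borel"
            using holomorphic_several_measurable(3)[OF hh, of 1] by measurable
          then show "(\<lambda>w. indicator T_B w * (ennreal (rho1 w powr \<alpha>) * ennreal (norm (h w) powr 1))) \<in> borel_measurable lborel"
            by (simp add: mult_ac)
        qed
        also have "\<dots> = V_int \<alpha> (\<lambda>w. ennreal (norm (rho z w) powr (- ?N) * g w))"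
          using \<kappa>(1) C'
          by (intro nn_integral_cong) (simp add: nh g_def powr_one' ennreal_mult mult_ac split: split_indicator)
        finally show ?thesis .
      qed
      let ?I = "\<lambda>f. \<integral>\<^sup>+w. ennreal (norm (f w) powr p) \<partial>V_meas \<alpha>"
      have "?I ?T = V_int \<alpha> (\<lambda>z. ennreal (norm (?T z) powr p))"
        by (rule nn_integral_V_meas) (rule holomorphic_several_measurable(2)[OF Thol])
      also have "\<dots> \<le> ennreal Cs * V_int \<alpha> (\<lambda>w. ennreal (g w powr p))"
        by (rule schur[OF gm g0 _ T_le]) auto
      also have "V_int \<alpha> (\<lambda>w. ennreal (g w powr p)) =
         (\<integral>\<^sup>+w. ennreal ((\<kappa> * C') powr p) * (ennreal (rho1 w powr \<alpha>) * (indicator T_B w * ennreal (norm (f w) powr p))) \<partial>lborel)"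
        using \<kappa>(1) C'
        by (intro nn_integral_cong) (simp add: g_def powr_mult ennreal_mult mult_ac split: split_indicator)
      also have "\<dots> = ennreal ((\<kappa> * C') powr p) * (\<integral>\<^sup>+w. ennreal (rho1 w powr \<alpha>) * (indicator T_B w * ennreal (norm (f w) powr p)) \<partial>lborel)"
      proof (rule nn_integral_cmult)
        have "(\<lambda>w. ennreal (rho1 w powr \<alpha>) * (indicator T_B w * ennreal (norm (f w) powr p))) \<in> borel_measurable borel"
          using holomorphic_several_measurable(3)[OF hol, of p] by measurable
        then show "(\<lambda>w. ennreal (rho1 w powr \<alpha>) * (indicator T_B w * ennreal (norm (f w) powr p))) \<in> borel_measurable lborel"
          by simp
      qed
      also have "(\<integral>\<^sup>+w. ennreal (rho1 w powr \<alpha>) * (indicator T_B w * ennreal (norm (f w) powr p)) \<partial>lborel) = ?I f"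
        by (subst nn_integral_V_meas[OF holomorphic_several_measurable(2)[OF hol]]) (simp add: mult_ac)
      also have "ennreal Cs * (ennreal ((\<kappa> * C') powr p) * ?I f) = ennreal D * ?I f"
        using Cs by (simp add: D_def ennreal_mult mult.assoc)
      finally have le: "?I ?T \<le> ennreal D * ?I f" .
      have "?I f < \<infinity>" using fA by (simp add: A_space_def)
      then have DIf: "ennreal D * ?I f < \<infinity>" by (simp add: ennreal_mult_less_top)
      have "enn2real (?I ?T) \<le> enn2real (ennreal D * ?I f)"
        using le DIf by (intro enn2real_mono) auto
      also have "\<dots> = D * enn2real (?I f)" using D by (simp add: enn2real_mult)
      finally have "enn2real (?I ?T) powr (1 / p) \<le> (D * enn2real (?I f)) powr (1 / p)"
        using p by (intro powr_mono2) auto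
      then have "A_norm p \<alpha> ?T \<le> D powr (1 / p) * A_norm p \<alpha> f"
        using D by (simp add: A_norm_def powr_mult)
      moreover have "?T \<in> A_space p \<alpha>"
        using Thol le_less_trans[OF le DIf] by (simp add: A_space_def)
      ultimately show ?thesis by blast
     qed
     have "D powr (1 / p) > 0" using D by simp
     then show ?thesis
       unfolding toeplitz_bounded_def using t(1) fin main by blast
    qed
   qed
  qed
qed

end

section \<open>Bounded Toeplitz operators tested on powers of rho\<close>

lemma rho1_add_last: "rho1 (z + \<xi> *s axis last_ix 1) = rho1 z + Im \<xi>"
proof -
  have "(\<Sum>j\<in>UNIV - {last_ix}. (Im ((z + \<xi> *s axis last_ix 1) $ j))\<^sup>2) = (\<Sum>j\<in>UNIV - {last_ix}. (Im (z $ j))\<^sup>2)"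
    by (intro sum.cong) (auto simp: axis_def)
  then show ?thesis by (simp add: rho1_def axis_def)
qed

lemma add_last_in_T_B: "norm \<xi> < rho1 z \<Longrightarrow> z + \<xi> *s axis last_ix 1 \<in> T_B"
  using abs_Im_le_cmod[of \<xi>] by (simp add: T_B_iff rho1_add_last)

text \<open>\<rho>(w,z) is the conjugate of \<rho>(z,w), and on the right half plane the principal
  power commutes with conjugation. Equal exponents therefore make the integrand nonnegative.\<close>

lemma rho_powr_mult_cnj:
  assumes "z \<in> T_B" "w \<in> T_B"
  shows "rho z w powr of_real s * rho w z powr of_real s = of_real (norm (rho z w) powr (2 * s))"
proof -
  have "cnj (rho z w powr of_real s) = rho w z powr of_real s"
    using cnj_powr[of "rho z w" "of_real s"] Re_rho_pos[OF assms] by (simp add: cnj_rho)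
  then have "rho z w powr of_real s * rho w z powr of_real s = of_real ((norm (rho z w powr of_real s))\<^sup>2)"
    by (simp only: complex_norm_square)
  also have "(norm (rho z w powr of_real s))\<^sup>2 = norm (rho z w) powr (2 * s)"
  proof -
    have "s + s = 2 * s" by simp
    then show ?thesis by (simp only: norm_powr_of_real power2_eq_square powr_add[symmetric])
  qed
  finally show ?thesis .
qed

text \<open>|\<rho>(w,z)| dominates a multiple of |\<rho>(w,i)|, and |\<rho>(w,i)| \<ge> 1/2 allows
  the exponent s to exceed t.\<close>

lemma rho_powr_S_space:
  fixes z :: "'n::{finite,linorder} cvec"
  assumes z: "z \<in> T_B" and s: "s \<ge> t" "s > 0"
  shows "(\<lambda>w. rho w z powr of_real (- s)) \<in> S_space t"
proof (rule norm_rho_comparable[OF base_pt_in_T_B z])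
  fix C :: real assume C: "C > 0" "\<And>w. w \<in> T_B \<Longrightarrow> norm (rho base_pt w) \<le> C * norm (rho z w)"
  have "norm (rho w base_pt) powr t * norm (rho w z powr of_real (- s)) \<le> (1/2) powr (t - s) * C powr s"
    if w: "w \<in> T_B" for w
  proof -
    have p: "norm (rho w base_pt) > 0" "norm (rho w z) > 0" using norm_rho_pos[OF w] z by auto
    have "norm (rho w base_pt) / C \<le> norm (rho w z)"
      using C(2)[OF w] C(1) by (simp add: norm_rho_commute[of w] field_simps)
    then have "norm (rho w z) powr (- s) \<le> (norm (rho w base_pt) / C) powr (- s)"
      using p C(1) s by (intro powr_mono2') auto
    also have "\<dots> = C powr s * norm (rho w base_pt) powr (- s)"
      using p C(1) by (simp add: powr_divide powr_minus_divide)
    finally have "norm (rho w base_pt) powr t * norm (rho w z) powr (- s) \<le>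
       norm (rho w base_pt) powr t * (C powr s * norm (rho w base_pt) powr (- s))"
      by (rule mult_left_mono) simp
    also have "\<dots> = C powr s * norm (rho w base_pt) powr (t - s)"
      by (simp add: powr_diff powr_minus_divide)
    also have "\<dots> \<le> C powr s * (1/2) powr (t - s)"
      using norm_rho_base_ge[OF w] s by (intro mult_left_mono powr_mono2') auto
    finally show ?thesis unfolding norm_powr_of_real by (simp add: mult.commute)
  qed
  then show ?thesis
    using holomorphic_several_rho_powr[OF z] by (auto simp: S_space_def bdd_above_def)
qed

context measure_on_T_B
begin

text \<open>Each derivative multiplies by -s times -i/2, with s the current exponent, and raises the
  exponent by one; the factors s collect in the Pochhammer symbol.\<close>

lemma higher_deriv_integral_rho_powr:
  fixes s :: real and k :: nat
  assumes \<phi>: "integrable \<mu> \<phi>" and s: "s > 0" and z: "z \<in> T_B" and \<xi>: "norm \<xi> < rho1 z"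
  shows "(deriv ^^ k) (\<lambda>\<xi>. \<integral>w. rho (z + \<xi> *s axis last_ix 1) w powr of_real (- s) * \<phi> w \<partial>\<mu>) \<xi> =
     (\<i> / 2) ^ k * of_real (pochhammer s k) *
     (\<integral>w. rho (z + \<xi> *s axis last_ix 1) w powr of_real (- (s + real k)) * \<phi> w \<partial>\<mu>)"
proof -
  define H where "H s \<xi> = (\<integral>w. rho (z + \<xi> *s axis last_ix 1) w powr of_real (- s) * \<phi> w \<partial>\<mu>)" for s \<xi>
  have step: "(H s has_field_derivative (of_real s * (\<i> / 2)) * H (s + 1) \<xi>) (at \<xi>)"
    if s: "s > 0" and \<xi>: "norm \<xi> < rho1 z" for s \<xi>
  proof -
    let ?z = "z + \<xi> *s axis last_ix 1"
    have D1: "((\<lambda>\<xi>. z + \<xi> *s axis last_ix 1) has_derivative (\<lambda>h. h *s axis last_ix 1)) (at \<xi>)"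
      using bounded_linear.has_derivative[OF bounded_linear_scaleC_left has_derivative_ident]
      by (auto intro!: derivative_eq_intros)
    have "(H s has_derivative (\<lambda>h. \<integral>w. - of_real s * rho ?z w powr of_real (- s - 1) * drho ?z w (h *s axis last_ix 1) * \<phi> w \<partial>\<mu>)) (at \<xi>)"
      unfolding H_def[abs_def]
      by (rule has_derivative_compose[OF D1 has_derivative_integral_rho_powr[OF \<phi> s add_last_in_T_B[OF \<xi>]]])
    moreover have "(\<integral>w. - of_real s * rho ?z w powr of_real (- s - 1) * drho ?z w (h *s axis last_ix 1) * \<phi> w \<partial>\<mu>)
       = h * (of_real s * (\<i> / 2) * H (s + 1) \<xi>)" for h
    proof -
      have e: "- s - 1 = - (s + 1)" by simp
      have "(\<integral>w. - of_real s * rho ?z w powr of_real (- s - 1) * drho ?z w (h *s axis last_ix 1) * \<phi> w \<partial>\<mu>)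
        = (\<integral>w. (h * (of_real s * (\<i> / 2))) * (rho ?z w powr of_real (- (s + 1)) * \<phi> w) \<partial>\<mu>)"
        unfolding e by (intro Bochner_Integration.integral_cong) (simp_all add: drho_scaleC drho_axis)
      also have "\<dots> = (h * (of_real s * (\<i> / 2))) * H (s + 1) \<xi>"
        unfolding H_def by (rule integral_mult_right_zero)
      finally show ?thesis by (simp add: mult.assoc)
    qed
    ultimately show ?thesis
      by (intro has_derivative_imp_has_field_derivative) auto
  qed
  \<comment> \<open>The claim is carried on the whole disc, since the next derivative at a point
    uses the formula in a neighbourhood of it.\<close>
  have "\<forall>\<xi>. norm \<xi> < rho1 z \<longrightarrow> (deriv ^^ k) (H s) \<xi> = (\<i> / 2) ^ k * of_real (pochhammer s k) * H (s + real k) \<xi>"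
  proof (induction k)
    case (Suc k)
    show ?case
    proof (intro allI impI)
      fix \<xi> :: complex assume \<xi>: "norm \<xi> < rho1 z"
      have "((\<lambda>\<xi>. (\<i> / 2) ^ k * of_real (pochhammer s k) * H (s + real k) \<xi>) has_field_derivative
         (\<i> / 2) ^ k * of_real (pochhammer s k) * ((of_real (s + real k) * (\<i> / 2)) * H (s + real k + 1) \<xi>)) (at \<xi>)"
        using s \<xi> by (intro DERIV_cmult step) auto
      then have "((deriv ^^ k) (H s) has_field_derivative
         (\<i> / 2) ^ k * of_real (pochhammer s k) * ((of_real (s + real k) * (\<i> / 2)) * H (s + real k + 1) \<xi>)) (at \<xi>)"
        by (rule has_field_derivative_transform_within_open[where S = "ball 0 (rho1 z)"]) (use Suc \<xi> in auto)
      then have "deriv ((deriv ^^ k) (H s)) \<xi> =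
         (\<i> / 2) ^ k * of_real (pochhammer s k) * ((of_real (s + real k) * (\<i> / 2)) * H (s + real k + 1) \<xi>)"
        by (rule DERIV_imp_deriv)
      moreover have "s + real k + 1 = s + real (Suc k)" by simp
      ultimately show "(deriv ^^ Suc k) (H s) \<xi> = (\<i> / 2) ^ Suc k * of_real (pochhammer s (Suc k)) * H (s + real (Suc k)) \<xi>"
        by (simp only: funpow.simps comp_def pochhammer_Suc power_Suc of_real_mult of_real_add of_real_of_nat_eq) (simp only: ac_simps)
    qed
  qed simp
  then show ?thesis using \<xi> unfolding H_def[abs_def] by blast
qed

text \<open>The norm bound becomes a pointwise bound near z by the sub-mean value inequality, and
  Cauchy's inequality passes it on to the k-th derivative, a kernel integral to which
  \<open>emeasure_hball_le_of_kernel\<close> applies.\<close>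

lemma hball_of_toeplitz_bounded:
  fixes \<alpha> p c :: real
  assumes \<alpha>: "\<alpha> > -1" and p: "p > 1" and c: "c > 1" and T: "toeplitz_bounded p \<alpha> \<mu>"
  obtains C' :: real where "C' \<ge> 0"
    and "\<And>z. z \<in> T_B \<Longrightarrow> emeasure \<mu> (hball c z) \<le> ennreal (C' * rho1 z powr (real CARD('n) + \<alpha> + 1))"
proof -
  define N where "N = real CARD('n) + \<alpha> + 1"
  have N: "N > 0" using \<alpha> by (simp add: N_def add_pos_pos add.assoc)
  obtain t C where t: "t > real CARD('n) + (\<alpha> + 1) / p"
    and fin: "(\<integral>\<^sup>+z. ennreal (norm (rho z base_pt) powr (- t)) \<partial>\<mu>) < \<infinity>"
    and C: "C > 0" "\<And>f. f \<in> S_space t \<Longrightarrow> toeplitz \<alpha> \<mu> f \<in> A_space p \<alpha>"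
      "\<And>f. f \<in> S_space t \<Longrightarrow> A_norm p \<alpha> (toeplitz \<alpha> \<mu> f) \<le> C * A_norm p \<alpha> f"
    using T unfolding toeplitz_bounded_def by blast
  have t0: "t > 0"
  proof -
    have "(\<alpha> + 1) / p > 0" using \<alpha> p by simp
    then show ?thesis using t by (smt (verit) of_nat_0_le_iff)
  qed
  \<comment> \<open>k \<ge> t puts the test function into \<open>S_space t\<close>, and M = N + k is
    the exponent that the kernel reaches after k derivatives.\<close>
  define k where "k = nat \<lceil>t\<rceil>"
  define M where "M = N + real k"
  have k: "real k \<ge> t" unfolding k_def by (rule real_nat_ceiling_ge)
  have M: "M \<ge> t" "M > 0" "M > N" using k N t0 by (auto simp: M_def)
  have Mp: "M * p > N"
  proof -
    have "M * 1 < M * p" using M p by (intro mult_strict_left_mono) auto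
    then show ?thesis using M(3) by linarith
  qed
  obtain \<kappa> :: real where \<kappa>: "\<kappa> > 0" "\<And>z w :: 'n cvec. K_kernel \<alpha> z w = of_real \<kappa> * rho z w powr of_real (- N)"
    using K_kernel_eq[where 'n = 'n, OF \<alpha>] unfolding N_def by metis
  obtain J :: real where J: "J > 0" "\<And>z :: 'n cvec. z \<in> T_B \<Longrightarrow>
     A_norm p \<alpha> (\<lambda>w. rho w z powr of_real (- M)) powr p \<le> J * rho1 z powr (N - M * p)"
  proof (rule rho_powr_A_space[where 'n = 'n, OF \<alpha>, of p M])
    fix J :: real assume "J > 0" "\<And>z :: 'n cvec. z \<in> T_B \<Longrightarrow> (\<lambda>w. rho w z powr of_real (- M)) \<in> A_space p \<alpha> \<and>
     A_norm p \<alpha> (\<lambda>w. rho w z powr of_real (- M)) powr p \<le> J * rho1 z powr (real CARD('n) + \<alpha> + 1 - M * p)"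
    then show thesis by (intro that[of J]) (auto simp: N_def)
  qed (use p Mp in \<open>auto simp: N_def\<close>)
  obtain C2 :: real where C2: "C2 > 0"
    "\<And>(z :: 'n cvec) f. z \<in> T_B \<Longrightarrow> holomorphic_several_on f T_B \<Longrightarrow>
      ennreal (norm (f z) powr p) \<le> ennreal (C2 * rho1 z powr (- N)) *
        V_int \<alpha> (\<lambda>w. ennreal (norm (f w) powr p) * indicator (hball c z) w)"
    unfolding N_def by (rule norm_powr_submean[where 'n = 'n and \<alpha> = \<alpha> and q = p, OF _ c],
        use p in simp, rule that[unfolded N_def])
  define C3 where "C3 = C2 * 2 powr N * C powr p * J"
  define C4 where "C4 = C3 powr (1 / p)"
  define poch where "poch = pochhammer N k"
  have poch: "poch > 0" unfolding poch_def using N by (rule pochhammer_pos)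
  define C5 where "C5 = fact k * (C4 / \<kappa>) * 2 ^ k * 2 ^ k / poch"
  have C3: "C3 > 0" using C2(1) C(1) J(1) by (simp add: C3_def)
  have C5: "C5 \<ge> 0" using poch \<kappa>(1) by (simp add: C5_def C4_def)
  have main: "(\<integral>\<^sup>+w. ennreal (norm (rho z w) powr (- (2 * M))) \<partial>\<mu>) \<le> ennreal (C5 * rho1 z powr (- (2 * M) + N))"
    if z: "z \<in> T_B" for z
  proof -
    have r: "rho1 z > 0" using z by (simp add: T_B_iff)
    define f where "f w = rho w z powr of_real (- M)" for w
    have fS: "f \<in> S_space t" unfolding f_def by (rule rho_powr_S_space[OF z M(1,2)])
    have int: "integrable \<mu> f" by (rule S_space_integrable[OF fin fS])
    define F where "F = toeplitz \<alpha> \<mu> f"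
    have FA: "F \<in> A_space p \<alpha>" and FC: "A_norm p \<alpha> F \<le> C * A_norm p \<alpha> f"
      using C(2,3)[OF fS] by (auto simp: F_def)
    have Fhol: "holomorphic_several_on F T_B" using FA by (simp add: A_space_def)
    define H where "H \<xi> = (\<integral>w. rho (z + \<xi> *s axis last_ix 1) w powr of_real (- N) * f w \<partial>\<mu>)" for \<xi>
    have FH: "F (z + \<xi> *s axis last_ix 1) = of_real \<kappa> * H \<xi>" for \<xi>
      unfolding F_def toeplitz_def \<kappa>(2) H_def mult.assoc by simp
    have IF: "V_int \<alpha> (\<lambda>w. ennreal (norm (F w) powr p)) \<le>
        ennreal (C powr p * J * rho1 z powr (N - M * p))"
    proof -
      have "V_int \<alpha> (\<lambda>w. ennreal (norm (F w) powr p)) =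
         (\<integral>\<^sup>+w. ennreal (norm (F w) powr p) \<partial>V_meas \<alpha>)"
        by (rule nn_integral_V_meas[symmetric]) (rule holomorphic_several_measurable(2)[OF Fhol])
      also have "\<dots> = ennreal (A_norm p \<alpha> F powr p)"
        using p FA by (simp add: A_norm_powr A_space_def)
      also have "\<dots> \<le> ennreal (C powr p * J * rho1 z powr (N - M * p))"
      proof (rule ennreal_leI)
        have "A_norm p \<alpha> F powr p \<le> (C * A_norm p \<alpha> f) powr p"
          using FC p by (intro powr_mono2) (auto simp: A_norm_def)
        also have "\<dots> = C powr p * A_norm p \<alpha> f powr p"
          by (rule powr_mult)
        also have "\<dots> \<le> C powr p * (J * rho1 z powr (N - M * p))"
          using J(2)[OF z] unfolding f_def by (intro mult_left_mono) auto
        finally show "A_norm p \<alpha> F powr p \<le> C powr p * J * rho1 z powr (N - M * p)" by (simp add: mult.assoc)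
      qed
      finally show ?thesis .
    qed
    \<comment> \<open>The powers of \<rho>(z) combine to (-N + N - Mp)/p = -M; the factor 2^N in
      \<open>C3\<close> comes from \<rho>(\<zeta>) \<ge> \<rho>(z)/2.\<close>
    have F_le: "norm (F \<zeta>) \<le> C4 * rho1 z powr (- M)" if \<zeta>: "rho1 \<zeta> \<ge> rho1 z / 2" for \<zeta>
    proof -
      have \<zeta>T: "\<zeta> \<in> T_B" using \<zeta> r by (simp add: T_B_iff)
      have "ennreal (norm (F \<zeta>) powr p) \<le> ennreal (C2 * rho1 \<zeta> powr (- N)) *
        V_int \<alpha> (\<lambda>w. ennreal (norm (F w) powr p) * indicator (hball c \<zeta>) w)"
        by (rule C2(2)[OF \<zeta>T Fhol])
      also have "\<dots> \<le> ennreal (C2 * rho1 \<zeta> powr (- N)) *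
        V_int \<alpha> (\<lambda>w. ennreal (norm (F w) powr p))"
        by (intro mult_left_mono nn_integral_mono) (auto split: split_indicator)
      also have "\<dots> \<le> ennreal (C2 * rho1 \<zeta> powr (- N)) * ennreal (C powr p * J * rho1 z powr (N - M * p))"
        using IF by (rule mult_left_mono) simp
      also have "\<dots> = ennreal (C2 * rho1 \<zeta> powr (- N) * (C powr p * J * rho1 z powr (N - M * p)))"
        using C2(1) J(1) by (intro ennreal_mult[symmetric]) auto
      finally have "norm (F \<zeta>) powr p \<le> C2 * rho1 \<zeta> powr (- N) * (C powr p * J * rho1 z powr (N - M * p))"
        using C2(1) J(1) by (subst (asm) ennreal_le_iff) auto
      also have "\<dots> \<le> C2 * (rho1 z / 2) powr (- N) * (C powr p * J * rho1 z powr (N - M * p))"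
        using \<zeta> r N C2(1) J(1) by (intro mult_right_mono mult_left_mono powr_mono2') auto
      also have "(rho1 z / 2) powr (- N) = 2 powr N * rho1 z powr (- N)"
        using r by (simp add: powr_divide powr_minus_divide)
      also have "C2 * (2 powr N * rho1 z powr (- N)) * (C powr p * J * rho1 z powr (N - M * p)) =
         C3 * (rho1 z powr (- N) * rho1 z powr (N - M * p))"
        by (simp add: C3_def)
      also have "rho1 z powr (- N) * rho1 z powr (N - M * p) = rho1 z powr (- M * p)"
        by (simp flip: powr_add)
      finally have "(norm (F \<zeta>) powr p) powr (1 / p) \<le> (C3 * rho1 z powr (- M * p)) powr (1 / p)"
        using p by (intro powr_mono2) auto
      then show ?thesis
        using p C3 by (simp add: powr_powr powr_mult C4_def)
    qed
    \<comment> \<open>This radius keeps the closed disc inside the domain and \<rho> at least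
      \<rho>(z)/2 on it, where \<open>F_le\<close> applies.\<close>
    let ?R = "rho1 z / 2"
    have R: "?R > 0" "?R < rho1 z" using r by auto
    have H_le: "norm (H \<xi>) \<le> C4 * rho1 z powr (- M) / \<kappa>" if "norm \<xi> \<le> ?R" for \<xi>
    proof -
      have "rho1 (z + \<xi> *s axis last_ix 1) \<ge> ?R"
        using that abs_Im_le_cmod[of \<xi>] unfolding rho1_add_last by linarith
      from F_le[OF this] have "\<kappa> * norm (H \<xi>) \<le> C4 * rho1 z powr (- M)"
        unfolding FH using \<kappa>(1) by (simp add: norm_mult)
      then show ?thesis using \<kappa>(1) by (simp add: field_simps)
    qed
    have Hhol: "H holomorphic_on ball 0 (rho1 z)"
      unfolding H_def[abs_def]
      by (rule holomorphic_several_slice[OF holomorphic_several_integral_rho_powr[OF int N]])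
         (auto intro: add_last_in_T_B)
    have "norm ((deriv ^^ k) H 0) \<le> fact k * (C4 * rho1 z powr (- M) / \<kappa>) / ?R ^ k"
    proof (rule Cauchy_inequality[OF _ _ R(1)])
      show "H holomorphic_on ball 0 ?R" using R by (intro holomorphic_on_subset[OF Hhol]) auto
      show "continuous_on (cball 0 ?R) H"
        using R by (intro holomorphic_on_imp_continuous_on holomorphic_on_subset[OF Hhol]) auto
      show "norm (H \<xi>) \<le> C4 * rho1 z powr (- M) / \<kappa>" if "norm (0 - \<xi>) = ?R" for \<xi>
        using that by (intro H_le) simp
    qed
    \<comment> \<open>The kernel exponent N has risen to M, that of \<open>f\<close>, so the
      integrand is nonnegative and the modulus of the derivative is the integral itself up to a
      constant.\<close>
    moreover have "(deriv ^^ k) H 0 = (\<i> / 2) ^ k * of_real poch * (\<integral>w. of_real (norm (rho z w) powr (- (2 * M))) \<partial>\<mu>)"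
    proof -
      have "(deriv ^^ k) H 0 = (\<i> / 2) ^ k * of_real (pochhammer N k) *
         (\<integral>w. rho (z + 0 *s axis last_ix 1) w powr of_real (- (N + real k)) * f w \<partial>\<mu>)"
        unfolding H_def[abs_def] using r by (intro higher_deriv_integral_rho_powr int N z) auto
      also have "(\<integral>w. rho (z + 0 *s axis last_ix 1) w powr of_real (- (N + real k)) * f w \<partial>\<mu>) =
          (\<integral>w. of_real (norm (rho z w) powr (- (2 * M))) \<partial>\<mu>)"
      proof (rule Bochner_Integration.integral_cong[OF refl])
        fix w assume "w \<in> space \<mu>"
        then have w: "w \<in> T_B" by (simp add: space_mu)
        show "rho (z + 0 *s axis last_ix 1) w powr of_real (- (N + real k)) * f w = of_real (norm (rho z w) powr (- (2 * M)))"
          using rho_powr_mult_cnj[OF z w, of "- M"] by (simp add: f_def M_def)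
      qed
      finally show ?thesis by (simp only: poch_def)
    qed
    moreover have "(\<integral>w. complex_of_real (norm (rho z w) powr (- (2 * M))) \<partial>\<mu>) = of_real (\<integral>w. norm (rho z w) powr (- (2 * M)) \<partial>\<mu>)"
      by (rule integral_complex_of_real)
    ultimately have "(1 / 2) ^ k * poch * (\<integral>w. norm (rho z w) powr (- (2 * M)) \<partial>\<mu>) \<le> fact k * (C4 * rho1 z powr (- M) / \<kappa>) / ?R ^ k"
      using poch by (simp add: norm_mult norm_power norm_divide)
    then have "(\<integral>w. norm (rho z w) powr (- (2 * M)) \<partial>\<mu>) \<le> C5 * (rho1 z powr (- M) / rho1 z ^ k)"
      using poch \<kappa>(1) r by (simp add: C5_def power_divide field_simps)
    also have "rho1 z powr (- M) / rho1 z ^ k = rho1 z powr (- (2 * M) + N)"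
    proof -
      have "rho1 z powr (- M) / rho1 z ^ k = rho1 z powr (- M - real k)"
        using r by (simp add: powr_diff powr_realpow)
      also have "- M - real k = - (2 * M) + N" by (simp add: M_def)
      finally show ?thesis .
    qed
    finally have le: "(\<integral>w. norm (rho z w) powr (- (2 * M)) \<partial>\<mu>) \<le> C5 * rho1 z powr (- (2 * M) + N)" .
    \<comment> \<open>Without integrability the bound just proved would say nothing, since the
      Bochner integral then has the default value 0.\<close>
    have "integrable \<mu> (\<lambda>w. norm (rho z w) powr (- (2 * M)))"
    proof -
      have "integrable \<mu> (\<lambda>w. norm (rho z w powr of_real (- M) * f w))"
        using M by (intro integrable_norm integrable_rho_powr z int) auto
      also have "?this \<longleftrightarrow> ?thesis"
      proof (rule Bochner_Integration.integrable_cong[OF refl])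
        fix w assume "w \<in> space \<mu>"
        then have w: "w \<in> T_B" by (simp add: space_mu)
        show "norm (rho z w powr of_real (- M) * f w) = norm (rho z w) powr (- (2 * M))"
          unfolding f_def rho_powr_mult_cnj[OF z w] by simp
      qed
      finally show ?thesis .
    qed
    then have "(\<integral>\<^sup>+w. ennreal (norm (rho z w) powr (- (2 * M))) \<partial>\<mu>) = ennreal (\<integral>w. norm (rho z w) powr (- (2 * M)) \<partial>\<mu>)"
      by (rule nn_integral_eq_integral) simp
    also have "\<dots> \<le> ennreal (C5 * rho1 z powr (- (2 * M) + N))" by (rule ennreal_leI[OF le])
    finally show ?thesis .
  qed
  show thesis
  proof (rule that)
    show "(2 * c) powr (2 * M) * C5 \<ge> 0" using C5 by simp
    show "emeasure \<mu> (hball c z) \<le> ennreal ((2 * c) powr (2 * M) * C5 * rho1 z powr (real CARD('n) + \<alpha> + 1))"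
      if z: "z \<in> T_B" for z
      unfolding N_def[symmetric]
      by (rule emeasure_hball_le_of_kernel[OF c z _ C5 main[OF z]]) (use M in simp)
  qed
qed

end

theorem theorem6p1:
  fixes r p q \<alpha> :: real and \<mu> :: "(complex ^ 'n::{finite,linorder}) measure"
  assumes "r > 0" and "1 < p" and "0 < q" and "\<alpha> > -1" and "\<mu> \<in> M_plus"
  shows "(toeplitz_bounded p \<alpha> \<mu> \<longleftrightarrow> bounded_on_T_B (berezin \<alpha> \<mu>)) \<and>
         (bounded_on_T_B (berezin \<alpha> \<mu>) \<longleftrightarrow> bounded_on_T_B (averaging \<alpha> r \<mu>)) \<and>
         (bounded_on_T_B (averaging \<alpha> r \<mu>) \<longleftrightarrow> carleson q \<alpha> \<mu>)"
proof -
  note r = assms(1) and p = assms(2) and q = assms(3) and \<alpha> = assms(4)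
  define N where "N = real CARD('n) + \<alpha> + 1"
  have N: "N > 0" using \<alpha> by (simp add: N_def add_pos_pos add.assoc)
  interpret measure_on_T_B \<mu>
    using assms(5) by unfold_locales (simp add: M_plus_def)
  obtain t0 where fin0: "(\<integral>\<^sup>+z. ennreal (norm (rho z base_pt) powr (- t0)) \<partial>\<mu>) < \<infinity>"
    using assms(5) by (auto simp: M_plus_def)
  have sf: "sigma_finite_measure \<mu>" by (rule sigma_finite_mu[OF fin0])
  define c where "c = (cosh r)\<^sup>2"
  have c: "c > 1"
    using r cosh_square_eq[of r] by (simp add: c_def)
  \<comment> \<open>The pivot of the equivalences: as balls have volume a constant times
    \<rho>(z)^N, this is boundedness of the averages, free of division in
    \<open>ennreal\<close>.\<close>
  define AVG where "AVG \<longleftrightarrow> (\<exists>C\<ge>0. \<forall>z\<in>T_B. emeasure \<mu> (hball c z) \<le> ennreal (C * rho1 z powr N))"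
  have averaging: "bounded_on_T_B (averaging \<alpha> r \<mu>) \<longleftrightarrow> AVG"
  proof (rule emeasure_V_meas_hball[where 'n = 'n, OF \<alpha> c])
    fix v :: real assume v: "v > 0" "\<And>z :: 'n cvec. z \<in> T_B \<Longrightarrow> emeasure (V_meas \<alpha>) (hball c z) = ennreal (v * rho1 z powr (real CARD('n) + \<alpha> + 1))"
    have eq: "averaging \<alpha> r \<mu> z = emeasure \<mu> (hball c z) / ennreal (v * rho1 z powr N)" if "z \<in> T_B" for z
      unfolding averaging_def D_ball_eq_hball[OF that r] c_def[symmetric] v(2)[OF that] N_def ..
    have pos: "v * rho1 z powr N > 0" if "z \<in> T_B" for z :: "'n cvec" using that v(1) by (simp add: T_B_iff)
    show ?thesis
    proof
      assume "bounded_on_T_B (averaging \<alpha> r \<mu>)"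
      then obtain C where C0: "\<And>z. z \<in> T_B \<Longrightarrow> averaging \<alpha> r \<mu> z \<le> ennreal C"
        by (auto simp: bounded_on_T_B_def)
      \<comment> \<open>The bound in \<open>bounded_on_T_B\<close> is any real, and
        \<open>ennreal\<close> sends negative ones to 0; the maximum gives a nonnegative
        constant.\<close>
      have C: "averaging \<alpha> r \<mu> z \<le> ennreal (max C 0)" if "z \<in> T_B" for z
        by (rule order_trans[OF C0[OF that]]) (simp add: ennreal_leI)
      have "emeasure \<mu> (hball c z) \<le> ennreal (max C 0 * v * rho1 z powr N)" if z: "z \<in> T_B" for z
      proof -
        have "emeasure \<mu> (hball c z) = emeasure \<mu> (hball c z) / ennreal (v * rho1 z powr N) * ennreal (v * rho1 z powr N)"
        proof -
          have "ennreal (v * rho1 z powr N) / ennreal (v * rho1 z powr N) = 1"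
            using pos[OF z] by (intro ennreal_divide_self) auto
          then show ?thesis by (simp add: ennreal_divide_times)
        qed
        also have "\<dots> \<le> ennreal (max C 0) * ennreal (v * rho1 z powr N)"
          using C[OF z] unfolding eq[OF z] by (rule mult_right_mono) simp
        finally show ?thesis using v(1) by (simp add: mult.assoc flip: ennreal_mult)
      qed
      then show AVG unfolding AVG_def using v(1) by (intro exI[of _ "max C 0 * v"]) auto
    next
      assume AVG
      then obtain C where C: "C \<ge> 0" "\<And>z. z \<in> T_B \<Longrightarrow> emeasure \<mu> (hball c z) \<le> ennreal (C * rho1 z powr N)"
        by (auto simp: AVG_def)
      have "averaging \<alpha> r \<mu> z \<le> ennreal (C / v)" if z: "z \<in> T_B" for z
      proof -
        have "averaging \<alpha> r \<mu> z \<le> ennreal (C * rho1 z powr N) / ennreal (v * rho1 z powr N)"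
          unfolding eq[OF z] using C(2)[OF z] by (rule divide_right_mono_ennreal)
        also have "\<dots> = ennreal (C / v)"
          using C(1) pos[OF z] z by (subst divide_ennreal) (auto simp: T_B_iff)
        finally show ?thesis .
      qed
      then show "bounded_on_T_B (averaging \<alpha> r \<mu>)" by (auto simp: bounded_on_T_B_def)
    qed
  qed
  have AVG_carleson: "carleson q \<alpha> \<mu>" if avg: AVG
  proof -
    obtain C where C: "C \<ge> 0" "\<And>z. z \<in> T_B \<Longrightarrow> emeasure \<mu> (hball c z) \<le> ennreal (C * rho1 z powr (real CARD('n) + \<alpha> + 1))"
      using avg by (auto simp: AVG_def N_def)
    show ?thesis
    proof (rule carleson_of_hball[OF sf q c C(1) \<alpha> C(2)])
      fix C' :: real assume C': "C' > 0" "\<And>f. holomorphic_several_on f T_B \<Longrightarrow>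
        (\<integral>\<^sup>+z. ennreal (norm (f z) powr q) \<partial>\<mu>) \<le>
         ennreal C' * V_int \<alpha> (\<lambda>w. ennreal (norm (f w) powr q))"
      have "(\<integral>\<^sup>+z. ennreal (norm (f z) powr q) \<partial>\<mu>) \<le> ennreal (C' * A_norm q \<alpha> f powr q)" if f: "f \<in> A_space q \<alpha>" for f
      proof -
        have hol: "holomorphic_several_on f T_B" and If: "(\<integral>\<^sup>+z. ennreal (norm (f z) powr q) \<partial>V_meas \<alpha>) < \<infinity>"
          using f by (auto simp: A_space_def)
        have "(\<integral>\<^sup>+z. ennreal (norm (f z) powr q) \<partial>\<mu>) \<le> ennreal C' * (\<integral>\<^sup>+z. ennreal (norm (f z) powr q) \<partial>V_meas \<alpha>)"
          unfolding nn_integral_V_meas[OF holomorphic_several_measurable(2)[OF hol]] by (rule C'(2)[OF hol])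
        also have "\<dots> = ennreal (C' * A_norm q \<alpha> f powr q)"
          using If C'(1) unfolding A_norm_powr[OF q] by (simp add: ennreal_mult)
        finally show ?thesis .
      qed
      then show ?thesis using C'(1) by (auto simp: carleson_def)
    qed
  qed
  have berezin: "bounded_on_T_B (berezin \<alpha> \<mu>) \<longleftrightarrow>
    (\<exists>C\<ge>0. \<forall>z\<in>T_B. (\<integral>\<^sup>+w. ennreal (norm (rho z w) powr (- (2 * N))) \<partial>\<mu>) \<le> ennreal (C * rho1 z powr (- (2 * N) + N)))"
    (is "_ \<longleftrightarrow> ?K")
  proof (rule norm_k_normalized[where 'n = 'n, OF \<alpha>])
    note [measurable] = measurable_ident_mu
    fix \<kappa> :: real assume \<kappa>: "\<kappa> > 0" "\<And>z w :: 'n cvec. z \<in> T_B \<Longrightarrow> (norm (k_normalized \<alpha> z w))\<^sup>2 =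
      \<kappa> * rho1 z powr (real CARD('n) + \<alpha> + 1) * norm (rho z w) powr (- 2 * (real CARD('n) + \<alpha> + 1))"
    define I where "I z = (\<integral>\<^sup>+w. ennreal (norm (rho z w) powr (- (2 * N))) \<partial>\<mu>)" for z
    have eq: "berezin \<alpha> \<mu> z = ennreal (\<kappa> * rho1 z powr N) * I z" if z: "z \<in> T_B" for z
    proof -
      have "berezin \<alpha> \<mu> z = (\<integral>\<^sup>+w. ennreal (\<kappa> * rho1 z powr N) * ennreal (norm (rho z w) powr (- (2 * N))) \<partial>\<mu>)"
        unfolding berezin_def \<kappa>(2)[OF z] N_def[symmetric] using \<kappa>(1)
        by (intro nn_integral_cong) (simp add: ennreal_mult)
      also have "\<dots> = ennreal (\<kappa> * rho1 z powr N) * I z"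
        unfolding I_def by (rule nn_integral_cmult) measurable
      finally show ?thesis .
    qed
    have e: "- (2 * N) + N = - N" by simp
    have inv: "rho1 z powr N * rho1 z powr (- N) = 1" if "z \<in> T_B" for z :: "'n cvec"
      using that by (simp add: T_B_iff flip: powr_add)
    show ?thesis
    proof
      assume "bounded_on_T_B (berezin \<alpha> \<mu>)"
      then obtain C where C0: "\<And>z. z \<in> T_B \<Longrightarrow> berezin \<alpha> \<mu> z \<le> ennreal C"
        by (auto simp: bounded_on_T_B_def)
      have C: "berezin \<alpha> \<mu> z \<le> ennreal (max C 0)" if "z \<in> T_B" for z
        by (rule order_trans[OF C0[OF that]]) (simp add: ennreal_leI)
      have "I z \<le> ennreal (max C 0 / \<kappa> * rho1 z powr (- N))" if z: "z \<in> T_B" for z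
      proof -
        have 1: "(rho1 z powr (- N) / \<kappa>) * (\<kappa> * rho1 z powr N) = 1"
          using inv[OF z] \<kappa>(1) by (simp add: mult.commute)
        have "I z = ennreal ((rho1 z powr (- N) / \<kappa>) * (\<kappa> * rho1 z powr N)) * I z" unfolding 1 by simp
        also have "\<dots> = ennreal (rho1 z powr (- N) / \<kappa>) * berezin \<alpha> \<mu> z"
          unfolding eq[OF z] using \<kappa>(1) by (subst ennreal_mult) (auto simp: mult.assoc)
        also have "\<dots> \<le> ennreal (rho1 z powr (- N) / \<kappa>) * ennreal (max C 0)"
          using C[OF z] by (rule mult_left_mono) simp
        also have "\<dots> = ennreal (max C 0 / \<kappa> * rho1 z powr (- N))"
          using \<kappa>(1) by (subst ennreal_mult[symmetric]) (auto simp: mult.commute)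
        finally show ?thesis .
      qed
      then show ?K unfolding e I_def[symmetric] using \<kappa>(1) by (intro exI[of _ "max C 0 / \<kappa>"]) auto
    next
      assume ?K
      then obtain C where C: "C \<ge> 0" "\<And>z. z \<in> T_B \<Longrightarrow> I z \<le> ennreal (C * rho1 z powr (- N))"
        unfolding e I_def[symmetric] by blast
      have "berezin \<alpha> \<mu> z \<le> ennreal (\<kappa> * C)" if z: "z \<in> T_B" for z
      proof -
        have "berezin \<alpha> \<mu> z \<le> ennreal (\<kappa> * rho1 z powr N) * ennreal (C * rho1 z powr (- N))"
          unfolding eq[OF z] using C(2)[OF z] by (rule mult_left_mono) simp
        also have "\<dots> = ennreal (\<kappa> * C * (rho1 z powr N * rho1 z powr (- N)))"
          using C(1) \<kappa>(1) by (subst ennreal_mult[symmetric]) (auto simp: mult_ac)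
        finally show ?thesis unfolding inv[OF z] by simp
      qed
      then show "bounded_on_T_B (berezin \<alpha> \<mu>)" by (auto simp: bounded_on_T_B_def)
    qed
  qed
  have carleson_berezin: "bounded_on_T_B (berezin \<alpha> \<mu>)" if carl: "carleson q \<alpha> \<mu>"
  proof -
    obtain C where C: "C > 0" "\<And>f. f \<in> A_space q \<alpha> \<Longrightarrow> (\<integral>\<^sup>+z. ennreal (norm (f z) powr q) \<partial>\<mu>) \<le> ennreal (C * A_norm q \<alpha> f powr q)"
      using carl unfolding carleson_def by blast
    \<comment> \<open>With the exponent 2N/q the q-th power of the modulus of the test function is
      the Berezin integrand |\<rho>(z,w)|^(-2N), and 2N > N places the function in the
      space.\<close>
    have "2 * N / q * q > real CARD('n) + \<alpha> + 1" using q N by (simp add: N_def)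
    then show ?thesis
    proof (rule rho_powr_A_space[where 'n = 'n, OF \<alpha> q])
      fix J :: real assume J: "J > 0" "\<And>z :: 'n cvec. z \<in> T_B \<Longrightarrow> (\<lambda>w. rho w z powr of_real (- (2 * N / q))) \<in> A_space q \<alpha> \<and>
        A_norm q \<alpha> (\<lambda>w. rho w z powr of_real (- (2 * N / q))) powr q \<le> J * rho1 z powr (real CARD('n) + \<alpha> + 1 - 2 * N / q * q)"
      have "(\<integral>\<^sup>+w. ennreal (norm (rho z w) powr (- (2 * N))) \<partial>\<mu>) \<le> ennreal (C * J * rho1 z powr (- (2 * N) + N))" if z: "z \<in> T_B" for z
      proof -
        let ?f = "\<lambda>w. rho w z powr of_real (- (2 * N / q))"
        have "(\<integral>\<^sup>+w. ennreal (norm (rho z w) powr (- (2 * N))) \<partial>\<mu>) = (\<integral>\<^sup>+w. ennreal (norm (?f w) powr q) \<partial>\<mu>)"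
          unfolding norm_powr_of_real powr_powr norm_rho_commute[of z] using q by simp
        also have "\<dots> \<le> ennreal (C * A_norm q \<alpha> ?f powr q)" using J(2)[OF z] by (intro C(2)) blast
        also have "\<dots> \<le> ennreal (C * (J * rho1 z powr (real CARD('n) + \<alpha> + 1 - 2 * N / q * q)))"
          using J(2)[OF z] C(1) by (intro ennreal_leI mult_left_mono) auto
        also have "real CARD('n) + \<alpha> + 1 - 2 * N / q * q = - (2 * N) + N" using q by (simp add: N_def)
        finally show ?thesis by (simp only: mult.assoc)
      qed
      then show ?thesis unfolding berezin using C(1) J(1) by (intro exI[of _ "C * J"]) auto
    qed
  qed
  have berezin_AVG: AVG if ber: "bounded_on_T_B (berezin \<alpha> \<mu>)"
  proof -
    obtain C where C: "C \<ge> 0" "\<And>z. z \<in> T_B \<Longrightarrow> (\<integral>\<^sup>+w. ennreal (norm (rho z w) powr (- (2 * N))) \<partial>\<mu>) \<le> ennreal (C * rho1 z powr (- (2 * N) + N))"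
      using ber unfolding berezin by blast
    have "emeasure \<mu> (hball c z) \<le> ennreal ((2 * c) powr (2 * N) * C * rho1 z powr N)" if "z \<in> T_B" for z
      by (rule emeasure_hball_le_of_kernel[OF c that _ C(1) C(2)[OF that]]) (use N in simp)
    then show ?thesis unfolding AVG_def using C(1) by (intro exI[of _ "(2 * c) powr (2 * N) * C"]) auto
  qed
  have AVG_toeplitz: "toeplitz_bounded p \<alpha> \<mu>" if AVG
    using that toeplitz_bounded_of_hball[OF \<alpha> p c _ fin0] by (auto simp: AVG_def N_def)
  have toeplitz_AVG: AVG if "toeplitz_bounded p \<alpha> \<mu>"
    by (rule hball_of_toeplitz_bounded[OF \<alpha> p c that]) (auto simp: AVG_def N_def)
  \<comment> \<open>The implications run in a cycle from \<open>AVG\<close> to Carleson to Berezin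
    and back to \<open>AVG\<close>; the Toeplitz condition is tied to \<open>AVG\<close> in both
    directions.\<close>
  show ?thesis
    using averaging AVG_carleson carleson_berezin berezin_AVG AVG_toeplitz toeplitz_AVG by blast
qed

end
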